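(* Assume Smoothness, Stochastic oracle, Network topology and Gradient dissimilarity (all defined in the context). Let $\mu_k=\mu_0(k+1)^{-p}$ with $\mu_0>0$, $p\in(0,1/4)$, and let $\gamma\in(0,\frac{1}{2L_2})$. Choose the learning rates $\lambda_\theta^k=c_\theta n^{1/2}K^{-1/2}$, $\lambda_x^k=\lambda_y^k=c_\lambda\lambda_\theta^k$ for $k=0,\dots,K-1$, where $c_\theta,c_\lambda$ are positive constants such that the step-size conditions listed in the context hold. Then the iterates of SUN-DSBO-SE satisfy $$\frac1K\sum_{k=0}^{K-1}\mathbb{E}\|\nabla\Psi_{\mu_k}(\bar x^k,\bar y^k)\|^2=\mathcal{O}\Big(\frac{\mathcal{C}_1}{n^{1/2}K^{1/2}}\Big)+\mathcal{O}\Big(\frac{n(\delta_f^2+\delta_g^2)}{(1-\rho)^2K}\Big)+\mathcal{O}\Big(\frac{n(\sigma_f^2+\sigma_g^2)}{(1-\rho)^2K}\Big),$$ where $\mathcal{C}_1$ is a positive constant depending on $\delta_f^2,\delta_g^2,\sigma_f^2,\sigma_g^2$ but independent of $n$ and $1-\rho$.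
   Context: **Problem.** There are $n$ agents; $[n]=\{1,\dots,n\}$. For $i\in[n]$, $f_i(x,y)=\mathbb{E}_{\xi_{f,i}}[f_i(x,y;\xi_{f,i})]$ and $g_i(x,y)=\mathbb{E}_{\xi_{g,i}}[g_i(x,y;\xi_{g,i})]$ are real functions on $\mathbb{R}^{d_x}\times\mathbb{R}^{d_y}$; $F=\frac1n\sum_i f_i$, $G=\frac1n\sum_i g_i$, and $F$ is bounded below by $\underline{F}$. For $\gamma>0$, $V_\gamma(x,y)=\min_{\theta\in\mathbb{R}^{d_y}}\{G(x,\theta)+\frac1{2\gamma}\|\theta-y\|^2\}$, with unique minimizer $\theta_\gamma^*(x,y)$ when $\gamma\in(0,\frac1{2L_2})$; $\Psi_\mu(x,y)=\mu F(x,y)+G(x,y)-V_\gamma(x,y)$. **Assumptions.** *Smoothness*: each $f_i$, $g_i$ is continuously differentiable, $f_i$ is $L_1$-smooth and $g_i$ is $L_2$-smooth (Lipschitz gradient in $(x,y)$). *Stochastic oracle*: with i.i.d. samples, $\nabla f_i(x,y;\xi_{f,i})$ and $\nabla g_i(x,y;\xi_{g,i})$ are unbiased estimators of $\nabla f_i(x,y)$, $\nabla g_i(x,y)$ with variances $\mathbb{E}\|\cdot\|^2$ of the error at most $\delta_f^2$ and $\delta_g^2$. *Network topology*: $\mathbf{W}=(w_{ij})\in\mathbb{R}^{n\times n}$ is non-negative, symmetric, doubly stochastic, with eigenvalues $1=\lambda_1>\lambda_2\ge\dots\ge\lambda_n$ and $\rho:=\max\{|\lambda_2|,|\lambda_n|\}<1$.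 *Gradient dissimilarity*: there are $\sigma_f,\sigma_g\ge0$ with $\frac1n\sum_i\|\nabla f_i(x,y)-\nabla F(x,y)\|^2\le\sigma_f^2$ and $\frac1n\sum_i\|\nabla g_i(x,y)-\nabla G(x,y)\|^2\le\sigma_g^2$ for all $(x,y)$. **Algorithm SUN-DSBO-SE.** From initial points $\theta_i^0,x_i^0,y_i^0$, for $k=0,\dots,K-1$ each agent $i$ draws fresh samples $\xi_{g,i}^k,\xi_{f,i}^k$ and computes $$\hat D_{\theta,i}^k=\nabla_yg_i(x_i^k,\theta_i^k;\xi_{g,i}^k)+\tfrac1\gamma(\theta_i^k-y_i^k),$$ $$\hat D_{x,i}^k=\mu_k\nabla_xf_i(x_i^k,y_i^k;\xi_{f,i}^k)+\nabla_xg_i(x_i^k,y_i^k;\xi_{g,i}^k)-\nabla_xg_i(x_i^k,\theta_i^k;\xi_{g,i}^k),$$ $$\hat D_{y,i}^k=\mu_k\nabla_yf_i(x_i^k,y_i^k;\xi_{f,i}^k)+\nabla_yg_i(x_i^k,y_i^k;\xi_{g,i}^k)-\tfrac1\gamma(y_i^k-\theta_i^k),$$ and sets $\Diamond_i^{k+1}=\sum_{j=1}^nw_{ij}(\Diamond_j^k-\lambda_\Diamond^k\hat D_{\Diamond,j}^k)$ for $\Diamond\in\{\theta,x,y\}$. Averages: $\bar\Diamond^k=\frac1n\sum_i\Diamond_i^k$. **Step-size conditions.** Let $L_\theta>0$ be a Lipschitz constant of $\theta_\gamma^*$, $\eta=\frac1\gamma-L_2$, $L_{\Phi_\infty}=L_2+\min\{L_2,\frac1\gamma\}$,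 $a_1=\frac1{2L_\theta}\sqrt{L_2^2+\gamma^{-2}}$, $$\tau_2=2\,\frac{3(\mu_0L_1^2+2L_2^2)c_\lambda+4(\mu_0L_1^2+L_2^2)c_\lambda+\frac{12a_1}{\eta}L_2^2}{c_\lambda(1-\rho)},$$ $$\tau_3=2\,\frac{3(\mu_0L_1^2+L_2^2)c_\lambda+4(\mu_0L_1^2+L_2^2+\gamma^{-2})c_\lambda+\frac{12a_1}{\eta}\gamma^{-2}}{c_\lambda(1-\rho)},$$ $$\tau_4=2\,\frac{3L_2^2c_\lambda+4\gamma^{-2}c_\lambda+\frac{12a_1}{\eta}(L_2^2+\gamma^{-2})}{c_\lambda(1-\rho)}.$$ The conditions are: $c_\lambda\le\frac{\eta}{32a_1L_\theta^2}$, $\lambda_\theta^k\le\frac4{3\eta}$, $\lambda_\theta^k\le\frac{4a_1L_\theta^2}{\eta L_{\Phi_\infty}}$, $\lambda_\theta^k\le\frac{\tau_2c_\lambda(1-\rho)^2}{192a_1L_2^2}$, $\lambda_\theta^k\le\frac{\tau_3c_\lambda(1-\rho)^2}{192a_1\gamma^{-2}}$, $\lambda_\theta^k\le\frac{\tau_4c_\lambda(1-\rho)^2}{192a_1(L_2^2+\gamma^{-2})}$. **Convention.** $\mathcal{O}(\cdot)$ hides constants independent of $K$, $n$, $1-\rho$, $\delta_f,\delta_g,\sigma_f,\sigma_g$ (they may depend on $L_1,L_2,\gamma,\mu_0,c_\theta,c_\lambda$). *)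

theory Defs
  imports
    "HOL-Probability.Probability"
    "Jordan_Normal_Form.Char_Poly"
begin

text \<open>
  Agents are numbered \<open>0, \<dots>, n - 1\<close>.  A function on
  $\mathbf{R}^{d_x} \times \mathbf{R}^{d_y}$ is a function on the product \<open>'x \<times> 'y\<close> of two
  Euclidean spaces, whose norm and inner product are the Euclidean ones; the partial gradients
  with respect to \<open>x\<close> and \<open>y\<close> are the two components of the gradient.
\<close>

definition grad :: "('a::real_inner \<Rightarrow> real) \<Rightarrow> 'a \<Rightarrow> 'a" where
  "grad h z = (THE D. GDERIV h z :> D)"

definition mean :: "nat \<Rightarrow> (nat \<Rightarrow> 'a::real_vector) \<Rightarrow> 'a" where
  "mean n v = (1 / real n) *\<^sub>R (\<Sum>i<n. v i)"


subsection \<open>Proximal envelope and penalized objective\<close>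

definition prox_obj ::
  "real \<Rightarrow> ('x \<times> 'y \<Rightarrow> real) \<Rightarrow> 'x \<times> 'y \<Rightarrow> 'y::euclidean_space \<Rightarrow> real" where
  "prox_obj \<gamma> G z \<theta> = G (fst z, \<theta>) + 1 / (2 * \<gamma>) * (norm (\<theta> - snd z))\<^sup>2"

text \<open>
  The infimum below is the minimum, attained only at \<open>theta_star \<gamma> G z\<close>, whenever the gradient
  of \<open>G\<close> is \<open>L\<^sub>2\<close>-Lipschitz and \<open>0 < \<gamma> < 1 / (2 * L\<^sub>2)\<close>: the proximal objective is
  then strongly convex in \<open>\<theta>\<close>.
\<close>

definition V_env ::
  "real \<Rightarrow> ('x \<times> 'y \<Rightarrow> real) \<Rightarrow> 'x \<times> 'y::euclidean_space \<Rightarrow> real" where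
  "V_env \<gamma> G z = (INF \<theta>. prox_obj \<gamma> G z \<theta>)"

definition theta_star ::
  "real \<Rightarrow> ('x \<times> 'y \<Rightarrow> real) \<Rightarrow> 'x \<times> 'y \<Rightarrow> 'y::euclidean_space" where
  "theta_star \<gamma> G z = (ARG_MIN (prox_obj \<gamma> G z) \<theta>. True)"

definition Psi ::
  "real \<Rightarrow> ('x \<times> 'y \<Rightarrow> real) \<Rightarrow> ('x \<times> 'y \<Rightarrow> real) \<Rightarrow> real \<Rightarrow> 'x \<times> 'y::euclidean_space \<Rightarrow> real" where
  "Psi \<gamma> F G \<mu> z = \<mu> * F z + G z - V_env \<gamma> G z"


subsection \<open>Assumptions\<close>

definition smooth_fun :: "real \<Rightarrow> ('a::euclidean_space \<Rightarrow> real) \<Rightarrow> bool" where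
  "smooth_fun L h \<longleftrightarrow>
     (\<forall>z. h differentiable (at z)) \<and> continuous_on UNIV (grad h) \<and>
     L-lipschitz_on UNIV (grad h)"

text \<open>
  \<open>S\<close> is the law of a sample and \<open>hs s\<close> the sample function \<open>h(\<cdot>; s)\<close>.  Integrability is
  stated explicitly because the Bochner integral of a non-integrable function is \<open>0\<close>.
\<close>

definition stochastic_oracle ::
  "'s measure \<Rightarrow> ('s \<Rightarrow> 'a::euclidean_space \<Rightarrow> real) \<Rightarrow> ('a \<Rightarrow> real) \<Rightarrow> real \<Rightarrow> bool" where
  "stochastic_oracle S hs h \<delta> \<longleftrightarrow>
     prob_space S \<and>
     (\<forall>z. integrable S (\<lambda>s. hs s z) \<and> h z = (\<integral>s. hs s z \<partial>S)) \<and>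
     (\<forall>s\<in>space S. \<forall>z. hs s differentiable (at z)) \<and>
     (\<forall>z. integrable S (\<lambda>s. grad (hs s) z) \<and> (\<integral>s. grad (hs s) z \<partial>S) = grad h z) \<and>
     (\<forall>z. integrable S (\<lambda>s. (norm (grad (hs s) z - grad h z))\<^sup>2) \<and>
          (\<integral>s. (norm (grad (hs s) z - grad h z))\<^sup>2 \<partial>S) \<le> \<delta>\<^sup>2)"

text \<open>
  \<open>ev 1, \<dots>, ev n\<close> are the eigenvalues in decreasing order, with multiplicity.  For \<open>n = 1\<close>
  the predicate is unsatisfiable, since then \<open>ev n = ev 1 = 1\<close> forces \<open>\<rho> \<ge> 1\<close>.
\<close>

definition network_topology :: "nat \<Rightarrow> real mat \<Rightarrow> real \<Rightarrow> bool" where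
  "network_topology n W \<rho> \<longleftrightarrow>
     W \<in> carrier_mat n n \<and>
     (\<forall>i<n. \<forall>j<n. 0 \<le> W $$ (i, j)) \<and>
     transpose_mat W = W \<and>
     (\<forall>i<n. (\<Sum>j<n. W $$ (i, j)) = 1) \<and>
     (\<forall>j<n. (\<Sum>i<n. W $$ (i, j)) = 1) \<and>
     (\<exists>ev :: nat \<Rightarrow> real.
        char_poly W = (\<Prod>i\<in>{1..n}. [:- ev i, 1:]) \<and>
        ev 1 = 1 \<and> ev 2 < 1 \<and> (\<forall>i\<in>{2..n}. \<forall>j\<in>{i..n}. ev j \<le> ev i) \<and>
        \<rho> = max \<bar>ev 2\<bar> \<bar>ev n\<bar>) \<and>
     \<rho> < 1"

definition gradient_dissimilarity ::
  "nat \<Rightarrow> (nat \<Rightarrow> 'a::euclidean_space \<Rightarrow> real) \<Rightarrow> real \<Rightarrow> bool" where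
  "gradient_dissimilarity n h \<sigma> \<longleftrightarrow>
     0 \<le> \<sigma> \<and>
     (\<forall>z. mean n (\<lambda>i. (norm (grad (h i) z - grad (\<lambda>z'. mean n (\<lambda>j. h j z')) z))\<^sup>2) \<le> \<sigma>\<^sup>2)"


subsection \<open>The algorithm SUN-DSBO-SE\<close>

text \<open>In the three directions \<open>f\<close> and \<open>g\<close> are the sample functions of one agent.\<close>

definition dir_theta ::
  "real \<Rightarrow> ('x::euclidean_space \<times> 'y::euclidean_space \<Rightarrow> real) \<Rightarrow> 'x \<Rightarrow> 'y \<Rightarrow> 'y \<Rightarrow> 'y" where
  "dir_theta \<gamma> g x y \<theta> = snd (grad g (x, \<theta>)) + (1 / \<gamma>) *\<^sub>R (\<theta> - y)"

definition dir_x ::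
  "real \<Rightarrow> ('x::euclidean_space \<times> 'y::euclidean_space \<Rightarrow> real) \<Rightarrow> ('x \<times> 'y \<Rightarrow> real) \<Rightarrow>
   'x \<Rightarrow> 'y \<Rightarrow> 'y \<Rightarrow> 'x" where
  "dir_x \<mu> f g x y \<theta> = \<mu> *\<^sub>R fst (grad f (x, y)) + fst (grad g (x, y)) - fst (grad g (x, \<theta>))"

definition dir_y ::
  "real \<Rightarrow> real \<Rightarrow> ('x::euclidean_space \<times> 'y::euclidean_space \<Rightarrow> real) \<Rightarrow> ('x \<times> 'y \<Rightarrow> real) \<Rightarrow>
   'x \<Rightarrow> 'y \<Rightarrow> 'y \<Rightarrow> 'y" where
  "dir_y \<gamma> \<mu> f g x y \<theta> =
     \<mu> *\<^sub>R snd (grad f (x, y)) + snd (grad g (x, y)) - (1 / \<gamma>) *\<^sub>R (y - \<theta>)"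

definition gossip :: "nat \<Rightarrow> real mat \<Rightarrow> nat \<Rightarrow> (nat \<Rightarrow> 'a::real_vector) \<Rightarrow> 'a" where
  "gossip n W i v = (\<Sum>j<n. (W $$ (i, j)) *\<^sub>R v j)"

text \<open>
  One run of \<open>K\<close> iterations for realized samples \<open>sf k i\<close> and \<open>sg k i\<close>; the first argument of
  the trajectories is the iteration, the second the agent.
\<close>

definition sun_dsbo_se ::
  "nat \<Rightarrow> nat \<Rightarrow> real mat \<Rightarrow> real \<Rightarrow>
   (nat \<Rightarrow> real) \<Rightarrow> (nat \<Rightarrow> real) \<Rightarrow> (nat \<Rightarrow> real) \<Rightarrow> (nat \<Rightarrow> real) \<Rightarrow>
   (nat \<Rightarrow> 's \<Rightarrow> 'x::euclidean_space \<times> 'y::euclidean_space \<Rightarrow> real) \<Rightarrow>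
   (nat \<Rightarrow> 's \<Rightarrow> 'x \<times> 'y \<Rightarrow> real) \<Rightarrow>
   (nat \<Rightarrow> nat \<Rightarrow> 's) \<Rightarrow> (nat \<Rightarrow> nat \<Rightarrow> 's) \<Rightarrow>
   (nat \<Rightarrow> 'y) \<Rightarrow> (nat \<Rightarrow> 'x) \<Rightarrow> (nat \<Rightarrow> 'y) \<Rightarrow>
   (nat \<Rightarrow> nat \<Rightarrow> 'y) \<Rightarrow> (nat \<Rightarrow> nat \<Rightarrow> 'x) \<Rightarrow> (nat \<Rightarrow> nat \<Rightarrow> 'y) \<Rightarrow> bool" where
  "sun_dsbo_se n K W \<gamma> \<mu> lam_theta lam_x lam_y fs gs sf sg \<theta>0 x0 y0 \<theta> x y \<longleftrightarrow>
     (\<forall>i<n. \<theta> 0 i = \<theta>0 i \<and> x 0 i = x0 i \<and> y 0 i = y0 i) \<and>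
     (\<forall>k<K. \<forall>i<n.
        \<theta> (Suc k) i = gossip n W i (\<lambda>j. \<theta> k j -
          lam_theta k *\<^sub>R dir_theta \<gamma> (gs j (sg k j)) (x k j) (y k j) (\<theta> k j)) \<and>
        x (Suc k) i = gossip n W i (\<lambda>j. x k j -
          lam_x k *\<^sub>R dir_x (\<mu> k) (fs j (sf k j)) (gs j (sg k j)) (x k j) (y k j) (\<theta> k j)) \<and>
        y (Suc k) i = gossip n W i (\<lambda>j. y k j -
          lam_y k *\<^sub>R dir_y \<gamma> (\<mu> k) (fs j (sf k j)) (gs j (sg k j)) (x k j) (y k j) (\<theta> k j)))"

text \<open>
  Fresh sampling: the \<open>2 * K * n\<close> samples are mutually independent, and those of agent \<open>i\<close> have
  the laws \<open>Sf i\<close> and \<open>Sg i\<close> in every iteration.  The left (right) summand of the index set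
  carries the samples for the upper (lower) level functions.
\<close>

definition fresh_samples ::
  "'w measure \<Rightarrow> nat \<Rightarrow> nat \<Rightarrow> (nat \<Rightarrow> 's measure) \<Rightarrow> (nat \<Rightarrow> 's measure) \<Rightarrow>
   (nat \<Rightarrow> nat \<Rightarrow> 'w \<Rightarrow> 's) \<Rightarrow> (nat \<Rightarrow> nat \<Rightarrow> 'w \<Rightarrow> 's) \<Rightarrow> bool" where
  "fresh_samples M n K Sf Sg \<xi>f \<xi>g \<longleftrightarrow>
     prob_space M \<and>
     prob_space.indep_vars M
       (case_sum (\<lambda>(k, i). Sf i) (\<lambda>(k, i). Sg i))
       (case_sum (\<lambda>(k, i). \<xi>f k i) (\<lambda>(k, i). \<xi>g k i))
       (({..<K} \<times> {..<n}) <+> ({..<K} \<times> {..<n})) \<and>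
     (\<forall>k<K. \<forall>i<n. distr M (Sf i) (\<xi>f k i) = Sf i \<and> distr M (Sg i) (\<xi>g k i) = Sg i)"


subsection \<open>Step-size conditions and initial gap\<close>

definition step_size_conditions ::
  "real \<Rightarrow> real \<Rightarrow> real \<Rightarrow> real \<Rightarrow> real \<Rightarrow> real \<Rightarrow> real \<Rightarrow> real \<Rightarrow> bool" where
  "step_size_conditions L1 L2 \<gamma> \<mu>0 c_lam L\<theta> \<rho> lam \<longleftrightarrow>
     (let \<eta> = 1 / \<gamma> - L2;
          L\<Phi> = L2 + min L2 (1 / \<gamma>);
          g2 = 1 / \<gamma>\<^sup>2;
          a1 = 1 / (2 * L\<theta>) * sqrt (L2\<^sup>2 + g2);
          \<tau>2 = 2 * ((3 * (\<mu>0 * L1\<^sup>2 + 2 * L2\<^sup>2) * c_lam + 4 * (\<mu>0 * L1\<^sup>2 + L2\<^sup>2) * c_lam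
                 + 12 * a1 / \<eta> * L2\<^sup>2) / (c_lam * (1 - \<rho>)));
          \<tau>3 = 2 * ((3 * (\<mu>0 * L1\<^sup>2 + L2\<^sup>2) * c_lam + 4 * (\<mu>0 * L1\<^sup>2 + L2\<^sup>2 + g2) * c_lam
                 + 12 * a1 / \<eta> * g2) / (c_lam * (1 - \<rho>)));
          \<tau>4 = 2 * ((3 * L2\<^sup>2 * c_lam + 4 * g2 * c_lam
                 + 12 * a1 / \<eta> * (L2\<^sup>2 + g2)) / (c_lam * (1 - \<rho>)))
      in c_lam \<le> \<eta> / (32 * a1 * L\<theta>\<^sup>2) \<and>
         lam \<le> 4 / (3 * \<eta>) \<and>
         lam \<le> 4 * a1 * L\<theta>\<^sup>2 / (\<eta> * L\<Phi>) \<and>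
         lam \<le> \<tau>2 * c_lam * (1 - \<rho>)\<^sup>2 / (192 * a1 * L2\<^sup>2) \<and>
         lam \<le> \<tau>3 * c_lam * (1 - \<rho>)\<^sup>2 / (192 * a1 * g2) \<and>
         lam \<le> \<tau>4 * c_lam * (1 - \<rho>)\<^sup>2 / (192 * a1 * (L2\<^sup>2 + g2)))"

text \<open>
  Size of the initial data: the gaps of the two parts of the penalized objective and the tracking
  error at the averaged initial point, plus the averaged initial consensus error.
\<close>

definition initial_gap ::
  "nat \<Rightarrow> real \<Rightarrow> ('x::euclidean_space \<times> 'y::euclidean_space \<Rightarrow> real) \<Rightarrow> ('x \<times> 'y \<Rightarrow> real) \<Rightarrow> real \<Rightarrow>
   (nat \<Rightarrow> 'y) \<Rightarrow> (nat \<Rightarrow> 'x) \<Rightarrow> (nat \<Rightarrow> 'y) \<Rightarrow> real" where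
  "initial_gap n \<gamma> F G F_low \<theta>0 x0 y0 =
     (let z = (mean n x0, mean n y0)
      in (F z - F_low) + (G z - V_env \<gamma> G z) + (norm (mean n \<theta>0 - theta_star \<gamma> G z))\<^sup>2
         + mean n (\<lambda>i. (norm (\<theta>0 i - mean n \<theta>0))\<^sup>2 + (norm (x0 i - mean n x0))\<^sup>2
                       + (norm (y0 i - mean n y0))\<^sup>2))"

end

theory Submission
  imports Defs "Jordan_Normal_Form.Schur_Decomposition"
begin

text \<open>
  Write \<open>r = 1 / \<gamma>\<close>, \<open>z = (x, y)\<close>, and let \<open>P z \<theta>\<close> be the proximal objective, with minimal value
  \<open>V z\<close> attained at \<open>\<theta>s z\<close>.  The averaged iterates follow, up to noise and disagreement between the
  agents, a gradient descent-ascent scheme: \<open>\<theta>\<close> moves along the gradient of \<open>P z\<close>, and \<open>z\<close> moves along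
  \<open>\<nabla>\<Psi> z - e\<close>, where the bias \<open>e\<close> (\<open>gap_grad\<close>) measures how far \<open>\<theta>\<close> is from \<open>\<theta>s z\<close>.

  The obvious measure of tracking, the squared distance from \<open>\<theta>\<close> to \<open>\<theta>s z\<close>, is not suitable here.
  The map \<open>\<theta>s\<close> is only Lipschitz, so a step of \<open>z\<close> perturbed by noise changes this distance to
  \<^emph>\<open>first\<close> order in the size of the noise, and the resulting error bound would not vanish with the step size.
  The optimality gap \<open>P z \<theta> - V z\<close> is comparable with the squared distance and has Lipschitz
  gradients in \<open>(z, \<theta>)\<close>.  Moreover its \<open>z\<close>-gradient is exactly the bias \<open>e\<close>.  The proof therefore uses
  the energy
  \[ m (F z - F_{low}) + (G z - V z) + (P z \theta - V z), \]
  with \<open>m = \<mu>\<^sub>k\<close>.  Its gradient is \<open>(\<nabla>\<Psi> z + e, \<nabla>P)\<close>, and its inner product with the direction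
  \<open>(c (\<nabla>\<Psi> z - e), \<nabla>P)\<close> is \<open>c |\<nabla>\<Psi>|\<^sup>2 - c |e|\<^sup>2 + |\<nabla>P|\<^sup>2\<close>: the mixed terms cancel.  The step-size
  conditions make \<open>c |e|\<^sup>2\<close> at most a quarter of \<open>|\<nabla>P|\<^sup>2\<close>, so the energy decreases by a
  multiple of \<open>|\<nabla>\<Psi>|\<^sup>2\<close> (\<open>energy_decrease\<close>).  The noise only enters through its second
  moment, which is divided by \<open>n\<close> for the averaged iterate because errors of different agents are
  uncorrelated (\<open>energy_step\<close>).

  The disagreement of the agents contracts by the factor \<open>\<rho>\<^sup>2\<close> in each gossip step
  (\<open>gossip_contraction\<close>) and is driven by noise and by the dissimilarity of the local gradients
  (\<open>consensus_step\<close>).  Its steady state is of order \<open>\<lambda>\<^sup>2 / (1 - \<rho>)\<^sup>2\<close>, which gives the last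
  two terms of the bound.  Adding a multiple of \<open>\<lambda> / (1 - \<rho>)\<close> times the disagreement to the energy
  yields a quantity that can be summed over the iterations (\<open>lyapunov_sum\<close>).

  The step-size conditions do not control \<open>\<mu>\<^sub>k L1\<close>.  While \<open>\<mu>\<^sub>k L1 > r\<close> the energy
  and the disagreement may grow, but only by a bounded factor in each iteration, and since \<open>\<mu>\<^sub>k\<close> tends
  to \<open>0\<close> this happens in at most \<open>k0\<close> iterations, where \<open>k0\<close> depends only on \<open>\<mu>0\<close>, \<open>p\<close>, \<open>L1\<close> and
  \<open>\<gamma>\<close>.  The total loss is a constant factor.
\<close>

section \<open>Gradients of smooth functions\<close>

lemma gderiv_unique:
  assumes "GDERIV h z :> D" "GDERIV h z :> D'"
  shows "D = D'"
proof -
  have "(\<lambda>w. inner w D) = (\<lambda>w. inner w D')"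
    using assms unfolding gderiv_def by (rule has_derivative_unique)
  then have "inner (D - D') D = inner (D - D') D'" by metis
  then have "inner (D - D') (D - D') = 0" by (simp add: inner_diff_right)
  then show ?thesis by simp
qed

lemma grad_eqI: "GDERIV h z :> D \<Longrightarrow> grad h z = D"
  unfolding grad_def by (rule the_equality) (auto intro: gderiv_unique)

lemma gderiv_grad:
  fixes h :: "'a::euclidean_space \<Rightarrow> real"
  assumes "h differentiable (at z)"
  shows "GDERIV h z :> grad h z"
proof -
  obtain h' where h': "(h has_derivative h') (at z)"
    using assms unfolding differentiable_def by blast
  interpret h': bounded_linear h' using h' by (rule has_derivative_bounded_linear)
  have "h' = (\<lambda>w. inner w (\<Sum>b\<in>Basis. h' b *\<^sub>R b))"
  proof
    fix w
    have "h' w = h' (\<Sum>b\<in>Basis. inner w b *\<^sub>R b)" by (simp add: euclidean_representation)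
    also have "\<dots> = (\<Sum>b\<in>Basis. inner w b * h' b)" by (simp add: h'.sum h'.scale)
    finally show "h' w = inner w (\<Sum>b\<in>Basis. h' b *\<^sub>R b)"
      by (simp add: inner_sum_right mult.commute)
  qed
  then have "GDERIV h z :> (\<Sum>b\<in>Basis. h' b *\<^sub>R b)"
    using h' unfolding gderiv_def by simp
  then show ?thesis using grad_eqI by metis
qed

lemma smooth_fun_gderiv: "smooth_fun L h \<Longrightarrow> GDERIV h z :> grad h z"
  unfolding smooth_fun_def by (blast intro: gderiv_grad)

lemma smooth_fun_lipschitz: "smooth_fun L h \<Longrightarrow> norm (grad h z - grad h z') \<le> L * norm (z - z')"
  unfolding smooth_fun_def by (auto dest!: lipschitz_onD[where x=z and y=z'] simp: dist_norm)

lemma smooth_fun_nonneg: "smooth_fun L h \<Longrightarrow> 0 \<le> L"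
  unfolding smooth_fun_def by (auto dest: lipschitz_on_nonneg)

lemma smooth_funI:
  fixes h :: "'a::euclidean_space \<Rightarrow> real"
  assumes "\<And>z. GDERIV h z :> D z" "\<And>z z'. norm (D z - D z') \<le> L * norm (z - z')" "0 \<le> L"
  shows "smooth_fun L h"
proof -
  have "grad h = D" using grad_eqI[OF assms(1)] by blast
  moreover have "L-lipschitz_on UNIV D"
    using assms(2,3) by (auto intro!: lipschitz_onI simp: dist_norm)
  moreover have "h differentiable (at z)" for z
    using assms(1) unfolding gderiv_def differentiable_def by blast
  ultimately show ?thesis
    unfolding smooth_fun_def by (auto intro: lipschitz_on_continuous_on)
qed

lemma smooth_fun_uminus: 
  assumes "smooth_fun L h" shows "smooth_fun L (\<lambda>z. - h z)"
proof (rule smooth_funI)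
  show "GDERIV (\<lambda>z. - h z) z :> - grad h z" for z
    using GDERIV_minus[OF smooth_fun_gderiv[OF assms]] .
  show "norm (- grad h z - - grad h z') \<le> L * norm (z - z')" for z z'
    using smooth_fun_lipschitz[OF assms, of z z'] by (simp add: norm_minus_commute)
  show "0 \<le> L" using smooth_fun_nonneg[OF assms] .
qed

text \<open>
  Along the segment from \<open>z\<close> to \<open>z + w\<close> the left side minus the right side has a nonpositive
  derivative, because the slope of \<open>h\<close> changes by at most \<open>t * L * (norm w)\<^sup>2\<close> up to time \<open>t\<close>.
\<close>

lemma smooth_fun_upper:
  assumes "smooth_fun L h"
  shows "h (z + w) \<le> h z + inner (grad h z) w + L / 2 * (norm w)\<^sup>2"
proof -
  define \<phi> where "\<phi> t = h (z + t *\<^sub>R w) - t * inner (grad h z) w - L / 2 * t\<^sup>2 * (norm w)\<^sup>2" for t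
  have d: "(\<phi> has_real_derivative
      (inner (grad h (z + t *\<^sub>R w)) w - inner (grad h z) w - L * t * (norm w)\<^sup>2)) (at t)" for t
  proof -
    have "((\<lambda>t. h (z + t *\<^sub>R w)) has_derivative (\<lambda>s. inner (s *\<^sub>R w) (grad h (z + t *\<^sub>R w)))) (at t)"
    proof (rule has_derivative_compose[where f="\<lambda>t. z + t *\<^sub>R w" and f'="\<lambda>s. s *\<^sub>R w"])
      show "((\<lambda>t. z + t *\<^sub>R w) has_derivative (\<lambda>s. s *\<^sub>R w)) (at t)"
        by (auto intro!: derivative_eq_intros)
      show "(h has_derivative (\<lambda>s. inner s (grad h (z + t *\<^sub>R w)))) (at (z + t *\<^sub>R w))"
        using smooth_fun_gderiv[OF assms] unfolding gderiv_def by blast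
    qed
    then have "((\<lambda>t. h (z + t *\<^sub>R w)) has_real_derivative inner (grad h (z + t *\<^sub>R w)) w) (at t)"
      unfolding has_field_derivative_def by (simp add: mult.commute inner_commute mult_commute_abs)
    then show ?thesis unfolding \<phi>_def
      by (auto intro!: derivative_eq_intros simp: power2_eq_square)
  qed
  have "\<phi> 1 \<le> \<phi> 0"
  proof (rule DERIV_nonpos_imp_nonincreasing[where f=\<phi> and a=0 and b=1])
    show "(0::real) \<le> 1" by simp
  next
    fix t :: real assume t: "0 \<le> t" "t \<le> 1"
    have "inner (grad h (z + t *\<^sub>R w)) w - inner (grad h z) w
        = inner (grad h (z + t *\<^sub>R w) - grad h z) w" by (simp add: inner_diff_left)
    also have "\<dots> \<le> norm (grad h (z + t *\<^sub>R w) - grad h z) * norm w"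
      by (rule norm_cauchy_schwarz)
    also have "\<dots> \<le> (L * norm (z + t *\<^sub>R w - z)) * norm w"
      by (intro mult_right_mono smooth_fun_lipschitz[OF assms]) auto
    also have "\<dots> = L * t * (norm w)\<^sup>2" using t by (simp add: power2_eq_square)
    finally show "\<exists>y. (\<phi> has_real_derivative y) (at t) \<and> y \<le> 0"
      using d[of t] by (intro exI conjI) auto
  qed
  then show ?thesis unfolding \<phi>_def by simp
qed

lemma smooth_fun_lower:
  assumes "smooth_fun L h"
  shows "h z + inner (grad h z) w - L / 2 * (norm w)\<^sup>2 \<le> h (z + w)"
proof -
  have "grad (\<lambda>z. - h z) z = - grad h z"
    by (rule grad_eqI[OF GDERIV_minus[OF smooth_fun_gderiv[OF assms]]])
  then show ?thesis using smooth_fun_upper[OF smooth_fun_uminus[OF assms], of z w] by simp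
qed

section \<open>Averages over the agents\<close>

lemma gderiv_mean:
  assumes "\<And>i. i < n \<Longrightarrow> GDERIV (f i) z :> D i"
  shows "GDERIV (\<lambda>z. mean n (\<lambda>i. f i z)) z :> mean n D"
proof -
  have "((\<lambda>z. (1 / real n) *\<^sub>R (\<Sum>i<n. f i z)) has_derivative
      (\<lambda>w. (1 / real n) *\<^sub>R (\<Sum>i<n. inner w (D i)))) (at z)"
    by (intro has_derivative_scaleR_right has_derivative_sum)
       (use assms in \<open>auto simp: gderiv_def\<close>)
  then show ?thesis unfolding gderiv_def mean_def by (simp add: inner_sum_right)
qed

lemma mean_diff: "mean n u - mean n v = mean n (\<lambda>i. u i - v i)"
  unfolding mean_def by (simp add: sum_subtractf scaleR_diff_right)

lemma mean_add: "mean n u + mean n v = mean n (\<lambda>i. u i + v i)"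
  unfolding mean_def by (simp add: sum.distrib scaleR_add_right)

lemma mean_const: "1 \<le> n \<Longrightarrow> mean n (\<lambda>i. v) = v"
  unfolding mean_def by (simp add: sum_constant_scaleR)

lemma mean_mono: 
  fixes u v :: "nat \<Rightarrow> real"
  assumes "\<And>i. i < n \<Longrightarrow> u i \<le> v i" shows "mean n u \<le> mean n v"
  unfolding mean_def using assms by (auto intro!: mult_left_mono sum_mono divide_right_mono)

lemma mean_cmult: "mean n (\<lambda>i. a * u i) = a * mean n (u :: nat \<Rightarrow> real)"
  unfolding mean_def by (simp add: sum_distrib_left)

lemma mean_scaleR: "mean n (\<lambda>i. a *\<^sub>R u i) = a *\<^sub>R mean n u"
  unfolding mean_def by (simp add: scaleR_sum_right mult.commute)

lemma mean_nonneg: "(\<And>i. i < n \<Longrightarrow> 0 \<le> u i) \<Longrightarrow> 0 \<le> mean n (u :: nat \<Rightarrow> real)"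
  unfolding mean_def by (auto intro!: divide_nonneg_nonneg sum_nonneg)

lemma mean_cong: "(\<And>i. i < n \<Longrightarrow> u i = v i) \<Longrightarrow> mean n u = mean n v"
  unfolding mean_def by simp

lemma linear_mean: 
  assumes "linear T" shows "T (mean n u) = mean n (\<lambda>i. T (u i))"
proof -
  interpret linear T by fact
  show ?thesis unfolding mean_def by (simp add: sum scale)
qed

lemma norm_mean_le: "norm (mean n u) \<le> mean n (\<lambda>i. norm (u i))"
  unfolding mean_def by (auto intro!: divide_right_mono norm_sum)

lemma norm_mean_squared_le: "(norm (mean n u))\<^sup>2 \<le> mean n (\<lambda>i. (norm (u i))\<^sup>2)"
proof (cases "n = 0")
  case False
  have "(norm (\<Sum>i<n. u i))\<^sup>2 \<le> (\<Sum>i<n. norm (u i) * 1)\<^sup>2"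
    by (rule power_mono) (auto intro!: norm_sum)
  also have "\<dots> \<le> (\<Sum>i<n. (norm (u i))\<^sup>2) * (\<Sum>i<n. 1\<^sup>2)" by (rule Cauchy_Schwarz_ineq_sum)
  finally have "(norm (\<Sum>i<n. u i))\<^sup>2 \<le> real n * (\<Sum>i<n. (norm (u i))\<^sup>2)" by (simp add: mult.commute)
  then show ?thesis unfolding mean_def using False
    by (simp add: power_mult_distrib divide_simps power2_eq_square mult.commute)
qed (simp add: mean_def)

lemma smooth_fun_mean:
  fixes f :: "nat \<Rightarrow> 'a::euclidean_space \<Rightarrow> real"
  assumes n: "1 \<le> n" and "\<And>i. i < n \<Longrightarrow> smooth_fun L (f i)"
  shows "smooth_fun L (\<lambda>z. mean n (\<lambda>i. f i z))"
    and "grad (\<lambda>z. mean n (\<lambda>i. f i z)) z = mean n (\<lambda>i. grad (f i) z)"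
proof -
  have D: "GDERIV (\<lambda>z. mean n (\<lambda>i. f i z)) z :> mean n (\<lambda>i. grad (f i) z)" for z
    by (intro gderiv_mean smooth_fun_gderiv[of L] assms)
  then show "grad (\<lambda>z. mean n (\<lambda>i. f i z)) z = mean n (\<lambda>i. grad (f i) z)"
    by (rule grad_eqI)
  show "smooth_fun L (\<lambda>z. mean n (\<lambda>i. f i z))"
  proof (rule smooth_funI[OF D])
    fix z z' :: 'a
    have "norm (mean n (\<lambda>i. grad (f i) z) - mean n (\<lambda>i. grad (f i) z'))
        \<le> mean n (\<lambda>i. norm (grad (f i) z - grad (f i) z'))"
      unfolding mean_diff by (rule norm_mean_le)
    also have "\<dots> \<le> mean n (\<lambda>i. L * norm (z - z'))"
      by (intro mean_mono smooth_fun_lipschitz assms)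
    finally show "norm (mean n (\<lambda>i. grad (f i) z) - mean n (\<lambda>i. grad (f i) z')) \<le> L * norm (z - z')"
      using n by (simp add: mean_const)
    show "0 \<le> L" using smooth_fun_nonneg[OF assms(2)[of 0]] n by simp
  qed
qed

section \<open>The proximal envelope\<close>

lemma gderiv_if_quadratic_error:
  fixes h :: "'a::euclidean_space \<Rightarrow> real"
  assumes "\<And>u. \<bar>h (z + u) - h z - inner D u\<bar> \<le> C * (norm u)\<^sup>2"
  shows "GDERIV h z :> D"
  unfolding gderiv_def has_derivative_at
proof
  show "bounded_linear (\<lambda>u. inner u D)" by (rule bounded_linear_inner_left)
  have "((\<lambda>u. C * norm u) \<longlongrightarrow> 0) (at (0::'a))"
    by (rule tendsto_mult_right_zero[OF tendsto_norm_zero[OF tendsto_ident_at]])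
  moreover have "\<forall>\<^sub>F u in at 0. norm (norm (h (z + u) - h z - inner u D) / norm u) \<le> C * norm u"
  proof (rule eventually_mono[OF eventually_neq_at_within[of 0]])
    fix u :: 'a assume "u \<noteq> 0"
    then have "\<bar>h (z + u) - h z - inner D u\<bar> / norm u \<le> C * norm u"
      using divide_right_mono[OF assms[of u], of "norm u"] by (simp add: power2_eq_square)
    then show "norm (norm (h (z + u) - h z - inner u D) / norm u) \<le> C * norm u"
      by (simp add: inner_commute)
  qed
  ultimately show "((\<lambda>u. norm (h (z + u) - h z - inner u D) / norm u) \<longlongrightarrow> 0) (at 0)"
    by (rule Lim_null_comparison[rotated])
qed

lemma norm_Pair_squared: "(norm (a, b))\<^sup>2 = (norm a)\<^sup>2 + (norm b)\<^sup>2"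
  by (simp add: norm_Pair)

lemma norm_fst_le_norm: "norm (fst p) \<le> norm p" and norm_snd_le_norm: "norm (snd p) \<le> norm p"
  by (cases p; simp add: norm_fst_le norm_snd_le)+

lemma two_mult_le_weighted:
  assumes "0 < (t::real)" shows "2 * (a * b) \<le> t * a\<^sup>2 + b\<^sup>2 / t"
proof -
  have "0 \<le> (t * a - b)\<^sup>2 / t" using assms by simp
  also have "\<dots> = t * a\<^sup>2 + b\<^sup>2 / t - 2 * (a * b)" 
    using assms by (simp add: power2_diff power_mult_distrib field_simps power2_eq_square)
  finally show ?thesis by simp
qed

lemma norm_add_squared_le_weighted:
  fixes a b :: "'a::real_inner"
  assumes "0 < (t::real)"
  shows "(norm (a + b))\<^sup>2 \<le> (1 + t) * (norm a)\<^sup>2 + (1 + 1 / t) * (norm b)\<^sup>2"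
proof -
  have "(norm (a + b))\<^sup>2 \<le> (norm a + norm b)\<^sup>2"
    by (rule power_mono[OF norm_triangle_ineq]) simp
  also have "\<dots> = (norm a)\<^sup>2 + (norm b)\<^sup>2 + 2 * (norm a * norm b)" by (simp add: power2_sum)
  also have "\<dots> \<le> (norm a)\<^sup>2 + (norm b)\<^sup>2 + (t * (norm a)\<^sup>2 + (norm b)\<^sup>2 / t)"
    using two_mult_le_weighted[OF assms] by simp
  finally show ?thesis by (simp add: algebra_simps)
qed

lemma two_term_cauchy:
  assumes "0 \<le> (a::real)" "0 \<le> b"
  shows "a * norm x + b * norm y \<le> sqrt (a\<^sup>2 + b\<^sup>2) * norm (x, y)"
proof -
  have "a * norm x + b * norm y = inner (a, b) (norm x, norm y)" by simp
  also have "\<dots> \<le> norm (a, b) * norm (norm x, norm y)" by (rule norm_cauchy_schwarz)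
  finally show ?thesis by (simp add: norm_Pair)
qed

locale bilevel =
  fixes F G :: "'x::euclidean_space \<times> 'y::euclidean_space \<Rightarrow> real" and L1 L2 \<gamma> F_low :: real
  assumes smooth_F: "smooth_fun L1 F" and smooth_G: "smooth_fun L2 G"
    and F_low: "\<And>z. F_low \<le> F z"
    and gamma_pos: "0 < \<gamma>" and gamma_less: "\<gamma> < 1 / (2 * L2)"
begin

definition r :: real where "r = 1 / \<gamma>"
definition \<eta> :: real where "\<eta> = r - L2"
definition S :: real where "S = sqrt (L2\<^sup>2 + r\<^sup>2)"

abbreviation "P \<equiv> prox_obj \<gamma> G"
abbreviation "\<theta>s \<equiv> theta_star \<gamma> G"
abbreviation "V \<equiv> V_env \<gamma> G"

definition gradP :: "'x \<times> 'y \<Rightarrow> 'y \<Rightarrow> 'y" where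
  "gradP z \<theta> = snd (grad G (fst z, \<theta>)) + r *\<^sub>R (\<theta> - snd z)"

lemma r_pos: "0 < r" using gamma_pos by (simp add: r_def)

lemma L2_pos: "0 < L2"
proof -
  have "0 < 1 / (2 * L2)" using gamma_pos gamma_less by linarith
  then show ?thesis by (simp add: zero_less_divide_iff)
qed

lemma L2_less: "L2 < r / 2"
  using gamma_less gamma_pos L2_pos by (simp add: r_def field_simps)

lemma L1_nonneg: "0 \<le> L1" using smooth_fun_nonneg[OF smooth_F] .

lemma eta_bounds: "0 < \<eta>" "r / 2 < \<eta>" "\<eta> < r"
  using L2_less L2_pos r_pos by (auto simp: \<eta>_def)

lemma S_pos: "0 < S" and S_squared: "S\<^sup>2 = L2\<^sup>2 + r\<^sup>2" and r_le_S: "r \<le> S"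
  and S_squared_le: "S\<^sup>2 \<le> 5 / 4 * r\<^sup>2" and S_squared_le_eta: "S\<^sup>2 \<le> 5 * \<eta>\<^sup>2"
proof -
  show "0 < S" using r_pos L2_pos by (auto simp: S_def intro!: add_nonneg_pos)
  show *: "S\<^sup>2 = L2\<^sup>2 + r\<^sup>2" by (simp add: S_def)
  show "r \<le> S" unfolding S_def by (rule real_le_rsqrt) simp
  have "L2\<^sup>2 \<le> (r / 2)\<^sup>2" using L2_less L2_pos by (intro power_mono) auto
  then show 2: "S\<^sup>2 \<le> 5 / 4 * r\<^sup>2" unfolding * by (simp add: power_divide)
  have "(r / 2)\<^sup>2 \<le> \<eta>\<^sup>2" using eta_bounds r_pos by (intro power_mono) auto
  then show "S\<^sup>2 \<le> 5 * \<eta>\<^sup>2" using 2 by (simp add: power_divide)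
qed

lemma prox_obj_r: "P z \<theta> = G (fst z, \<theta>) + r / 2 * (norm (\<theta> - snd z))\<^sup>2"
  by (simp add: prox_obj_def r_def)

lemma square_shift:
  fixes a b :: "'b::real_inner"
  shows "r / 2 * (norm (a + b))\<^sup>2 = r / 2 * (norm a)\<^sup>2 + inner (r *\<^sub>R a) b + r / 2 * (norm b)\<^sup>2"
  by (simp add: power2_norm_eq_inner inner_add_left inner_add_right inner_commute algebra_simps)

lemma prox_obj_shift:
  "P z (\<theta> + v) - P z \<theta> - inner (gradP z \<theta>) v
    = G (fst z, \<theta> + v) - G (fst z, \<theta>) - inner (grad G (fst z, \<theta>)) (0, v) + r / 2 * (norm v)\<^sup>2"
proof -
  have "P z (\<theta> + v) = G (fst z, \<theta> + v) + r / 2 * (norm ((\<theta> - snd z) + v))\<^sup>2"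
    by (simp add: prox_obj_r algebra_simps)
  then show ?thesis unfolding square_shift
    by (simp add: prox_obj_r gradP_def inner_prod_def inner_add_left add_divide_distrib)
qed

lemma prox_obj_lower: "P z \<theta> + inner (gradP z \<theta>) v + \<eta> / 2 * (norm v)\<^sup>2 \<le> P z (\<theta> + v)"
  using smooth_fun_lower[OF smooth_G, of "(fst z, \<theta>)" "(0, v)"] prox_obj_shift[of z \<theta> v]
  by (simp add: \<eta>_def norm_Pair algebra_simps add_divide_distrib diff_divide_distrib)

lemma prox_obj_upper: "P z (\<theta> + v) \<le> P z \<theta> + inner (gradP z \<theta>) v + (L2 + r) / 2 * (norm v)\<^sup>2"
  using smooth_fun_upper[OF smooth_G, of "(fst z, \<theta>)" "(0, v)"] prox_obj_shift[of z \<theta> v]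
  by (simp add: norm_Pair algebra_simps add_divide_distrib)

lemma continuous_prox_obj: "continuous_on UNIV (P z)"
proof -
  have "isCont G w" for w
    using smooth_G unfolding smooth_fun_def by (blast intro: differentiable_imp_continuous_within)
  then have "continuous_on UNIV G" by (simp add: continuous_at_imp_continuous_on)
  then have "continuous_on UNIV (\<lambda>\<theta>. G (fst z, \<theta>))"
    by (rule continuous_on_compose2) (auto intro!: continuous_intros)
  then show ?thesis unfolding prox_obj_def by (intro continuous_intros)
qed

text \<open>
  Outside a ball whose radius is dictated by strong convexity the value exceeds the value at \<open>0\<close>, so a
  minimizer over the ball is a global one.
\<close>

lemma prox_obj_has_min: "\<exists>\<theta>. \<forall>\<theta>'. P z \<theta> \<le> P z \<theta>'"
proof -
  define R where "R = 2 * norm (gradP z 0) / \<eta>"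
  have R: "0 \<le> R" using eta_bounds by (simp add: R_def)
  obtain \<theta> where \<theta>: "\<theta> \<in> cball 0 R" "\<And>\<theta>'. \<theta>' \<in> cball 0 R \<Longrightarrow> P z \<theta> \<le> P z \<theta>'"
    using continuous_attains_inf[of "cball 0 R" "P z"] continuous_on_subset[OF continuous_prox_obj] R
    by auto
  have "P z \<theta> \<le> P z \<theta>'" if "\<theta>' \<notin> cball 0 R" for \<theta>'
  proof -
    have n: "R \<le> norm \<theta>'" using that by simp
    have "- (norm (gradP z 0) * norm \<theta>') \<le> inner (gradP z 0) \<theta>'"
      using Cauchy_Schwarz_ineq2[of "gradP z 0" \<theta>'] by linarith
    moreover have "norm (gradP z 0) * norm \<theta>' = \<eta> / 2 * R * norm \<theta>'"
      using eta_bounds by (simp add: R_def)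
    moreover have "\<eta> / 2 * R * norm \<theta>' \<le> \<eta> / 2 * norm \<theta>' * norm \<theta>'"
      using n eta_bounds by (intro mult_right_mono mult_left_mono) auto
    ultimately have "P z 0 \<le> P z \<theta>'"
      using prox_obj_lower[of z 0 \<theta>'] by (simp add: power2_eq_square)
    then show ?thesis using \<theta>(2)[of 0] R by simp
  qed
  then show ?thesis using \<theta>(2) by blast
qed

lemma theta_star_min: "P z (\<theta>s z) \<le> P z \<theta>"
proof -
  have "\<exists>\<theta>. is_arg_min (P z) (\<lambda>_. True) \<theta>"
    using prox_obj_has_min[of z] by (auto simp: is_arg_min_def not_less)
  then have "is_arg_min (P z) (\<lambda>_. True) (\<theta>s z)"
    unfolding theta_star_def arg_min_def by (rule someI_ex)
  then show ?thesis by (simp add: is_arg_min_def not_less)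
qed

lemma V_env_eq: "V z = P z (\<theta>s z)"
  unfolding V_env_def by (rule cInf_eq_minimum) (auto intro: theta_star_min)

lemma V_env_le: "V z \<le> P z \<theta>"
  using theta_star_min V_env_eq by simp

lemma gradP_theta_star: "gradP z (\<theta>s z) = 0"
proof -
  define g where "g = gradP z (\<theta>s z)"
  define b where "b = L2 + r"
  have b: "0 < b" using L2_pos r_pos by (simp add: b_def)
  \<comment> \<open>Compare with the gradient step of length \<open>1 / b\<close>, where \<open>b\<close> is the curvature bound.\<close>
  have "P z (\<theta>s z) \<le> P z (\<theta>s z) + inner g (- (1 / b) *\<^sub>R g) + b / 2 * (norm (- (1 / b) *\<^sub>R g))\<^sup>2"
    using prox_obj_upper[of z "\<theta>s z" "- (1 / b) *\<^sub>R g"] theta_star_min[of z]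
    unfolding g_def b_def by (meson order_trans)
  moreover have "b / 2 * (norm (- (1 / b) *\<^sub>R g))\<^sup>2 = (norm g)\<^sup>2 / b / 2"
    using b by (simp add: power_mult_distrib power_divide power2_eq_square)
  moreover have "inner g (- (1 / b) *\<^sub>R g) = - ((norm g)\<^sup>2 / b)"
    by (simp add: power2_norm_eq_inner)
  ultimately have "P z (\<theta>s z) \<le> P z (\<theta>s z) + - ((norm g)\<^sup>2 / b) + (norm g)\<^sup>2 / b / 2"
    by (simp only:)
  moreover have "p \<le> p + - q + q / 2 \<Longrightarrow> q \<le> 0" for p q :: real by simp
  ultimately have "(norm g)\<^sup>2 / b \<le> 0" by blast
  then have "(norm g)\<^sup>2 \<le> 0" using b by (simp add: divide_le_0_iff)
  then show ?thesis by (simp add: g_def)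
qed

text \<open>
  Strong convexity at both ends of the segment from \<open>\<theta>\<close> to the minimizer makes \<open>gradP\<close> strongly
  monotone.
\<close>

lemma gradP_ge: "\<eta> * norm (\<theta> - \<theta>s z) \<le> norm (gradP z \<theta>)"
proof -
  let ?e = "\<theta> - \<theta>s z"
  have "P z \<theta> + inner (gradP z \<theta>) (- ?e) + \<eta> / 2 * (norm (- ?e))\<^sup>2 \<le> P z (\<theta>s z)"
    using prox_obj_lower[of z \<theta> "- ?e"] by simp
  moreover have "P z (\<theta>s z) + \<eta> / 2 * (norm ?e)\<^sup>2 \<le> P z \<theta>"
    using prox_obj_lower[of z "\<theta>s z" ?e] by (simp add: gradP_theta_star)
  ultimately have "\<eta> * (norm ?e)\<^sup>2 \<le> inner (gradP z \<theta>) ?e"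
    unfolding norm_minus_cancel inner_minus_right by linarith
  also have "\<dots> \<le> norm (gradP z \<theta>) * norm ?e" by (rule norm_cauchy_schwarz)
  finally have "(\<eta> * norm ?e) * norm ?e \<le> norm (gradP z \<theta>) * norm ?e"
    by (simp add: power2_eq_square mult_ac)
  then show ?thesis by (cases "norm ?e = 0") auto
qed

text \<open>
  At a fixed \<open>\<theta>\<close> the gradient \<open>gradP\<close> moves with \<open>z\<close> at most at rate \<open>S\<close>; at the old
  minimizer it vanished, and by strong monotonicity its new value bounds the distance to the new
  minimizer.
\<close>

lemma theta_star_lipschitz: "norm (\<theta>s z - \<theta>s z') \<le> S / \<eta> * norm (z - z')"
proof -
  let ?\<theta> = "\<theta>s z"
  have "gradP z' ?\<theta> = gradP z' ?\<theta> - gradP z ?\<theta>" by (simp add: gradP_theta_star)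
  also have "\<dots> = snd (grad G (fst z', ?\<theta>) - grad G (fst z, ?\<theta>)) + r *\<^sub>R (snd z - snd z')"
    by (simp add: gradP_def algebra_simps)
  finally have "norm (gradP z' ?\<theta>)
      \<le> norm (snd (grad G (fst z', ?\<theta>) - grad G (fst z, ?\<theta>))) + norm (r *\<^sub>R (snd z - snd z'))"
    by (simp only: norm_triangle_ineq)
  also have "\<dots> \<le> norm (grad G (fst z', ?\<theta>) - grad G (fst z, ?\<theta>)) + r * norm (snd z - snd z')"
    using r_pos norm_snd_le_norm[of "grad G (fst z', ?\<theta>) - grad G (fst z, ?\<theta>)"] by simp
  also have "\<dots> \<le> L2 * norm (fst z - fst z') + r * norm (snd z - snd z')"
    using smooth_fun_lipschitz[OF smooth_G, of "(fst z', ?\<theta>)" "(fst z, ?\<theta>)"]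
    by (simp add: norm_Pair norm_minus_commute)
  also have "\<dots> \<le> S * norm (z - z')"
    using two_term_cauchy[of L2 r "fst z - fst z'" "snd z - snd z'"] L2_pos r_pos
    by (simp add: S_def minus_prod_def)
  finally have "\<eta> * norm (\<theta>s z - \<theta>s z') \<le> S * norm (z - z')"
    using gradP_ge[of ?\<theta> z'] by linarith
  then show ?thesis using eta_bounds by (simp add: field_simps)
qed

definition gradV :: "'x \<times> 'y \<Rightarrow> 'x \<times> 'y" where
  "gradV z = (fst (grad G (fst z, \<theta>s z)), r *\<^sub>R (snd z - \<theta>s z))"

text \<open>
  The \<open>z\<close>-gradient of the gap \<open>P z \<theta> - V z\<close>.  It is also the bias of the search direction for
  \<open>z\<close>, which uses \<open>\<theta>\<close> in place of the minimizer.
\<close>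

definition gap_grad :: "'x \<times> 'y \<Rightarrow> 'y \<Rightarrow> 'x \<times> 'y" where
  "gap_grad z \<theta> = (fst (grad G (fst z, \<theta>)) - fst (grad G (fst z, \<theta>s z)), - r *\<^sub>R (\<theta> - \<theta>s z))"

lemma norm_cross_grad:
  "norm (fst (grad G (a, \<theta>)) - fst (grad G (a, \<theta>')), - r *\<^sub>R (\<theta> - \<theta>')) \<le> S * norm (\<theta> - \<theta>')"
proof -
  have "norm (fst (grad G (a, \<theta>)) - fst (grad G (a, \<theta>'))) \<le> norm (grad G (a, \<theta>) - grad G (a, \<theta>'))"
    using norm_fst_le_norm[of "grad G (a, \<theta>) - grad G (a, \<theta>')"] by simp
  also have "\<dots> \<le> L2 * norm (\<theta> - \<theta>')"
    using smooth_fun_lipschitz[OF smooth_G, of "(a, \<theta>)" "(a, \<theta>')"] by (simp add: norm_Pair)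
  finally have "(norm (fst (grad G (a, \<theta>)) - fst (grad G (a, \<theta>'))))\<^sup>2 \<le> (L2 * norm (\<theta> - \<theta>'))\<^sup>2"
    by (rule power_mono) simp
  moreover have "(norm (- r *\<^sub>R (\<theta> - \<theta>')))\<^sup>2 = r\<^sup>2 * (norm (\<theta> - \<theta>'))\<^sup>2"
    unfolding norm_scaleR by (simp add: power_mult_distrib)
  moreover have "(S * norm (\<theta> - \<theta>'))\<^sup>2 = (L2 * norm (\<theta> - \<theta>'))\<^sup>2 + r\<^sup>2 * (norm (\<theta> - \<theta>'))\<^sup>2"
    by (simp add: power_mult_distrib S_squared distrib_right)
  ultimately have "(norm (fst (grad G (a, \<theta>)) - fst (grad G (a, \<theta>')), - r *\<^sub>R (\<theta> - \<theta>')))\<^sup>2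
      \<le> (S * norm (\<theta> - \<theta>'))\<^sup>2"
    unfolding norm_Pair_squared by linarith
  then show ?thesis by (rule power2_le_imp_le) (use S_pos in auto)
qed

lemma norm_gap_grad: "norm (gap_grad z \<theta>) \<le> S * norm (\<theta> - \<theta>s z)"
  unfolding gap_grad_def by (rule norm_cross_grad)

lemma gap_grad_le: "\<eta> * norm (gap_grad z \<theta>) \<le> S * norm (gradP z \<theta>)"
proof -
  have "\<eta> * norm (gap_grad z \<theta>) \<le> \<eta> * (S * norm (\<theta> - \<theta>s z))"
    using eta_bounds by (intro mult_left_mono norm_gap_grad) auto
  also have "\<dots> = S * (\<eta> * norm (\<theta> - \<theta>s z))" by simp
  also have "\<dots> \<le> S * norm (gradP z \<theta>)" using S_pos by (intro mult_left_mono gradP_ge) auto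
  finally show ?thesis .
qed

lemma gap_grad_squared_le: "\<eta>\<^sup>2 * (norm (gap_grad z \<theta>))\<^sup>2 \<le> S\<^sup>2 * (norm (gradP z \<theta>))\<^sup>2"
  unfolding power_mult_distrib[symmetric]
  using eta_bounds by (intro power_mono gap_grad_le) auto

text \<open>
  Since \<open>V (z + u) = P (z + u) \<theta>'\<close> and \<open>V z \<le> P z \<theta>'\<close> for the new minimizer \<open>\<theta>'\<close>, the difference is
  at least the increment of \<open>P\<close> in \<open>z\<close> at \<open>\<theta>'\<close>.  Replacing \<open>\<theta>'\<close> by the old minimizer in the gradient
  costs another term of second order, because the minimizer is Lipschitz.
\<close>

lemma V_env_lower:
  "V z + inner (gradV z) u - (5 / 2 * r + L2 / 2) * (norm u)\<^sup>2 \<le> V (z + u)"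
proof -
  let ?\<theta> = "\<theta>s z" and ?\<theta>' = "\<theta>s (z + u)"
  define d where "d = (fst (grad G (fst z, ?\<theta>')) - fst (grad G (fst z, ?\<theta>)), - r *\<^sub>R (?\<theta>' - ?\<theta>))"
  have "norm d \<le> S * norm (?\<theta>' - ?\<theta>)" unfolding d_def by (rule norm_cross_grad)
  also have "\<dots> \<le> S * (S / \<eta> * norm u)"
    using theta_star_lipschitz[of "z + u" z] S_pos by (intro mult_left_mono) auto
  also have "\<dots> \<le> 5 / 2 * r * norm u"
  proof -
    have "S * S \<le> 5 / 2 * r * \<eta>"
    proof -
      have "5 / 4 * r * r \<le> 5 / 4 * r * (2 * \<eta>)"
        using eta_bounds r_pos by (intro mult_left_mono) auto
      then show ?thesis using S_squared_le by (simp add: power2_eq_square)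
    qed
    then have "S * S / \<eta> \<le> 5 / 2 * r" using eta_bounds by (simp add: divide_le_eq)
    then have "S * S / \<eta> * norm u \<le> 5 / 2 * r * norm u" by (intro mult_right_mono) auto
    then show ?thesis by simp
  qed
  finally have "norm d * norm u \<le> 5 / 2 * r * norm u * norm u" by (intro mult_right_mono) auto
  then have d: "- (5 / 2 * r * (norm u)\<^sup>2) \<le> inner d u"
    using Cauchy_Schwarz_ineq2[of d u] by (simp add: power2_eq_square)
  have "P (z + u) ?\<theta>' = G (fst z + fst u, ?\<theta>') + r / 2 * (norm ((?\<theta>' - snd z) + (- snd u)))\<^sup>2"
    by (simp add: prox_obj_r algebra_simps)
  also have "\<dots> \<ge> P z ?\<theta>' + inner (fst (grad G (fst z, ?\<theta>')), r *\<^sub>R (snd z - ?\<theta>')) u - L2 / 2 * (norm u)\<^sup>2"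
  proof -
    have "(norm (fst u))\<^sup>2 \<le> (norm u)\<^sup>2" using norm_Pair_squared[of "fst u" "snd u"] by simp
    then have "L2 / 2 * (norm (fst u))\<^sup>2 \<le> L2 / 2 * (norm u)\<^sup>2"
      using L2_pos by (intro mult_left_mono) auto
    then have "G (fst z, ?\<theta>') + inner (fst (grad G (fst z, ?\<theta>'))) (fst u) - L2 / 2 * (norm u)\<^sup>2
        \<le> G (fst z + fst u, ?\<theta>')"
      using smooth_fun_lower[OF smooth_G, of "(fst z, ?\<theta>')" "(fst u, 0)"]
      by (simp add: norm_Pair inner_prod_def)
    moreover have "0 \<le> r / 2 * (norm (snd u))\<^sup>2" using r_pos by simp
    ultimately show ?thesis
      unfolding square_shift by (simp add: prox_obj_r inner_prod_def inner_diff_left algebra_simps)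
  qed
  finally have "P z ?\<theta>' + inner (gradV z + d) u - L2 / 2 * (norm u)\<^sup>2 \<le> P (z + u) ?\<theta>'"
    by (simp add: gradV_def d_def algebra_simps)
  then show ?thesis using V_env_le[of z ?\<theta>'] d
    unfolding V_env_eq[of "z + u"] by (simp add: inner_add_left algebra_simps)
qed

lemma prox_obj_joint_upper:
  "P (z + u) (\<theta> + v) \<le> P z \<theta> + inner (gradV z + gap_grad z \<theta>) u + inner (gradP z \<theta>) v
     + (L2 / 2 + 5 / 2 * r) * (norm u)\<^sup>2 + (L2 / 2 + 5 / 8 * r) * (norm v)\<^sup>2"
proof -
  have "G (fst z + fst u, \<theta> + v) \<le> G (fst z, \<theta>) + inner (grad G (fst z, \<theta>)) (fst u, v)
      + L2 / 2 * ((norm (fst u))\<^sup>2 + (norm v)\<^sup>2)"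
    using smooth_fun_upper[OF smooth_G, of "(fst z, \<theta>)" "(fst u, v)"] by (simp add: norm_Pair)
  moreover have "L2 / 2 * (norm (fst u))\<^sup>2 \<le> L2 / 2 * (norm u)\<^sup>2"
    using norm_Pair_squared[of "fst u" "snd u"] L2_pos by (intro mult_left_mono) auto
  moreover have "r / 2 * (norm (v + (- snd u)))\<^sup>2
      \<le> r / 2 * (5 / 4 * (norm v)\<^sup>2 + 5 * (norm u)\<^sup>2)"
  proof (intro mult_left_mono)
    have "(norm (v + (- snd u)))\<^sup>2 \<le> 5 / 4 * (norm v)\<^sup>2 + 5 * (norm (snd u))\<^sup>2"
      using norm_add_squared_le_weighted[of "1/4" v "- snd u"] by simp
    also have "5 * (norm (snd u))\<^sup>2 \<le> 5 * (norm u)\<^sup>2"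
      using norm_Pair_squared[of "fst u" "snd u"] by simp
    finally show "(norm (v + (- snd u)))\<^sup>2 \<le> 5 / 4 * (norm v)\<^sup>2 + 5 * (norm u)\<^sup>2" by simp
  qed (use r_pos in simp)
  moreover have "P (z + u) (\<theta> + v) = G (fst z + fst u, \<theta> + v)
      + r / 2 * (norm ((\<theta> - snd z) + (v + (- snd u))))\<^sup>2"
    by (simp add: prox_obj_r algebra_simps)
  ultimately have "P (z + u) (\<theta> + v) \<le> P z \<theta>
      + inner (grad G (fst z, \<theta>)) (fst u, v) + inner (r *\<^sub>R (\<theta> - snd z)) (v - snd u)
      + (L2 / 2 + 5 / 2 * r) * (norm u)\<^sup>2 + (L2 / 2 + 5 / 8 * r) * (norm v)\<^sup>2"
    unfolding square_shift by (simp add: prox_obj_r algebra_simps)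
  moreover have "inner (grad G (fst z, \<theta>)) (fst u, v) + inner (r *\<^sub>R (\<theta> - snd z)) (v - snd u)
      = inner (gradV z + gap_grad z \<theta>) u + inner (gradP z \<theta>) v"
    by (simp add: gradV_def gap_grad_def gradP_def inner_prod_def algebra_simps inner_add_left
        inner_diff_left inner_diff_right)
  ultimately show ?thesis by linarith
qed

text \<open>
  The lower bound above and the upper bound obtained from the old minimizer enclose \<open>V\<close> between two
  paraboloids with the same slope.
\<close>

lemma gderiv_V: "GDERIV V z :> gradV z"
proof (rule gderiv_if_quadratic_error)
  fix u
  have "gap_grad z (\<theta>s z) = 0" by (simp add: gap_grad_def zero_prod_def)
  then have "V (z + u) \<le> V z + inner (gradV z) u + (L2 / 2 + 5 / 2 * r) * (norm u)\<^sup>2"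
    using prox_obj_joint_upper[of z u "\<theta>s z" 0] V_env_le[of "z + u" "\<theta>s z"]
    by (simp add: V_env_eq[of z])
  then show "\<bar>V (z + u) - V z - inner (gradV z) u\<bar> \<le> (L2 / 2 + 5 / 2 * r) * (norm u)\<^sup>2"
    using V_env_lower[of z u] by (simp add: abs_le_iff algebra_simps)
qed

definition gradPsi :: "real \<Rightarrow> 'x \<times> 'y \<Rightarrow> 'x \<times> 'y" where
  "gradPsi m z = m *\<^sub>R grad F z + grad G z - gradV z"

lemma grad_Psi: "grad (Psi \<gamma> F G m) z = gradPsi m z"
proof (rule grad_eqI)
  have "((\<lambda>z. m * F z + G z - V z) has_derivative
      (\<lambda>w. m * inner w (grad F z) + inner w (grad G z) - inner w (gradV z))) (at z)"
    using smooth_fun_gderiv[OF smooth_F, of z] smooth_fun_gderiv[OF smooth_G, of z] gderiv_V[of z]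
    unfolding gderiv_def by (intro has_derivative_add has_derivative_diff has_derivative_mult_right)
  then show "GDERIV (Psi \<gamma> F G m) z :> gradPsi m z"
    unfolding gderiv_def Psi_def gradPsi_def by (simp add: inner_add_right inner_diff_right)
qed

lemma theta_star_continuous: "continuous_on UNIV \<theta>s"
proof (rule lipschitz_on_continuous_on)
  show "(S / \<eta>)-lipschitz_on UNIV \<theta>s"
    using theta_star_lipschitz S_pos eta_bounds by (auto intro!: lipschitz_onI simp: dist_norm)
qed

lemma gradPsi_continuous: "continuous_on UNIV (gradPsi m)"
proof -
  have c: "continuous_on UNIV (grad F)" "continuous_on UNIV (grad G)"
    using smooth_F smooth_G unfolding smooth_fun_def by auto
  have "continuous_on UNIV (\<lambda>z. grad G (fst z, \<theta>s z))"
    by (rule continuous_on_compose2[OF c(2)])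
       (auto intro!: continuous_intros theta_star_continuous)
  then show ?thesis unfolding gradPsi_def gradV_def
    by (intro continuous_intros c theta_star_continuous)
qed

text \<open>
  The optimality condition recovers \<open>y\<close> from \<open>\<theta>s (x, y)\<close> by a \<open>(1 + \<gamma> * L2)\<close>-Lipschitz map, and
  \<open>1 + \<gamma> * L2 < 3 / 2\<close>.
\<close>

lemma lipschitz_theta_star_ge:
  assumes "L-lipschitz_on UNIV \<theta>s"
  shows "2 / 3 \<le> L"
proof -
  obtain b :: 'y where b: "b \<in> Basis" using nonempty_Basis by blast
  let ?t = "\<theta>s (0, b)" and ?s = "\<theta>s (0, 0)"
  have "snd (grad G (0, ?t)) + r *\<^sub>R ?t = r *\<^sub>R b"
    using gradP_theta_star[of "(0, b)"] by (simp add: gradP_def scaleR_diff_right add_diff_eq)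
  moreover have "snd (grad G (0, ?s)) + r *\<^sub>R ?s = 0"
    using gradP_theta_star[of "(0, 0)"] by (simp add: gradP_def)
  ultimately have "r *\<^sub>R b = snd (grad G (0, ?t)) + r *\<^sub>R ?t - (snd (grad G (0, ?s)) + r *\<^sub>R ?s)"
    by simp
  then have "r *\<^sub>R b = r *\<^sub>R (?t - ?s) + snd (grad G (0, ?t) - grad G (0, ?s))"
    by (simp add: algebra_simps)
  then have "r \<le> norm (r *\<^sub>R (?t - ?s) + snd (grad G (0, ?t) - grad G (0, ?s)))"
    using b r_pos by (metis abs_of_pos mult_cancel_left2 norm_Basis norm_scaleR order_refl)
  also have "\<dots> \<le> r * norm (?t - ?s) + norm (snd (grad G (0, ?t) - grad G (0, ?s)))"
    using norm_triangle_ineq[of "r *\<^sub>R (?t - ?s)"] r_pos by simp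
  also have "norm (snd (grad G (0, ?t) - grad G (0, ?s))) \<le> norm (grad G (0, ?t) - grad G (0, ?s))"
    by (rule norm_snd_le_norm)
  also have "\<dots> \<le> L2 * norm (?t - ?s)"
    using smooth_fun_lipschitz[OF smooth_G, of "(0, ?t)" "(0, ?s)"] by (simp add: norm_Pair)
  also have "\<dots> \<le> r / 2 * norm (?t - ?s)" using L2_less by (intro mult_right_mono) auto
  finally have "r \<le> 3 / 2 * r * norm (?t - ?s)" by simp
  then have 1: "2 / 3 \<le> norm (?t - ?s)" using r_pos by (simp add: field_simps)
  have "norm (?t - ?s) \<le> L * 1"
    using lipschitz_onD[OF assms, of "(0, b)" "(0, 0)"] b by (simp add: dist_norm norm_Pair)
  then show ?thesis using 1 by simp
qed

section \<open>The energy\<close>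

text \<open>
  The penalized objective, shifted to be nonnegative, plus the optimality gap of \<open>\<theta>\<close>.
\<close>

definition energy :: "real \<Rightarrow> ('x \<times> 'y) \<times> 'y \<Rightarrow> real" where
  "energy m = (\<lambda>(z, \<theta>). m * (F z - F_low) + (G z - V z) + (P z \<theta> - V z))"

definition gradE :: "real \<Rightarrow> ('x \<times> 'y) \<times> 'y \<Rightarrow> ('x \<times> 'y) \<times> 'y" where
  "gradE m = (\<lambda>(z, \<theta>). (gradPsi m z + gap_grad z \<theta>, gradP z \<theta>))"

lemma energy_nonneg: "0 \<le> m \<Longrightarrow> 0 \<le> energy m v"
proof -
  assume "0 \<le> m"
  moreover have "V z \<le> G z" for z using V_env_le[of z "snd z"] by (simp add: prox_obj_r)
  ultimately show ?thesis
    unfolding energy_def case_prod_beta using F_low V_env_le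
    by (intro add_nonneg_nonneg mult_nonneg_nonneg) (simp_all only: diff_ge_0_iff_ge)
qed

lemma energy_mono: "m' \<le> m \<Longrightarrow> energy m' v \<le> energy m v"
  unfolding energy_def case_prod_beta using F_low[of "fst v"] by (simp add: mult_right_mono)

lemma energy_le:
  assumes "0 \<le> m"
  shows "energy m (z, \<theta>) \<le> m * (F z - F_low) + (G z - V z) + r * (norm (\<theta> - \<theta>s z))\<^sup>2"
proof -
  have "P z \<theta> \<le> V z + (L2 + r) / 2 * (norm (\<theta> - \<theta>s z))\<^sup>2"
    using prox_obj_upper[of z "\<theta>s z" "\<theta> - \<theta>s z"] by (simp add: gradP_theta_star V_env_eq)
  also have "(L2 + r) / 2 * (norm (\<theta> - \<theta>s z))\<^sup>2 \<le> r * (norm (\<theta> - \<theta>s z))\<^sup>2"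
    using L2_less r_pos by (intro mult_right_mono) auto
  finally show ?thesis by (simp add: energy_def)
qed

text \<open>
  The two curvatures are kept apart because \<open>z\<close> moves with the smaller step size: its curvature may
  be large, while the one of \<open>\<theta>\<close> has to stay below \<open>r\<close>.
\<close>

lemma energy_upper:
  assumes "0 \<le> m"
  shows "energy m (v + w) \<le> energy m v + inner (gradE m v) w
     + (17 / 2 * r + m * L1 / 2) * (norm (fst w))\<^sup>2 + 7 / 8 * r * (norm (snd w))\<^sup>2"
proof -
  obtain z \<theta> where v: "v = (z, \<theta>)" by (cases v)
  obtain u t where w: "w = (u, t)" by (cases w)
  have "m * F (z + u) \<le> m * (F z + inner (grad F z) u + L1 / 2 * (norm u)\<^sup>2)"
    using assms by (intro mult_left_mono smooth_fun_upper[OF smooth_F])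
  moreover have "G (z + u) \<le> G z + inner (grad G z) u + L2 / 2 * (norm u)\<^sup>2"
    by (rule smooth_fun_upper[OF smooth_G])
  moreover note V_env_lower[of z u] prox_obj_joint_upper[of z u \<theta> t]
  ultimately have "energy m (v + w) \<le> energy m v + inner (gradE m v) w
     + (15 / 2 * r + 2 * L2 + m * L1 / 2) * (norm u)\<^sup>2 + (L2 / 2 + 5 / 8 * r) * (norm t)\<^sup>2"
    unfolding v w by (simp add: energy_def gradE_def gradPsi_def inner_add_left inner_diff_left algebra_simps)
  moreover have "(15 / 2 * r + 2 * L2 + m * L1 / 2) * (norm u)\<^sup>2 \<le> (17 / 2 * r + m * L1 / 2) * (norm u)\<^sup>2"
    using L2_less by (intro mult_right_mono) auto
  moreover have "(L2 / 2 + 5 / 8 * r) * (norm t)\<^sup>2 \<le> 7 / 8 * r * (norm t)\<^sup>2"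
    using L2_less by (intro mult_right_mono) auto
  ultimately show ?thesis unfolding w by simp
qed

lemma energy_continuous: "continuous_on UNIV (energy m)"
proof -
  have "isCont F z" "isCont G z" for z
    using smooth_F smooth_G unfolding smooth_fun_def by (blast intro: differentiable_imp_continuous_within)+
  then have c: "continuous_on UNIV F" "continuous_on UNIV G"
    by (auto simp: continuous_at_imp_continuous_on)
  have "isCont V z" for z
    using gderiv_V[of z] unfolding gderiv_def by (rule has_derivative_continuous)
  then have cV: "continuous_on UNIV V" by (auto simp: continuous_at_imp_continuous_on)
  show ?thesis
    unfolding energy_def case_prod_beta prox_obj_def
    by (intro continuous_intros continuous_on_compose2[OF c(1)] continuous_on_compose2[OF c(2)]
        continuous_on_compose2[OF cV]) auto
qed

text \<open>
  A gradient step from \<open>v\<close> cannot bring the energy below \<open>0\<close>.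
\<close>

lemma gradE_squared_le:
  assumes "0 \<le> m"
  shows "(norm (gradE m v))\<^sup>2 \<le> (34 * r + 2 * m * L1) * energy m v"
proof -
  define A where "A = 17 / 2 * r + m * L1 / 2"
  have A: "0 < A" using assms r_pos L1_nonneg by (auto simp: A_def intro!: add_pos_nonneg)
  let ?g = "gradE m v"
  have "0 \<le> energy m (v + (- 1 / (2 * A)) *\<^sub>R ?g)" by (rule energy_nonneg[OF assms])
  also have "\<dots> \<le> energy m v - (norm ?g)\<^sup>2 / (2 * A)
      + A * (norm (fst ((- 1 / (2 * A)) *\<^sub>R ?g)))\<^sup>2 + 7 / 8 * r * (norm (snd ((- 1 / (2 * A)) *\<^sub>R ?g)))\<^sup>2"
    using energy_upper[OF assms, of v "(- 1 / (2 * A)) *\<^sub>R ?g"]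
    by (simp add: A_def power2_norm_eq_inner)
  also have "\<dots> \<le> energy m v - (norm ?g)\<^sup>2 / (2 * A)
      + A * (norm (fst ((- 1 / (2 * A)) *\<^sub>R ?g)))\<^sup>2 + A * (norm (snd ((- 1 / (2 * A)) *\<^sub>R ?g)))\<^sup>2"
    using assms r_pos L1_nonneg by (intro add_left_mono mult_right_mono) (auto simp: A_def)
  also have "\<dots> = energy m v - (norm ?g)\<^sup>2 / (2 * A) + A * (norm ((- 1 / (2 * A)) *\<^sub>R ?g))\<^sup>2"
    by (subst (5) prod.collapse[symmetric], subst norm_Pair_squared) (simp add: algebra_simps)
  also have "A * (norm ((- 1 / (2 * A)) *\<^sub>R ?g))\<^sup>2 = (norm ?g)\<^sup>2 / (4 * A)"
    using A by (simp add: power_mult_distrib power_divide power2_eq_square)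
  finally have "(norm ?g)\<^sup>2 / (4 * A) \<le> energy m v" by (simp add: field_simps)
  then have "(norm ?g)\<^sup>2 \<le> 4 * A * energy m v" using A by (simp add: field_simps)
  then show ?thesis by (simp add: A_def algebra_simps)
qed

lemma gradPsi_squared_le:
  assumes "0 \<le> m"
  shows "(norm (gradPsi m (fst v)))\<^sup>2 \<le> 12 * (34 * r + 2 * m * L1) * energy m v"
proof -
  let ?a = "gradPsi m (fst v)" and ?g = "gap_grad (fst v) (snd v)" and ?q = "gradP (fst v) (snd v)"
  have "\<eta>\<^sup>2 * (norm ?g)\<^sup>2 \<le> 5 * \<eta>\<^sup>2 * (norm ?q)\<^sup>2"
    by (rule order_trans[OF gap_grad_squared_le mult_right_mono[OF S_squared_le_eta zero_le_power2]])
  then have g: "(norm ?g)\<^sup>2 \<le> 5 * (norm ?q)\<^sup>2" using eta_bounds by simp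
  have "(norm (?a + ?g + (- ?g)))\<^sup>2 \<le> 2 * (norm (?a + ?g))\<^sup>2 + 2 * (norm (- ?g))\<^sup>2"
    using norm_add_squared_le_weighted[of 1 "?a + ?g" "- ?g"] by simp
  then have "(norm ?a)\<^sup>2 \<le> 2 * (norm (?a + ?g))\<^sup>2 + 2 * (norm ?g)\<^sup>2" by simp
  then have "(norm ?a)\<^sup>2 \<le> 12 * ((norm (?a + ?g))\<^sup>2 + (norm ?q)\<^sup>2)"
    unfolding distrib_left
    using g zero_le_power2[of "norm (?a + ?g)"] zero_le_power2[of "norm ?q"] by linarith
  also have "(norm (?a + ?g))\<^sup>2 + (norm ?q)\<^sup>2 = (norm (gradE m v))\<^sup>2"
    by (simp add: gradE_def case_prod_beta norm_Pair_squared)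
  also have "\<dots> \<le> (34 * r + 2 * m * L1) * energy m v" by (rule gradE_squared_le[OF assms])
  finally show ?thesis by (simp only: mult.assoc)
qed

end

section \<open>Contraction of gossip averaging\<close>

definition mat_trace :: "real mat \<Rightarrow> real" where
  "mat_trace A = (\<Sum>i<dim_row A. A $$ (i, i))"

lemma mat_mult_entry:
  assumes "A \<in> carrier_mat n n" "B \<in> carrier_mat n n" "i < n" "j < n"
  shows "(A * B) $$ (i, j) = (\<Sum>k<n. A $$ (i, k) * B $$ (k, j))"
  using assms by (auto simp: scalar_prod_def lessThan_atLeast0 intro!: sum.cong)

lemma mat_trace_commute:
  assumes "A \<in> carrier_mat n n" "B \<in> carrier_mat n n"
  shows "mat_trace (A * B) = mat_trace (B * A)"
proof -
  have "mat_trace (A * B) = (\<Sum>i<n. \<Sum>k<n. A $$ (i, k) * B $$ (k, i))"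
    using assms by (simp add: mat_trace_def mat_mult_entry[OF assms] del: index_mult_mat(1))
  also have "\<dots> = (\<Sum>k<n. \<Sum>i<n. B $$ (k, i) * A $$ (i, k))"
    by (subst sum.swap) (simp add: mult.commute)
  also have "\<dots> = mat_trace (B * A)"
    using assms by (simp add: mat_trace_def mat_mult_entry[OF assms(2,1)] del: index_mult_mat(1))
  finally show ?thesis .
qed

lemma mat_trace_similar:
  assumes "A \<in> carrier_mat n n" "similar_mat_wit A B P Q"
  shows "mat_trace A = mat_trace B"
proof -
  note * = similar_mat_witD2[OF assms]
  have "mat_trace A = mat_trace (P * (B * Q))" 
    using * by (metis assoc_mult_mat)
  also have "\<dots> = mat_trace (B * Q * P)" using * by (intro mat_trace_commute) auto
  also have "B * Q * P = B" using * by (metis assoc_mult_mat right_mult_one_mat)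
  finally show ?thesis .
qed

lemma pow_upper_triangular:
  assumes B: "B \<in> carrier_mat n n" and ut: "upper_triangular B"
  shows "i < n \<Longrightarrow> j \<le> i \<Longrightarrow> (B ^\<^sub>m m) $$ (i, j) = (if j = i then (B $$ (i, i)) ^ m else (0::real))"
proof (induction m arbitrary: i j)
  case 0
  then show ?case using B by auto
next
  case (Suc m)
  have Bm: "B ^\<^sub>m m \<in> carrier_mat n n" using B by (rule pow_carrier_mat)
  have "(B ^\<^sub>m Suc m) $$ (i, j) = (\<Sum>k<n. (B ^\<^sub>m m) $$ (i, k) * B $$ (k, j))"
    using Suc by (simp add: mat_mult_entry[OF Bm B] del: index_mult_mat(1))
  also have "\<dots> = (\<Sum>k<n. if k = i then (B $$ (i, i)) ^ m * B $$ (i, j) else 0)"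
  proof (rule sum.cong)
    fix k assume "k \<in> {..<n}"
    then have k: "k < n" by simp
    consider "k < i" | "k = i" | "i < k" by linarith
    then show "(B ^\<^sub>m m) $$ (i, k) * B $$ (k, j) = (if k = i then (B $$ (i, i)) ^ m * B $$ (i, j) else 0)"
    proof cases
      case 3
      then have "B $$ (k, j) = 0" using upper_triangularD[OF ut, of j k] Suc.prems k B by auto
      then show ?thesis using 3 by simp
    qed (use Suc in auto)
  qed simp
  also have "\<dots> = (B $$ (i, i)) ^ m * B $$ (i, j)" using Suc.prems by simp
  also have "\<dots> = (if j = i then (B $$ (i, i)) ^ Suc m else 0)"
    using upper_triangularD[OF ut, of j i] Suc.prems B by auto
  finally show ?case .
qed

text \<open>
  Triangularization gives the traces of all powers from the characteristic polynomial, without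
  an orthonormal basis of eigenvectors.
\<close>

lemma mat_trace_pow:
  fixes W :: "real mat" and ev :: "nat \<Rightarrow> real"
  assumes W: "W \<in> carrier_mat n n" and cp: "char_poly W = (\<Prod>i\<in>{1..n}. [:- ev i, 1:])"
  shows "mat_trace (W ^\<^sub>m m) = (\<Sum>i\<in>{1..n}. ev i ^ m)"
proof -
  define es where "es = map ev [1..<Suc n]"
  have "char_poly W = (\<Prod>e\<leftarrow>es. [:- e, 1:])"
    unfolding cp es_def by (simp add: comp_def prod.distinct_set_conv_list[symmetric] atLeastLessThanSuc_atLeastAtMost del: upt_Suc)
  moreover obtain B P Q where "schur_decomposition W es = (B, P, Q)" by (cases "schur_decomposition W es")
  ultimately have sim: "similar_mat_wit W B P Q" and ut: "upper_triangular B" and diag: "diag_mat B = es"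
    using schur_decomposition[OF W] by blast+
  have B: "B \<in> carrier_mat n n" using similar_mat_witD2[OF W sim] by simp
  have "mat_trace (W ^\<^sub>m m) = mat_trace (B ^\<^sub>m m)"
    using mat_trace_similar[OF pow_carrier_mat[OF W] similar_mat_wit_pow[OF sim]] .
  also have "\<dots> = (\<Sum>i<n. (B $$ (i, i)) ^ m)"
    using B pow_carrier_mat[OF B, of m] by (simp add: mat_trace_def pow_upper_triangular[OF B ut])
  also have "\<dots> = (\<Sum>i<n. ev (Suc i) ^ m)"
  proof (rule sum.cong)
    fix i assume "i \<in> {..<n}"
    then have "B $$ (i, i) = diag_mat B ! i" using B by (simp add: diag_mat_def)
    then show "(B $$ (i, i)) ^ m = ev (Suc i) ^ m" using \<open>i \<in> _\<close> by (simp add: diag es_def del: upt_Suc)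
  qed simp
  also have "\<dots> = (\<Sum>i\<in>{1..n}. ev i ^ m)"
    by (rule sum.reindex_bij_witness[where i="\<lambda>i. i - 1" and j=Suc]) auto
  finally show ?thesis .
qed

text \<open>
  Log-convexity makes the ratios \<open>s (Suc m) / s m\<close> increase, so the first ratio is at most the
  asymptotic growth rate.
\<close>

lemma first_ratio_le_growth_rate:
  fixes s :: "nat \<Rightarrow> real"
  assumes nonneg: "\<And>m. 0 \<le> s m"
    and convex: "\<And>m. (s (Suc m))\<^sup>2 \<le> s m * s (Suc (Suc m))"
    and growth: "\<And>m. s m \<le> C * q ^ m * s 0"
    and q: "0 \<le> q"
  shows "s 1 \<le> q * s 0"
proof (cases "s 0 = 0 \<or> s 1 = 0")
  case True
  then show ?thesis using growth[of 1] nonneg[of 0] q by auto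
next
  case False
  then have pos: "0 < s 0" "0 < s 1" using nonneg by (simp_all add: order_less_le)
  define t where "t = s 1 / s 0"
  have t: "0 < t" using pos by (simp add: t_def)
  have ratio: "0 < s m \<and> t * s m \<le> s (Suc m)" for m
  proof (induction m)
    case 0
    then show ?case using pos by (simp add: t_def)
  next
    case (Suc m)
    then have p: "0 < s (Suc m)" using t by (meson less_le_trans mult_pos_pos)
    have "t * s m * s (Suc m) \<le> s (Suc m) * s (Suc m)"
      using Suc p by (intro mult_right_mono) auto
    also have "\<dots> \<le> s m * s (Suc (Suc m))" using convex[of m] by (simp add: power2_eq_square)
    finally have "s m * (t * s (Suc m)) \<le> s m * s (Suc (Suc m))" by (simp add: mult_ac)
    then show ?case using Suc p by simp
  qed
  have "t ^ m * s 0 \<le> s m" for m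
  proof (induction m)
    case (Suc m)
    then have "t * (t ^ m * s 0) \<le> t * s m" using t by (intro mult_left_mono) auto
    then show ?case using ratio[of m] by (simp add: mult.assoc)
  qed simp
  then have "t ^ m * s 0 \<le> C * q ^ m * s 0" for m using growth[of m] order_trans by blast
  then have tC: "t ^ m \<le> C * q ^ m" for m using pos by simp
  have "t \<le> q"
  proof (rule ccontr)
    assume "\<not> t \<le> q"
    show False
    proof (cases "q = 0")
      case True
      then show False using tC[of 1] t by simp
    next
      case False
      then have q: "0 < q" using q by simp
      then have "1 < t / q" using \<open>\<not> t \<le> q\<close> by simp
      then obtain m where "C < (t / q) ^ m" using real_arch_pow by blast
      then show False using tC[of m] q by (simp add: power_divide field_simps)
    qed
  qed
  then show ?thesis using pos by (simp add: t_def field_simps)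
qed

lemma network_topology_n: "network_topology n W \<rho> \<Longrightarrow> 0 \<le> \<rho> \<and> \<rho> < 1"
  unfolding network_topology_def by auto

text \<open>
  Subtracting the averaging matrix from \<open>W\<^sup>m\<close> does not change its action on vectors of mean \<open>0\<close>, and
  removes the eigenvalue \<open>1\<close> from the squared Frobenius norm, which is the trace of \<open>W\<^sup>2\<^sup>m\<close>.  Hence the
  squared norm of \<open>W\<^sup>m v\<close> is at most \<open>n \<rho>\<^sup>2\<^sup>m\<close> times that of \<open>v\<close>.  Symmetry of \<open>W\<close> makes these
  squared norms log-convex in \<open>m\<close>, which improves the asymptotic rate to a bound for one step.
\<close>

lemma network_contraction_scalar:
  assumes nt: "network_topology n W \<rho>" and v: "(\<Sum>i<n. v i) = 0"
  shows "(\<Sum>i<n. (\<Sum>j<n. W $$ (i, j) * v j)\<^sup>2) \<le> \<rho>\<^sup>2 * (\<Sum>i<n. (v i)\<^sup>2)"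
proof (cases "n = 0")
  case False
  obtain ev :: "nat \<Rightarrow> real" where W: "W \<in> carrier_mat n n" and sym: "transpose_mat W = W"
    and row: "\<And>i. i < n \<Longrightarrow> (\<Sum>j<n. W $$ (i, j)) = 1"
    and cp: "char_poly W = (\<Prod>i\<in>{1..n}. [:- ev i, 1:])" and ev1: "ev 1 = 1"
    and dec: "\<And>i j. i \<in> {2..n} \<Longrightarrow> j \<in> {i..n} \<Longrightarrow> ev j \<le> ev i" and \<rho>: "\<rho> = max \<bar>ev 2\<bar> \<bar>ev n\<bar>"
    using nt unfolding network_topology_def by blast
  have sW: "W $$ (i, j) = W $$ (j, i)" if "i < n" "j < n" for i j
    using sym that W by (metis carrier_matD index_transpose_mat(1))
  have Wm: "W ^\<^sub>m m \<in> carrier_mat n n" for m using W by (rule pow_carrier_mat)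
  have Suc_entry: "(W ^\<^sub>m Suc m) $$ (i, j) = (\<Sum>k<n. (W ^\<^sub>m m) $$ (i, k) * W $$ (k, j))"
    if "i < n" "j < n" for m i j using that by (simp add: mat_mult_entry[OF Wm W] del: index_mult_mat(1))
  have sWm: "(W ^\<^sub>m m) $$ (i, j) = (W ^\<^sub>m m) $$ (j, i)" if "i < n" "j < n" for m i j
  proof -
    have "transpose_mat (W ^\<^sub>m m) = W ^\<^sub>m m"
    proof (induction m)
      case (Suc m)
      have "transpose_mat (W ^\<^sub>m Suc m) = W * W ^\<^sub>m m"
        using Suc sym by (simp add: transpose_mult[OF Wm W])
      also have "\<dots> = W ^\<^sub>m Suc m"
      proof (induction m)
        case (Suc k)
        have "W * W ^\<^sub>m Suc k = (W * W ^\<^sub>m k) * W" using assoc_mult_mat[OF W Wm W, of k] by simp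
        then show ?case using Suc by simp
      qed (use W in simp)
      finally show ?case .
    qed (use W in simp)
    then show ?thesis using that Wm[of m] by (metis carrier_matD index_transpose_mat(1))
  qed
  have rowm: "(\<Sum>j<n. (W ^\<^sub>m m) $$ (i, j)) = 1" if "i < n" for m i
    using that
  proof (induction m)
    case 0
    then show ?case using W by simp
  next
    case (Suc m)
    have "(\<Sum>j<n. (W ^\<^sub>m Suc m) $$ (i, j)) = (\<Sum>j<n. \<Sum>k<n. (W ^\<^sub>m m) $$ (i, k) * W $$ (k, j))"
      using Suc by (intro sum.cong) (simp_all add: Suc_entry del: pow_mat.simps)
    also have "\<dots> = (\<Sum>k<n. (W ^\<^sub>m m) $$ (i, k) * (\<Sum>j<n. W $$ (k, j)))"
      by (subst sum.swap) (simp add: sum_distrib_left)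
    finally show ?case using Suc by (simp add: row)
  qed
  have pow_add: "W ^\<^sub>m m * W ^\<^sub>m k = W ^\<^sub>m (m + k)" for m k
  proof (induction k)
    case (Suc k)
    have "W ^\<^sub>m m * W ^\<^sub>m Suc k = (W ^\<^sub>m m * W ^\<^sub>m k) * W"
      using assoc_mult_mat[OF Wm Wm W, of m k] by simp
    then show ?case using Suc by simp
  qed (use W Wm[of m] in simp)
  define u where "u m i = (\<Sum>j<n. (W ^\<^sub>m m) $$ (i, j) * v j)" for m i
  define s where "s m = (\<Sum>i<n. (u m i)\<^sup>2)" for m
  have u0: "u 0 i = v i" if "i < n" for i
    using that W by (simp add: u_def if_distrib[where f="\<lambda>c. c * _"] cong: if_cong)
  have uS: "u (Suc m) i = (\<Sum>j<n. W $$ (i, j) * u m j)" if "i < n" for m i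
  proof -
    have "u (Suc m) i = (\<Sum>j<n. (W ^\<^sub>m Suc m) $$ (j, i) * v j)"
      unfolding u_def using that by (intro sum.cong refl arg_cong2[where f="(*)"] sWm) auto
    also have "\<dots> = (\<Sum>j<n. \<Sum>k<n. (W ^\<^sub>m m) $$ (j, k) * W $$ (k, i) * v j)"
      using that by (intro sum.cong) (simp_all add: Suc_entry sum_distrib_right del: pow_mat.simps)
    also have "\<dots> = (\<Sum>k<n. \<Sum>j<n. W $$ (i, k) * ((W ^\<^sub>m m) $$ (k, j) * v j))"
      by (subst sum.swap) (use that in \<open>auto intro!: sum.cong simp: sW[of i] sWm[of _ _ m]\<close>)
    finally show ?thesis by (simp add: u_def sum_distrib_left)
  qed
  have "s 1 \<le> \<rho>\<^sup>2 * s 0"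
  proof (rule first_ratio_le_growth_rate[where C="real n"])
    show "0 \<le> s m" for m unfolding s_def by (intro sum_nonneg) simp
    show "(s (Suc m))\<^sup>2 \<le> s m * s (Suc (Suc m))" for m
    proof -
      have "s (Suc m) = (\<Sum>i<n. \<Sum>j<n. W $$ (i, j) * u m j * u (Suc m) i)"
        unfolding s_def by (intro sum.cong) (auto simp: uS power2_eq_square sum_distrib_right)
      also have "\<dots> = (\<Sum>j<n. u m j * (\<Sum>i<n. W $$ (j, i) * u (Suc m) i))"
        by (subst sum.swap) (auto simp: sum_distrib_left sW intro!: sum.cong)
      also have "\<dots> = (\<Sum>j<n. u m j * u (Suc (Suc m)) j)"
        by (intro sum.cong) (auto simp: uS)
      finally show ?thesis unfolding s_def[of m] s_def[of "Suc (Suc m)"]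
        by (simp add: Cauchy_Schwarz_ineq_sum)
    qed
    show "s m \<le> real n * (\<rho>\<^sup>2) ^ m * s 0" for m
    proof -
      have evle: "(ev i)\<^sup>2 \<le> \<rho>\<^sup>2" if "i \<in> {2..n}" for i
      proof -
        have "ev n \<le> ev i" "ev i \<le> ev 2" using dec[of i n] dec[of 2 i] that by auto
        then have "\<bar>ev i\<bar> \<le> \<bar>\<rho>\<bar>" unfolding \<rho> by linarith
        then show ?thesis by (simp add: abs_le_square_iff)
      qed
      have fro: "(\<Sum>i<n. \<Sum>j<n. ((W ^\<^sub>m m) $$ (i, j))\<^sup>2) = (\<Sum>i\<in>{1..n}. ev i ^ (m + m))"
      proof -
        have "(\<Sum>i<n. \<Sum>j<n. ((W ^\<^sub>m m) $$ (i, j))\<^sup>2)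
            = (\<Sum>i<n. \<Sum>j<n. (W ^\<^sub>m m) $$ (i, j) * (W ^\<^sub>m m) $$ (j, i))"
          by (intro sum.cong refl) (auto simp: power2_eq_square intro!: sWm)
        also have "\<dots> = mat_trace (W ^\<^sub>m m * W ^\<^sub>m m)"
          using Wm[of m] W by (simp add: mat_trace_def mat_mult_entry[OF Wm Wm] del: index_mult_mat(1))
        also have "W ^\<^sub>m m * W ^\<^sub>m m = W ^\<^sub>m (m + m)" 
          by (rule pow_add)
        finally show ?thesis by (simp add: mat_trace_pow[OF W cp])
      qed
      have "(\<Sum>i<n. \<Sum>j<n. ((W ^\<^sub>m m) $$ (i, j) - 1 / n)\<^sup>2)
          = (\<Sum>i<n. (\<Sum>j<n. ((W ^\<^sub>m m) $$ (i, j))\<^sup>2) - 2 / n * (\<Sum>j<n. (W ^\<^sub>m m) $$ (i, j)) + n * (1 / n)\<^sup>2)"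
        by (simp add: power2_diff sum.distrib sum_subtractf sum_distrib_left mult_ac)
      also have "\<dots> = (\<Sum>i<n. (\<Sum>j<n. ((W ^\<^sub>m m) $$ (i, j))\<^sup>2) - 1 / n)"
        using False by (intro sum.cong) (auto simp: rowm power2_eq_square field_simps)
      also have "\<dots> = (\<Sum>i\<in>{1..n}. ev i ^ (m + m)) - 1"
        using False by (simp add: sum_subtractf fro)
      also have "\<dots> = (\<Sum>i\<in>{2..n}. ((ev i)\<^sup>2) ^ m)"
        using False ev1 by (subst sum.atLeast_Suc_atMost) (auto simp: numeral_2_eq_2 power_add power_mult_distrib)
      also have "\<dots> \<le> (\<Sum>i\<in>{2..n}. (\<rho>\<^sup>2) ^ m)" by (intro sum_mono power_mono evle) auto
      also have "\<dots> \<le> real n * (\<rho>\<^sup>2) ^ m" by (auto intro!: mult_right_mono)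
      finally have F: "(\<Sum>i<n. \<Sum>j<n. ((W ^\<^sub>m m) $$ (i, j) - 1 / n)\<^sup>2) \<le> real n * (\<rho>\<^sup>2) ^ m" .
      have "s m = (\<Sum>i<n. (\<Sum>j<n. ((W ^\<^sub>m m) $$ (i, j) - 1 / n) * v j)\<^sup>2)"
        unfolding s_def u_def using v by (simp add: left_diff_distrib sum_subtractf sum_divide_distrib[symmetric])
      also have "\<dots> \<le> (\<Sum>i<n. (\<Sum>j<n. ((W ^\<^sub>m m) $$ (i, j) - 1 / n)\<^sup>2) * (\<Sum>j<n. (v j)\<^sup>2))"
        by (intro sum_mono Cauchy_Schwarz_ineq_sum)
      also have "\<dots> = (\<Sum>i<n. \<Sum>j<n. ((W ^\<^sub>m m) $$ (i, j) - 1 / n)\<^sup>2) * s 0"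
        by (simp add: s_def u0 sum_distrib_right)
      also have "\<dots> \<le> real n * (\<rho>\<^sup>2) ^ m * s 0"
        by (intro mult_right_mono F) (simp add: s_def sum_nonneg)
      finally show ?thesis .
    qed
  qed simp
  then show ?thesis by (simp add: s_def uS u0 del: pow_mat.simps)
qed simp

lemma norm_squared_eq_sum_Basis: "(norm (x::'a::euclidean_space))\<^sup>2 = (\<Sum>b\<in>Basis. (inner x b)\<^sup>2)"
  unfolding power2_norm_eq_inner by (subst euclidean_inner) (simp add: power2_eq_square)

lemma mean_gossip:
  assumes "network_topology n W \<rho>"
  shows "mean n (\<lambda>i. gossip n W i u) = mean n u"
proof -
  have c: "\<And>j. j < n \<Longrightarrow> (\<Sum>i<n. W $$ (i, j)) = 1"
    using assms unfolding network_topology_def by blast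
  have "(\<Sum>i<n. gossip n W i u) = (\<Sum>j<n. (\<Sum>i<n. W $$ (i, j)) *\<^sub>R u j)"
    unfolding gossip_def by (subst sum.swap) (simp add: scaleR_sum_left)
  then show ?thesis using c by (simp add: mean_def)
qed

lemma gossip_contraction:
  fixes u :: "nat \<Rightarrow> 'a::euclidean_space"
  assumes nt: "network_topology n W \<rho>" and n: "1 \<le> n"
  shows "mean n (\<lambda>i. (norm (gossip n W i u - mean n u))\<^sup>2) \<le> \<rho>\<^sup>2 * mean n (\<lambda>i. (norm (u i - mean n u))\<^sup>2)"
proof -
  have row: "\<And>i. i < n \<Longrightarrow> (\<Sum>j<n. W $$ (i, j)) = 1"
    using nt unfolding network_topology_def by blast
  define w where "w i = u i - mean n u" for i
  have w0: "(\<Sum>i<n. w i) = 0"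
    using n by (simp add: w_def sum_subtractf sum_constant_scaleR mean_def)
  have g: "gossip n W i u - mean n u = gossip n W i w" if "i < n" for i
    using row[OF that] by (simp add: gossip_def w_def scaleR_diff_right sum_subtractf scaleR_sum_left[symmetric])
  have "(\<Sum>i<n. (norm (gossip n W i w))\<^sup>2) = (\<Sum>b\<in>Basis. \<Sum>i<n. (\<Sum>j<n. W $$ (i, j) * inner (w j) b)\<^sup>2)"
    unfolding norm_squared_eq_sum_Basis
    by (subst sum.swap) (simp add: gossip_def inner_sum_left)
  also have "\<dots> \<le> (\<Sum>b\<in>Basis. \<rho>\<^sup>2 * (\<Sum>i<n. (inner (w i) b)\<^sup>2))"
    by (intro sum_mono network_contraction_scalar[OF nt]) (simp add: inner_sum_left[symmetric] w0)
  also have "\<dots> = \<rho>\<^sup>2 * (\<Sum>i<n. (norm (w i))\<^sup>2)"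
    unfolding norm_squared_eq_sum_Basis
    by (subst sum.swap) (simp add: sum_distrib_left)
  finally have "(\<Sum>i<n. (norm (gossip n W i w))\<^sup>2) \<le> \<rho>\<^sup>2 * (\<Sum>i<n. (norm (w i))\<^sup>2)" .
  then have "(1 / real n) * (\<Sum>i<n. (norm (gossip n W i w))\<^sup>2) \<le> (1 / real n) * (\<rho>\<^sup>2 * (\<Sum>i<n. (norm (w i))\<^sup>2))"
    by (intro mult_left_mono) auto
  then have "mean n (\<lambda>i. (norm (gossip n W i w))\<^sup>2) \<le> \<rho>\<^sup>2 * mean n (\<lambda>i. (norm (w i))\<^sup>2)"
    by (simp add: mean_def)
  moreover have "mean n (\<lambda>i. (norm (gossip n W i u - mean n u))\<^sup>2) = mean n (\<lambda>i. (norm (gossip n W i w))\<^sup>2)"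
    by (rule mean_cong) (simp add: g)
  ultimately show ?thesis by (simp add: w_def)
qed

lemma mean_deviation:
  fixes u :: "nat \<Rightarrow> 'a::euclidean_space"
  assumes n: "1 \<le> n"
  shows "mean n (\<lambda>i. (norm (u i - m))\<^sup>2) = mean n (\<lambda>i. (norm (u i - mean n u))\<^sup>2) + (norm (mean n u - m))\<^sup>2"
proof -
  have "mean n (\<lambda>i. u i - mean n u) = 0"
    using n by (simp add: mean_diff[symmetric] mean_const)
  then have z: "mean n (\<lambda>i. inner (u i - mean n u) (mean n u - m)) = 0"
    using linear_mean[of "\<lambda>x. inner x (mean n u - m)" n "\<lambda>i. u i - mean n u"]
    by (simp add: bounded_linear.linear[OF bounded_linear_inner_left])
  have "(norm (u i - m))\<^sup>2 = (norm (u i - mean n u))\<^sup>2 + 2 * inner (u i - mean n u) (mean n u - m) + (norm (mean n u - m))\<^sup>2" for i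
    by (simp add: power2_norm_eq_inner algebra_simps inner_diff_left inner_diff_right inner_commute)
  then show ?thesis using z n
    by (simp add: mean_add[symmetric] mean_cmult mean_const)
qed

section \<open>Joint measurability of sampled gradients\<close>

text \<open>
  Approximating the identity by simple functions \<open>U i\<close>, the function is the limit of
  \<open>h s (U i z)\<close>, each of which involves only countably many of the sections \<open>h \<cdot> z\<close>.
\<close>

lemma caratheodory_measurable:
  fixes h :: "'s \<Rightarrow> 'a::euclidean_space \<Rightarrow> real"
  assumes meas: "\<And>z. (\<lambda>s. h s z) \<in> borel_measurable S"
    and cont: "\<And>s z. s \<in> space S \<Longrightarrow> isCont (h s) z"
  shows "(\<lambda>(s, z). h s z) \<in> borel_measurable (S \<Otimes>\<^sub>M borel)"
proof -
  obtain U :: "nat \<Rightarrow> 'a \<Rightarrow> 'a" where U: "\<And>i. simple_function borel (U i)" "\<And>z. (\<lambda>i. U i z) \<longlonglongrightarrow> z"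
    using borel_measurable_implies_sequence_metric[of "\<lambda>z::'a. z" borel 0] by auto
  show ?thesis
  proof (rule borel_measurable_LIMSEQ_real)
    show "(\<lambda>i. (case p of (s, z) \<Rightarrow> h s (U i z))) \<longlonglongrightarrow> (case p of (s, z) \<Rightarrow> h s z)"
      if "p \<in> space (S \<Otimes>\<^sub>M borel)" for p
      using that by (auto simp: space_pair_measure intro!: isCont_tendsto_compose[OF cont U(2)])
    show "(\<lambda>p. case p of (s, z) \<Rightarrow> h s (U i z)) \<in> borel_measurable (S \<Otimes>\<^sub>M borel)" for i
    proof -
      have fin: "finite (range (U i))" using U(1)[of i] by (auto simp: simple_function_def)
      have g: "(\<lambda>p. U i (snd p)) \<in> measurable (S \<Otimes>\<^sub>M borel) (count_space (range (U i)))"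
      proof (rule measurable_compose[OF measurable_snd])
        show "U i \<in> measurable borel (count_space (range (U i)))"
          using U(1)[of i] unfolding measurable_count_space_eq2[OF fin] by (auto simp: simple_function_def)
      qed
      have "(\<lambda>p. h (fst p) (U i (snd p))) \<in> borel_measurable (S \<Otimes>\<^sub>M borel)"
      proof (rule measurable_compose_countable'[OF _ g countable_finite[OF fin]])
        show "(\<lambda>p. h (fst p) z) \<in> borel_measurable (S \<Otimes>\<^sub>M borel)" for z
          by (rule measurable_compose[OF measurable_fst meas])
      qed
      then show ?thesis by (simp add: case_prod_beta)
    qed
  qed
qed

text \<open>
  The components of the gradient are limits of difference quotients along a fixed null sequence of
  increments, so measurability of the function values carries over.
\<close>

lemma grad_jointly_measurable:
  fixes h :: "'s \<Rightarrow> 'a::euclidean_space \<Rightarrow> real"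
  assumes meas: "\<And>z. (\<lambda>s. h s z) \<in> borel_measurable S"
    and diff: "\<And>s z. s \<in> space S \<Longrightarrow> h s differentiable (at z)"
  shows "(\<lambda>(s, z). grad (h s) z) \<in> borel_measurable (S \<Otimes>\<^sub>M borel)"
proof (subst borel_measurable_euclidean_space, rule ballI)
  fix b :: 'a assume b: "b \<in> Basis"
  have H: "(\<lambda>(s, z). h s z) \<in> borel_measurable (S \<Otimes>\<^sub>M borel)"
    using diff by (intro caratheodory_measurable meas) (auto intro: differentiable_imp_continuous_within)
  show "(\<lambda>p. inner (case p of (s, z) \<Rightarrow> grad (h s) z) b) \<in> borel_measurable (S \<Otimes>\<^sub>M borel)"
  proof (rule borel_measurable_LIMSEQ_real)
    fix p assume p: "p \<in> space (S \<Otimes>\<^sub>M (borel :: 'a measure))"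
    obtain s z where sz: "p = (s, z)" by (cases p)
    have s: "s \<in> space S" using p by (simp add: sz space_pair_measure)
    have "(h s has_derivative (\<lambda>w. inner w (grad (h s) z))) (at (z + 0 *\<^sub>R b))"
      using gderiv_grad[OF diff[OF s]] by (simp add: gderiv_def)
    then have "((\<lambda>t. h s (z + t *\<^sub>R b)) has_derivative (\<lambda>t. inner (t *\<^sub>R b) (grad (h s) z))) (at 0)"
      by (rule has_derivative_compose[rotated]) (auto intro!: derivative_eq_intros)
    then have "((\<lambda>t. h s (z + t *\<^sub>R b)) has_real_derivative inner (grad (h s) z) b) (at 0)"
      unfolding has_field_derivative_def by (simp add: inner_commute mult_commute_abs)
    then have "((\<lambda>t. (h s (z + t *\<^sub>R b) - h s z) / t) \<longlongrightarrow> inner (grad (h s) z) b) (at 0)"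
      by (simp add: DERIV_def)
    moreover have "filterlim (\<lambda>i. inverse (real (Suc i))) (at 0) sequentially"
      using LIMSEQ_inverse_real_of_nat by (auto simp: filterlim_at)
    ultimately have "(\<lambda>i. (h s (z + inverse (real (Suc i)) *\<^sub>R b) - h s z) / inverse (real (Suc i)))
        \<longlonglongrightarrow> inner (grad (h s) z) b"
      by (rule filterlim_compose)
    then show "(\<lambda>i. (h (fst p) (snd p + inverse (real (Suc i)) *\<^sub>R b) - h (fst p) (snd p)) / inverse (real (Suc i)))
        \<longlonglongrightarrow> inner (case p of (s, z) \<Rightarrow> grad (h s) z) b"
      by (simp add: sz)
  next
    fix i
    have "(\<lambda>p. (fst p, snd p + inverse (real (Suc i)) *\<^sub>R b)) \<in> measurable (S \<Otimes>\<^sub>M borel) (S \<Otimes>\<^sub>M borel)"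
      by measurable
    from measurable_compose[OF this H]
    have [measurable]: "(\<lambda>p. h (fst p) (snd p + inverse (real (Suc i)) *\<^sub>R b)) \<in> borel_measurable (S \<Otimes>\<^sub>M borel)"
      by simp
    have [measurable]: "(\<lambda>p. h (fst p) (snd p)) \<in> borel_measurable (S \<Otimes>\<^sub>M borel)"
      using H by (simp add: case_prod_beta)
    show "(\<lambda>p. (h (fst p) (snd p + inverse (real (Suc i)) *\<^sub>R b) - h (fst p) (snd p)) / inverse (real (Suc i)))
        \<in> borel_measurable (S \<Otimes>\<^sub>M borel)"
      by measurable
  qed
qed

section \<open>Square integrable random vectors\<close>

definition square_integrable :: "'w measure \<Rightarrow> ('w \<Rightarrow> 'a::euclidean_space) \<Rightarrow> bool" where
  "square_integrable M X \<longleftrightarrow> X \<in> borel_measurable M \<and> integrable M (\<lambda>\<omega>. (norm (X \<omega>))\<^sup>2)"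

lemma square_integrable_bound:
  assumes X: "square_integrable M X" and Y: "square_integrable M Y"
    and Z: "Z \<in> borel_measurable M"
    and le: "\<And>\<omega>. \<omega> \<in> space M \<Longrightarrow> norm (Z \<omega>) \<le> a * norm (X \<omega>) + b * norm (Y \<omega>)"
  shows "square_integrable M Z"
  unfolding square_integrable_def
proof (intro conjI Z)
  show "integrable M (\<lambda>\<omega>. (norm (Z \<omega>))\<^sup>2)"
  proof (rule Bochner_Integration.integrable_bound)
    show "integrable M (\<lambda>\<omega>. 2 * a\<^sup>2 * (norm (X \<omega>))\<^sup>2 + 2 * b\<^sup>2 * (norm (Y \<omega>))\<^sup>2)"
      using X Y unfolding square_integrable_def by auto
    show "(\<lambda>\<omega>. (norm (Z \<omega>))\<^sup>2) \<in> borel_measurable M" using Z by measurable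
    show "AE \<omega> in M. norm ((norm (Z \<omega>))\<^sup>2) \<le> norm (2 * a\<^sup>2 * (norm (X \<omega>))\<^sup>2 + 2 * b\<^sup>2 * (norm (Y \<omega>))\<^sup>2)"
    proof (rule AE_I2)
      fix \<omega> assume "\<omega> \<in> space M"
      then have "(norm (Z \<omega>))\<^sup>2 \<le> (a * norm (X \<omega>) + b * norm (Y \<omega>))\<^sup>2" using le by (intro power_mono) auto
      also have "\<dots> \<le> 2 * (a * norm (X \<omega>))\<^sup>2 + 2 * (b * norm (Y \<omega>))\<^sup>2" 
        using norm_add_squared_le_weighted[of 1 "a * norm (X \<omega>)" "b * norm (Y \<omega>)"] by simp
      finally show "norm ((norm (Z \<omega>))\<^sup>2) \<le> norm (2 * a\<^sup>2 * (norm (X \<omega>))\<^sup>2 + 2 * b\<^sup>2 * (norm (Y \<omega>))\<^sup>2)"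
        by (simp add: power_mult_distrib)
    qed
  qed
qed

lemma square_integrable_scaleR:
  "square_integrable M X \<Longrightarrow> square_integrable M (\<lambda>\<omega>. a *\<^sub>R X \<omega>)"
  by (rule square_integrable_bound[of M X X _ "\<bar>a\<bar>" 0]) (auto simp: square_integrable_def)

lemma square_integrable_add:
  assumes "square_integrable M X" "square_integrable M Y"
  shows "square_integrable M (\<lambda>\<omega>. X \<omega> + Y \<omega>)"
  by (rule square_integrable_bound[OF assms, of _ 1 1])
     (use assms in \<open>auto simp: square_integrable_def norm_triangle_ineq\<close>)

lemma square_integrable_diff:
  assumes "square_integrable M X" "square_integrable M Y"
  shows "square_integrable M (\<lambda>\<omega>. X \<omega> - Y \<omega>)"
  by (rule square_integrable_bound[OF assms, of _ 1 1])
     (use assms in \<open>auto simp: square_integrable_def norm_triangle_ineq4\<close>)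

lemma square_integrable_const: "finite_measure M \<Longrightarrow> square_integrable M (\<lambda>_. a)"
  by (simp add: square_integrable_def finite_measure.integrable_const)

lemma square_integrable_sum:
  assumes "finite_measure M" "\<And>i. i \<in> I \<Longrightarrow> square_integrable M (X i)"
  shows "square_integrable M (\<lambda>\<omega>. \<Sum>i\<in>I. X i \<omega>)"
  using assms(2)
  by (induction I rule: infinite_finite_induct)
     (auto intro: square_integrable_add square_integrable_const[OF assms(1)])

lemma square_integrable_mean:
  assumes "finite_measure M" "\<And>i. i < n \<Longrightarrow> square_integrable M (X i)"
  shows "square_integrable M (\<lambda>\<omega>. mean n (\<lambda>i. X i \<omega>))"
  unfolding mean_def using assms by (intro square_integrable_scaleR square_integrable_sum) auto

lemma square_integrable_linear_bound:
  assumes "finite_measure M" "square_integrable M X" "Z \<in> borel_measurable M"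
    and "\<And>\<omega>. \<omega> \<in> space M \<Longrightarrow> norm (Z \<omega>) \<le> a * norm (X \<omega>) + b"
  shows "square_integrable M Z"
  by (rule square_integrable_bound[OF assms(2) square_integrable_const[OF assms(1), of "1::real"] assms(3), of a b])
     (use assms(4) in auto)

lemma square_integrable_inner:
  assumes "square_integrable M X" "square_integrable M Y"
  shows "integrable M (\<lambda>\<omega>. inner (X \<omega>) (Y \<omega>))"
proof (rule Bochner_Integration.integrable_bound)
  show "integrable M (\<lambda>\<omega>. (norm (X \<omega>))\<^sup>2 + (norm (Y \<omega>))\<^sup>2)"
    using assms unfolding square_integrable_def by auto
  have [measurable]: "X \<in> borel_measurable M" "Y \<in> borel_measurable M" 
    using assms unfolding square_integrable_def by auto
  show "(\<lambda>\<omega>. inner (X \<omega>) (Y \<omega>)) \<in> borel_measurable M" by measurable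
  show "AE \<omega> in M. norm (inner (X \<omega>) (Y \<omega>)) \<le> norm ((norm (X \<omega>))\<^sup>2 + (norm (Y \<omega>))\<^sup>2)"
  proof (rule AE_I2)
    fix \<omega>
    have "\<bar>inner (X \<omega>) (Y \<omega>)\<bar> \<le> norm (X \<omega>) * norm (Y \<omega>)" by (rule Cauchy_Schwarz_ineq2)
    also have "\<dots> \<le> (norm (X \<omega>))\<^sup>2 + (norm (Y \<omega>))\<^sup>2"
      using two_mult_le_weighted[of 1 "norm (X \<omega>)" "norm (Y \<omega>)"]
      by (simp add: sum_power2_ge_zero) (smt (verit) mult_nonneg_nonneg norm_ge_zero)
    finally show "norm (inner (X \<omega>) (Y \<omega>)) \<le> norm ((norm (X \<omega>))\<^sup>2 + (norm (Y \<omega>))\<^sup>2)" by simp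
  qed
qed

lemma square_integrable_norm:
  "square_integrable M X \<Longrightarrow> integrable M (\<lambda>\<omega>. (norm (X \<omega>))\<^sup>2)"
  by (simp add: square_integrable_def)

section \<open>Independence of the past and a fresh sample\<close>

locale sampling = prob_space M for M :: "'w measure" +
  fixes I :: "'i set" and Sm :: "'i \<Rightarrow> 's measure" and \<xi> :: "'i \<Rightarrow> 'w \<Rightarrow> 's"
  assumes indep: "indep_vars Sm \<xi> I"
    and law: "\<And>j. j \<in> I \<Longrightarrow> distr M (Sm j) (\<xi> j) = Sm j"
begin

text \<open>
  The \<open>\<sigma>\<close>-algebra generated by the samples with index in \<open>J\<close>.  Measurability with respect to it
  says that a random variable is a function of these samples, without naming that function.
\<close>

definition past :: "'i set \<Rightarrow> 'w measure" where
  "past J = vimage_algebra (space M) (\<lambda>\<omega>. \<lambda>j\<in>J. \<xi> j \<omega>) (PiM J Sm)"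

lemma space_past [simp]: "space (past J) = space M" by (simp add: past_def)

lemma sample_measurable: "j \<in> I \<Longrightarrow> \<xi> j \<in> measurable M (Sm j)"
  using indep by (auto simp: indep_vars_def)

lemma tuple_measurable: "J \<subseteq> I \<Longrightarrow> (\<lambda>\<omega>. \<lambda>j\<in>J. \<xi> j \<omega>) \<in> measurable M (PiM J Sm)"
  by (rule measurable_restrict) (auto intro: sample_measurable)

lemma tuple_in_space: "J \<subseteq> I \<Longrightarrow> (\<lambda>\<omega>. \<lambda>j\<in>J. \<xi> j \<omega>) \<in> space M \<rightarrow> space (PiM J Sm)"
  using measurable_space[OF tuple_measurable] by blast

lemma tuple_measurable_past: "J \<subseteq> I \<Longrightarrow> (\<lambda>\<omega>. \<lambda>j\<in>J. \<xi> j \<omega>) \<in> measurable (past J) (PiM J Sm)"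
  unfolding past_def by (rule measurable_vimage_algebra1[OF tuple_in_space])

lemma past_mono:
  assumes "J \<subseteq> J'" "J' \<subseteq> I" "X \<in> measurable (past J) N"
  shows "X \<in> measurable (past J') N"
proof -
  have "(\<lambda>\<omega>. \<omega>) \<in> measurable (past J') (past J)"
    unfolding past_def[of J]
  proof (rule measurable_vimage_algebra2)
    have "(\<lambda>\<omega>. \<lambda>j\<in>J. (\<lambda>i\<in>J'. \<xi> i \<omega>) j) \<in> measurable (past J') (PiM J Sm)"
      by (rule measurable_restrict, rule measurable_compose[OF tuple_measurable_past[OF assms(2)]])
         (use assms(1) in \<open>auto intro: measurable_component_singleton\<close>)
    moreover have "(\<lambda>j\<in>J. (\<lambda>i\<in>J'. \<xi> i \<omega>) j) = (\<lambda>j\<in>J. \<xi> j \<omega>)" for \<omega>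
      using assms(1) by (auto simp: restrict_def fun_eq_iff)
    ultimately show "(\<lambda>\<omega>. \<lambda>j\<in>J. \<xi> j \<omega>) \<in> measurable (past J') (PiM J Sm)" by simp
  qed simp
  from measurable_compose[OF this assms(3)] show ?thesis by simp
qed

lemma past_measurable:
  assumes "J \<subseteq> I" "X \<in> measurable (past J) N"
  shows "X \<in> measurable M N"
proof -
  have "(\<lambda>\<omega>. \<omega>) \<in> measurable M (past J)"
    unfolding past_def
    by (rule measurable_vimage_algebra2, simp, rule measurable_restrict)
       (use assms(1) in \<open>auto intro: sample_measurable\<close>)
  from measurable_compose[OF this assms(2)] show ?thesis by simp
qed

lemma sample_past:
  assumes "j \<in> J" "J \<subseteq> I" shows "\<xi> j \<in> measurable (past J) (Sm j)"
proof -
  have "(\<lambda>\<omega>. (\<lambda>i\<in>J. \<xi> i \<omega>) j) \<in> measurable (past J) (Sm j)"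
    by (rule measurable_compose[OF tuple_measurable_past[OF assms(2)]])
       (use assms(1) in \<open>auto intro: measurable_component_singleton\<close>)
  then show ?thesis using assms(1) by simp
qed

text \<open>
  Stated for events rather than with \<open>indep_var\<close>, which would force \<open>X\<close> and the sample to have the
  same type.
\<close>

lemma past_indep_sample:
  assumes J: "J \<subseteq> I" and j: "j \<in> I" "j \<notin> J" and X: "X \<in> measurable (past J) N"
    and A: "A \<in> sets N" and B: "B \<in> sets (Sm j)"
  shows "prob ((X -` A \<inter> space M) \<inter> (\<xi> j -` B \<inter> space M)) = prob (X -` A \<inter> space M) * prob (\<xi> j -` B \<inter> space M)"
proof -
  let ?T = "\<lambda>J \<omega>. \<lambda>i\<in>J. \<xi> i \<omega>"
  have ind: "indep_var (PiM J Sm) (?T J) (PiM {j} Sm) (?T {j})"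
    using J j by (intro indep_var_restrict[OF indep]) auto
  have "X -` A \<inter> space M \<in> sets (past J)" using measurable_sets[OF X A] by simp
  then obtain C where C: "C \<in> sets (PiM J Sm)" "X -` A \<inter> space M = ?T J -` C \<inter> space M"
    unfolding past_def sets_vimage_algebra2[OF tuple_in_space[OF J]] by blast
  define B' where "B' = (\<lambda>f. f j) -` B \<inter> space (PiM {j} Sm)"
  have B': "B' \<in> sets (PiM {j} Sm)"
    unfolding B'_def by (rule measurable_sets[OF measurable_component_singleton[of j "{j}" Sm] B]) simp
  have eq: "?T {j} -` B' \<inter> space M = \<xi> j -` B \<inter> space M"
    using tuple_in_space[of "{j}"] j(1) by (auto simp: B'_def Pi_iff)
  have "(\<lambda>x. (?T J x, ?T {j} x)) -` (C \<times> B') \<inter> space M = (?T J -` C \<inter> space M) \<inter> (?T {j} -` B' \<inter> space M)"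
    by auto
  then show ?thesis
    using indep_varD[OF ind C(1) B'] by (simp only: eq C(2))
qed

text \<open>
  By independence the pair of a past-measurable variable and a fresh sample has a product law, so its
  expectations can be computed by first averaging over the sample.
\<close>

lemma joint_law:
  assumes J: "J \<subseteq> I" and j: "j \<in> I" "j \<notin> J" and X: "X \<in> measurable (past J) N"
  shows "distr M (N \<Otimes>\<^sub>M Sm j) (\<lambda>\<omega>. (X \<omega>, \<xi> j \<omega>)) = distr M N X \<Otimes>\<^sub>M Sm j"
proof -
  have XM [measurable]: "X \<in> measurable M N" by (rule past_measurable[OF J X])
  have xi [measurable]: "\<xi> j \<in> measurable M (Sm j)" by (rule sample_measurable[OF j(1)])
  interpret D: prob_space "distr M N X" by (rule prob_space_distr[OF XM])
  interpret E: prob_space "distr M (Sm j) (\<xi> j)" by (rule prob_space_distr[OF xi])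
  have "distr M N X \<Otimes>\<^sub>M distr M (Sm j) (\<xi> j) = distr M (N \<Otimes>\<^sub>M Sm j) (\<lambda>\<omega>. (X \<omega>, \<xi> j \<omega>))"
  proof (rule pair_measure_eqI)
    show "sigma_finite_measure (distr M N X)" "sigma_finite_measure (distr M (Sm j) (\<xi> j))" by unfold_locales
    show "sets (distr M N X \<Otimes>\<^sub>M distr M (Sm j) (\<xi> j)) = sets (distr M (N \<Otimes>\<^sub>M Sm j) (\<lambda>\<omega>. (X \<omega>, \<xi> j \<omega>)))"
      by simp
    fix A B assume AB: "A \<in> sets (distr M N X)" "B \<in> sets (distr M (Sm j) (\<xi> j))"
    then have AB': "A \<in> sets N" "B \<in> sets (Sm j)" by simp_all
    have "emeasure (distr M (N \<Otimes>\<^sub>M Sm j) (\<lambda>\<omega>. (X \<omega>, \<xi> j \<omega>))) (A \<times> B)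
        = emeasure M ((X -` A \<inter> space M) \<inter> (\<xi> j -` B \<inter> space M))"
      using AB' by (subst emeasure_distr) (auto intro!: arg_cong[where f="emeasure M"])
    also have "\<dots> = emeasure M (X -` A \<inter> space M) * emeasure M (\<xi> j -` B \<inter> space M)"
      using past_indep_sample[OF J j X AB'] by (simp add: emeasure_eq_measure ennreal_mult)
    finally show "emeasure (distr M N X) A * emeasure (distr M (Sm j) (\<xi> j)) B
        = emeasure (distr M (N \<Otimes>\<^sub>M Sm j) (\<lambda>\<omega>. (X \<omega>, \<xi> j \<omega>))) (A \<times> B)"
      using AB' by (simp add: emeasure_distr)
  qed
  then show ?thesis by (simp add: law[OF j(1)])
qed

definition err :: "'i \<Rightarrow> ('s \<Rightarrow> 'a::euclidean_space \<Rightarrow> real) \<Rightarrow> ('a \<Rightarrow> real) \<Rightarrow> ('w \<Rightarrow> 'a) \<Rightarrow> 'w \<Rightarrow> 'a" where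
  "err j hs h X \<omega> = grad (hs (\<xi> j \<omega>)) (X \<omega>) - grad h (X \<omega>)"

context
  fixes J :: "'i set" and j :: 'i and hs :: "'s \<Rightarrow> 'a::euclidean_space \<Rightarrow> real" and h :: "'a \<Rightarrow> real"
    and \<delta> L :: real and X :: "'w \<Rightarrow> 'a"
  assumes J: "J \<subseteq> I" and j: "j \<in> I" "j \<notin> J" and orc: "stochastic_oracle (Sm j) hs h \<delta>"
    and smooth: "smooth_fun L h" and X: "X \<in> borel_measurable (past J)"
begin

lemma oracle_grad_measurable: "(\<lambda>(s, z). grad (hs s) z) \<in> borel_measurable (Sm j \<Otimes>\<^sub>M borel)"
  using orc unfolding stochastic_oracle_def
  by (intro grad_jointly_measurable) (auto intro: borel_measurable_integrable)

lemma grad_borel_measurable: "grad h \<in> borel_measurable borel"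
  using smooth unfolding smooth_fun_def by (auto intro: borel_measurable_continuous_onI)

lemma error_jointly_measurable:
  "(\<lambda>p. grad (hs (snd p)) (fst p) - grad h (fst p)) \<in> borel_measurable (borel \<Otimes>\<^sub>M Sm j)"
proof -
  have "(\<lambda>p. (snd p, fst p)) \<in> measurable (borel \<Otimes>\<^sub>M Sm j) (Sm j \<Otimes>\<^sub>M (borel :: 'a measure))" by measurable
  from measurable_compose[OF this oracle_grad_measurable]
  have "(\<lambda>p. grad (hs (snd p)) (fst p)) \<in> borel_measurable (borel \<Otimes>\<^sub>M Sm j)" by simp
  moreover have "(\<lambda>p. grad h (fst p)) \<in> borel_measurable (borel \<Otimes>\<^sub>M Sm j)"
    by (rule measurable_compose[OF measurable_fst grad_borel_measurable])
  ultimately show ?thesis by measurable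
qed

lemma oracle_error_measurable:
  assumes "J' \<subseteq> I" "J \<subseteq> J'" "j \<in> J'"
  shows "err j hs h X \<in> borel_measurable (past J')"
proof -
  have "(\<lambda>\<omega>. (X \<omega>, \<xi> j \<omega>)) \<in> measurable (past J') (borel \<Otimes>\<^sub>M Sm j)"
    using past_mono[OF assms(2,1) X] sample_past[OF assms(3,1)] by measurable
  from measurable_compose[OF this error_jointly_measurable] show ?thesis by (simp add: err_def[abs_def])
qed

lemma oracle_error_variance:
  "square_integrable M (err j hs h X)" "(\<integral>\<omega>. (norm (err j hs h X \<omega>))\<^sup>2 \<partial>M) \<le> \<delta>\<^sup>2"
proof -
  let ?e = "\<lambda>p. grad (hs (snd p)) (fst p) - grad h (fst p)"
  let ?N = "err j hs h X"
  note em [measurable] = error_jointly_measurable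
  have XM [measurable]: "X \<in> borel_measurable M" by (rule past_measurable[OF J X])
  have xi [measurable]: "\<xi> j \<in> measurable M (Sm j)" by (rule sample_measurable[OF j(1)])
  interpret S: prob_space "Sm j" using orc by (simp add: stochastic_oracle_def)
  interpret D: prob_space "distr M borel X" by (rule prob_space_distr[OF XM])
  have "(\<lambda>\<omega>. ?e (X \<omega>, \<xi> j \<omega>)) \<in> borel_measurable M" by measurable
  then have Nm: "?N \<in> borel_measurable M" by (simp add: err_def[abs_def])
  have "(\<integral>\<^sup>+\<omega>. ennreal ((norm (?N \<omega>))\<^sup>2) \<partial>M)
      = (\<integral>\<^sup>+p. ennreal ((norm (?e p))\<^sup>2) \<partial>distr M (borel \<Otimes>\<^sub>M Sm j) (\<lambda>\<omega>. (X \<omega>, \<xi> j \<omega>)))"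
    by (subst nn_integral_distr) (auto simp: err_def)
  also have "\<dots> = (\<integral>\<^sup>+p. ennreal ((norm (?e p))\<^sup>2) \<partial>(distr M borel X \<Otimes>\<^sub>M Sm j))"
    by (simp add: joint_law[OF J j X])
  also have "\<dots> = (\<integral>\<^sup>+x. \<integral>\<^sup>+s. ennreal ((norm (?e (x, s)))\<^sup>2) \<partial>Sm j \<partial>distr M borel X)"
    by (rule S.nn_integral_fst[symmetric]) measurable
  also have "\<dots> \<le> (\<integral>\<^sup>+x. ennreal (\<delta>\<^sup>2) \<partial>distr M borel X)"
  proof (rule nn_integral_mono)
    fix x
    have "(\<integral>\<^sup>+s. ennreal ((norm (?e (x, s)))\<^sup>2) \<partial>Sm j)
        = ennreal (\<integral>s. (norm (?e (x, s)))\<^sup>2 \<partial>Sm j)"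
      using orc by (intro nn_integral_eq_integral) (auto simp: stochastic_oracle_def)
    also have "\<dots> \<le> ennreal (\<delta>\<^sup>2)" using orc by (intro ennreal_leI) (auto simp: stochastic_oracle_def)
    finally show "(\<integral>\<^sup>+s. ennreal ((norm (?e (x, s)))\<^sup>2) \<partial>Sm j) \<le> ennreal (\<delta>\<^sup>2)" .
  qed
  also have "\<dots> = ennreal (\<delta>\<^sup>2)" using D.emeasure_space_1 by simp
  finally have le: "(\<integral>\<^sup>+\<omega>. ennreal ((norm (?N \<omega>))\<^sup>2) \<partial>M) \<le> ennreal (\<delta>\<^sup>2)" .
  have int: "integrable M (\<lambda>\<omega>. (norm (?N \<omega>))\<^sup>2)"
  proof (rule integrableI_bounded)
    show "(\<lambda>\<omega>. (norm (?N \<omega>))\<^sup>2) \<in> borel_measurable M" using Nm by measurable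
    show "(\<integral>\<^sup>+\<omega>. ennreal (norm ((norm (?N \<omega>))\<^sup>2)) \<partial>M) < \<infinity>"
      using le by (simp add: le_less_trans[OF _ ennreal_less_top])
  qed
  show "square_integrable M ?N" using Nm int by (simp add: square_integrable_def)
  have "ennreal (\<integral>\<omega>. (norm (?N \<omega>))\<^sup>2 \<partial>M) \<le> ennreal (\<delta>\<^sup>2)"
    using le nn_integral_eq_integral[OF int] by simp
  then show "(\<integral>\<omega>. (norm (?N \<omega>))\<^sup>2 \<partial>M) \<le> \<delta>\<^sup>2" by (simp add: ennreal_le_iff)
qed

text \<open>
  Averaging over the fresh sample first turns the error into \<open>0\<close>, since the oracle is unbiased at each
  fixed point.  Here \<open>J\<close> may be larger than the history of \<open>X\<close>, which is how errors of different
  agents in the same iteration are seen to be uncorrelated.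
\<close>

lemma oracle_error_orthogonal:
  assumes Y: "Y \<in> borel_measurable (past J)" "square_integrable M Y"
  shows "(\<integral>\<omega>. inner (Y \<omega>) (err j hs h X \<omega>) \<partial>M) = 0"
proof -
  let ?e = "\<lambda>p. inner (snd (fst p)) (grad (hs (snd p)) (fst (fst p)) - grad h (fst (fst p)))"
  let ?N = "err j hs h X"
  have XY: "(\<lambda>\<omega>. (X \<omega>, Y \<omega>)) \<in> measurable (past J) (borel \<Otimes>\<^sub>M borel)" using X Y by measurable
  have XYM [measurable]: "(\<lambda>\<omega>. (X \<omega>, Y \<omega>)) \<in> measurable M (borel \<Otimes>\<^sub>M borel)" by (rule past_measurable[OF J XY])
  have xi [measurable]: "\<xi> j \<in> measurable M (Sm j)" by (rule sample_measurable[OF j(1)])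
  interpret S: prob_space "Sm j" using orc by (simp add: stochastic_oracle_def)
  interpret D: prob_space "distr M (borel \<Otimes>\<^sub>M borel) (\<lambda>\<omega>. (X \<omega>, Y \<omega>))" by (rule prob_space_distr[OF XYM])
  interpret DS: pair_sigma_finite "distr M (borel \<Otimes>\<^sub>M borel) (\<lambda>\<omega>. (X \<omega>, Y \<omega>))" "Sm j" ..
  have "(\<lambda>p. (fst (fst p), snd p)) \<in> measurable ((borel \<Otimes>\<^sub>M borel) \<Otimes>\<^sub>M Sm j) ((borel :: 'a measure) \<Otimes>\<^sub>M Sm j)"
    by measurable
  from measurable_compose[OF this error_jointly_measurable]
  have [measurable]: "(\<lambda>p. grad (hs (snd p)) (fst (fst p)) - grad h (fst (fst p)))
      \<in> borel_measurable ((borel \<Otimes>\<^sub>M borel) \<Otimes>\<^sub>M Sm j)" by simp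
  have em [measurable]: "?e \<in> borel_measurable ((borel \<Otimes>\<^sub>M borel) \<Otimes>\<^sub>M Sm j)" by measurable
  have law': "distr M ((borel \<Otimes>\<^sub>M borel) \<Otimes>\<^sub>M Sm j) (\<lambda>\<omega>. ((X \<omega>, Y \<omega>), \<xi> j \<omega>))
      = distr M (borel \<Otimes>\<^sub>M borel) (\<lambda>\<omega>. (X \<omega>, Y \<omega>)) \<Otimes>\<^sub>M Sm j"
    by (rule joint_law[OF J j XY])
  have "integrable M (\<lambda>\<omega>. inner (Y \<omega>) (?N \<omega>))"
    by (rule square_integrable_inner[OF Y(2) oracle_error_variance(1)])
  then have "integrable (distr M ((borel \<Otimes>\<^sub>M borel) \<Otimes>\<^sub>M Sm j) (\<lambda>\<omega>. ((X \<omega>, Y \<omega>), \<xi> j \<omega>))) ?e"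
    by (subst integrable_distr_eq) (auto simp: err_def)
  then have int: "integrable (distr M (borel \<Otimes>\<^sub>M borel) (\<lambda>\<omega>. (X \<omega>, Y \<omega>)) \<Otimes>\<^sub>M Sm j) ?e"
    by (simp only: law')
  have "(\<integral>\<omega>. inner (Y \<omega>) (?N \<omega>) \<partial>M)
      = (\<integral>p. ?e p \<partial>distr M ((borel \<Otimes>\<^sub>M borel) \<Otimes>\<^sub>M Sm j) (\<lambda>\<omega>. ((X \<omega>, Y \<omega>), \<xi> j \<omega>)))"
    by (subst integral_distr) (auto simp: err_def)
  also have "\<dots> = (\<integral>q. (\<integral>s. ?e (q, s) \<partial>Sm j) \<partial>distr M (borel \<Otimes>\<^sub>M borel) (\<lambda>\<omega>. (X \<omega>, Y \<omega>)))"
    unfolding law' by (rule DS.integral_fst'[OF int, symmetric])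
  also have "\<dots> = (\<integral>q. 0 \<partial>distr M (borel \<Otimes>\<^sub>M borel) (\<lambda>\<omega>. (X \<omega>, Y \<omega>)))"
  proof (rule Bochner_Integration.integral_cong[OF refl])
    fix q :: "'a \<times> 'a"
    have g: "integrable (Sm j) (\<lambda>s. grad (hs s) (fst q))" "(\<integral>s. grad (hs s) (fst q) \<partial>Sm j) = grad h (fst q)"
      using orc by (auto simp: stochastic_oracle_def)
    have "(\<integral>s. inner (snd q) (grad (hs s) (fst q) - grad h (fst q)) \<partial>Sm j)
        = inner (snd q) (\<integral>s. grad (hs s) (fst q) - grad h (fst q) \<partial>Sm j)"
      using g by (intro integral_inner_right) auto
    also have "\<dots> = 0" using g S.prob_space by simp
    finally show "(\<integral>s. ?e (q, s) \<partial>Sm j) = 0" by simp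
  qed
  finally show ?thesis by simp
qed

end

end

section \<open>The search directions\<close>

text \<open>
  The part of the search direction that depends on gradients, as a function of the gradient of \<open>f\<close> at
  \<open>(x, y)\<close> and those of \<open>g\<close> at \<open>(x, y)\<close> and \<open>(x, \<theta>)\<close>.  It is linear, so it also carries sampling errors
  and gradient dissimilarities to errors and dissimilarities of directions.
\<close>

definition comb ::
  "real \<Rightarrow> real \<Rightarrow> 'x::euclidean_space \<times> 'y::euclidean_space \<Rightarrow> 'x \<times> 'y \<Rightarrow> 'x \<times> 'y \<Rightarrow> ('x \<times> 'y) \<times> 'y" where
  "comb c m a b d = (c *\<^sub>R (m *\<^sub>R a + b - (fst d, 0)), snd d)"

lemma norm_comb_le:
  assumes "0 \<le> c" "0 \<le> m"
  shows "norm (comb c m a b d) \<le> c * m * norm a + c * norm b + (1 + c) * norm d"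
proof -
  let ?A = "((c * m) *\<^sub>R a, 0::'b)" and ?B = "(c *\<^sub>R b, 0::'b)" and ?C = "(- c *\<^sub>R (fst d, 0::'b), snd d)"
  have "comb c m a b d = ?A + ?B + ?C"
    by (cases a, cases b) (simp add: comb_def algebra_simps)
  then have "norm (comb c m a b d)
      \<le> norm ((c * m) *\<^sub>R a, 0::'b) + norm (c *\<^sub>R b, 0::'b) + norm (- c *\<^sub>R (fst d, 0::'b), snd d)"
    using norm_triangle_ineq[of "?A + ?B" ?C] norm_triangle_ineq[of ?A ?B] by simp
  also have "\<dots> \<le> c * m * norm a + c * norm b + (c * norm (fst d) + norm (snd d))"
    using assms norm_Pair_le[of "- c *\<^sub>R (fst d, 0::'b)" "snd d"] by (simp add: norm_Pair abs_mult)
  also have "\<dots> \<le> c * m * norm a + c * norm b + (1 + c) * norm d"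
    using mult_left_mono[OF norm_fst_le_norm[of d] assms(1)] norm_snd_le_norm[of d] 
    by (simp add: algebra_simps)
  finally show ?thesis .
qed

lemma norm_comb_squared_le:
  assumes "0 \<le> c" "c \<le> 3 / 32" "0 \<le> m"
  shows "(norm (comb c m a b d))\<^sup>2 \<le> m\<^sup>2 * (norm a)\<^sup>2 + 1 / 5 * (norm b)\<^sup>2 + 19 / 5 * (norm d)\<^sup>2"
proof -
  have s3: "(p + q + t)\<^sup>2 \<le> 3 * (p\<^sup>2 + q\<^sup>2 + t\<^sup>2)" for p q t :: real
    using sum_squares_bound[of p q] sum_squares_bound[of p t] sum_squares_bound[of q t]
    by (simp add: power2_eq_square algebra_simps)
  have c2: "c\<^sup>2 \<le> (3 / 32)\<^sup>2" "(1 + c)\<^sup>2 \<le> (35 / 32)\<^sup>2" using assms by (auto intro!: power_mono)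
  have "(norm (comb c m a b d))\<^sup>2 \<le> (c * m * norm a + c * norm b + (1 + c) * norm d)\<^sup>2"
    by (intro power_mono norm_comb_le assms) auto
  also have "\<dots> \<le> 3 * ((c * m * norm a)\<^sup>2 + (c * norm b)\<^sup>2 + ((1 + c) * norm d)\<^sup>2)" by (rule s3)
  also have "\<dots> = (3 * c\<^sup>2) * (m\<^sup>2 * (norm a)\<^sup>2) + (3 * c\<^sup>2) * (norm b)\<^sup>2 + (3 * (1 + c)\<^sup>2) * (norm d)\<^sup>2"
    by (simp only: power_mult_distrib) (simp add: distrib_left mult_ac)
  also have "\<dots> \<le> 1 * (m\<^sup>2 * (norm a)\<^sup>2) + 1 / 5 * (norm b)\<^sup>2 + 19 / 5 * (norm d)\<^sup>2"
    by (intro add_mono mult_right_mono) (use c2 in \<open>auto simp: power2_eq_square\<close>)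
  finally show ?thesis by simp
qed

lemma mean_comb:
  "mean n (\<lambda>i. comb c m (a i) (b i) (d i)) = comb c m (mean n a) (mean n b) (mean n d)"
proof -
  have "linear (\<lambda>t. comb c m (fst t) (fst (snd t)) (snd (snd t)))"
    by (rule linearI) (auto simp: comb_def algebra_simps)
  from linear_mean[OF this, of n "\<lambda>i. (a i, b i, d i)"]
  show ?thesis by (simp add: mean_def fst_sum snd_sum)
qed

text \<open>
  The three search directions of one agent as a single vector; the factor \<open>c\<close> turns the common step
  size into the slower one of \<open>x\<close> and \<open>y\<close>.
\<close>

definition step_dir ::
  "real \<Rightarrow> real \<Rightarrow> real \<Rightarrow> ('x::euclidean_space \<times> 'y::euclidean_space \<Rightarrow> real) \<Rightarrow> ('x \<times> 'y \<Rightarrow> real) \<Rightarrow>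
   ('x \<times> 'y) \<times> 'y \<Rightarrow> ('x \<times> 'y) \<times> 'y" where
  "step_dir \<gamma> c m f g = (\<lambda>((x, y), \<theta>).
     ((c *\<^sub>R dir_x m f g x y \<theta>, c *\<^sub>R dir_y \<gamma> m f g x y \<theta>), dir_theta \<gamma> g x y \<theta>))"

lemma step_dir_eq_comb:
  "step_dir \<gamma> c m f g v
    = comb c m (grad f (fst v)) (grad g (fst v)) (grad g (fst (fst v), snd v))
      + ((0, (c / \<gamma>) *\<^sub>R (snd v - snd (fst v))), (1 / \<gamma>) *\<^sub>R (snd v - snd (fst v)))"
  by (cases v, cases "fst v", cases "grad f (fst v)", cases "grad g (fst v)")
     (simp add: step_dir_def comb_def dir_x_def dir_y_def dir_theta_def algebra_simps)

lemma comb_diff: "comb c m a b d - comb c m a' b' d' = comb c m (a - a') (b - b') (d - d')"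
  by (simp add: comb_def algebra_simps)

lemma step_dir_diff_oracle:
  "step_dir \<gamma> c m f g v - step_dir \<gamma> c m f' g' v
    = comb c m (grad f (fst v) - grad f' (fst v)) (grad g (fst v) - grad g' (fst v))
        (grad g (fst (fst v), snd v) - grad g' (fst (fst v), snd v))"
  by (simp add: step_dir_eq_comb comb_diff[symmetric])

lemma gossip_Pair: "gossip n W i (\<lambda>j. (a j, b j)) = (gossip n W i a, gossip n W i b)"
  unfolding gossip_def by (simp add: prod_eq_iff fst_sum snd_sum)

lemma norm_prod_squared: "(norm p)\<^sup>2 = (norm (fst p))\<^sup>2 + (norm (snd p))\<^sup>2"
  by (cases p) (simp add: norm_Pair_squared)

lemma norm_add_norm_le: "norm a + norm b \<le> 3 / 2 * norm (a, b)"
proof (rule power2_le_imp_le)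
  have "(norm a + norm b)\<^sup>2 \<le> 2 * (norm (a, b))\<^sup>2"
    using sum_squares_bound[of "norm a" "norm b"] by (simp add: norm_Pair_squared power2_sum)
  also have "\<dots> \<le> (3 / 2 * norm (a, b))\<^sup>2" by (simp add: power2_eq_square)
  finally show "(norm a + norm b)\<^sup>2 \<le> (3 / 2 * norm (a, b))\<^sup>2" .
qed simp

context bilevel begin

text \<open>
  For the averaged functions the direction of \<open>z\<close> is the penalized gradient minus the gradient of the
  optimality gap, and the direction of \<open>\<theta>\<close> is the gradient of that gap.
\<close>

lemma step_dir_averaged:
  "step_dir \<gamma> c m F G v
    = (c *\<^sub>R (gradPsi m (fst v) - gap_grad (fst v) (snd v)), gradP (fst v) (snd v))"
proof -
  obtain x y \<theta> where v: "v = ((x, y), \<theta>)" by (metis prod.exhaust)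
  show ?thesis unfolding v
    by (simp add: step_dir_def dir_x_def dir_y_def dir_theta_def gradPsi_def gradV_def gap_grad_def
       gradP_def r_def prod_eq_iff algebra_simps)
qed

text \<open>
  The summand \<open>9 / 4 * r\<close> covers the contributions of \<open>g\<close> and of the proximal term, since \<open>L2 < r / 2\<close>
  and \<open>c \<le> 3 / 32\<close>.
\<close>

definition lip :: "real \<Rightarrow> real \<Rightarrow> real" where
  "lip c m = c * m * L1 + 9 / 4 * r"

lemma lip_nonneg: "0 \<le> c \<Longrightarrow> 0 \<le> m \<Longrightarrow> 0 \<le> lip c m"
  using L1_nonneg r_pos by (simp add: lip_def)

lemma step_dir_lipschitz:
  fixes f g :: "'x \<times> 'y \<Rightarrow> real"
  assumes f: "smooth_fun L1 f" and g: "smooth_fun L2 g" and c: "0 \<le> c" "c \<le> 3 / 32" and m: "0 \<le> m"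
  shows "norm (step_dir \<gamma> c m f g v - step_dir \<gamma> c m f g v') \<le> lip c m * norm (v - v')"
proof -
  let ?u = "v - v'"
  define w where "w = (snd v - snd (fst v)) - (snd v' - snd (fst v'))"
  let ?a = "grad f (fst v) - grad f (fst v')" and ?b = "grad g (fst v) - grad g (fst v')"
    and ?d = "grad g (fst (fst v), snd v) - grad g (fst (fst v'), snd v')"
  have eq: "step_dir \<gamma> c m f g v - step_dir \<gamma> c m f g v'
      = comb c m ?a ?b ?d + ((0, (c * r) *\<^sub>R w), r *\<^sub>R w)"
    unfolding step_dir_eq_comb comb_diff[symmetric] w_def r_def by (simp add: algebra_simps)
  have fs: "norm (fst v - fst v') \<le> norm ?u" using norm_fst_le_norm[of ?u] by simp
  have a: "norm ?a \<le> L1 * norm ?u"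
    using smooth_fun_lipschitz[OF f] mult_left_mono[OF fs L1_nonneg] order_trans by blast
  have b: "norm ?b \<le> L2 * norm ?u"
    using smooth_fun_lipschitz[OF g] mult_left_mono[OF fs] L2_pos by (meson less_imp_le order_trans)
  have "(norm ((fst (fst v), snd v) - (fst (fst v'), snd v')))\<^sup>2 \<le> (norm ?u)\<^sup>2"
    using norm_prod_squared[of ?u] norm_prod_squared[of "fst ?u"] by (simp add: norm_Pair_squared)
  then have "norm ((fst (fst v), snd v) - (fst (fst v'), snd v')) \<le> norm ?u"
    by (rule power2_le_imp_le) simp
  then have d: "norm ?d \<le> L2 * norm ?u"
    using smooth_fun_lipschitz[OF g] mult_left_mono[of _ "norm ?u" L2] L2_pos by (meson less_imp_le order_trans)
  have "norm w \<le> norm (snd ?u) + norm (snd (fst ?u))"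
    unfolding w_def using norm_triangle_ineq4[of "snd ?u" "snd (fst ?u)"] by (simp add: algebra_simps)
  also have "\<dots> \<le> norm (snd ?u) + norm (fst ?u)" using norm_snd_le_norm[of "fst ?u"] by simp
  also have "\<dots> \<le> 3 / 2 * norm ?u"
    using norm_add_norm_le[of "fst ?u" "snd ?u"] unfolding prod.collapse by linarith
  finally have w: "norm w \<le> 3 / 2 * norm ?u" .
  have "norm ((0::'x, (c * r) *\<^sub>R w), r *\<^sub>R w) \<le> (1 + c) * r * norm w"
  proof -
    have "norm (0::'x, (c * r) *\<^sub>R w) \<le> c * r * norm w" and "norm (r *\<^sub>R w) = r * norm w"
      using norm_Pair_le[of "0::'x" "(c * r) *\<^sub>R w"] c r_pos by simp_all
    then show ?thesis
      using norm_Pair_le[of "(0::'x, (c * r) *\<^sub>R w)" "r *\<^sub>R w"] by (simp only: distrib_right)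
  qed
  also have "\<dots> \<le> (1 + c) * r * (3 / 2 * norm ?u)"
    using w c r_pos by (intro mult_left_mono) auto
  finally have R: "norm ((0::'x, (c * r) *\<^sub>R w), r *\<^sub>R w) \<le> (1 + c) * r * (3 / 2 * norm ?u)" .
  have "norm (step_dir \<gamma> c m f g v - step_dir \<gamma> c m f g v')
      \<le> norm (comb c m ?a ?b ?d) + norm ((0::'x, (c * r) *\<^sub>R w), r *\<^sub>R w)"
    unfolding eq by (rule norm_triangle_ineq)
  also have "\<dots> \<le> c * m * (L1 * norm ?u) + c * (L2 * norm ?u) + (1 + c) * (L2 * norm ?u)
      + (1 + c) * r * (3 / 2 * norm ?u)"
  proof (rule add_mono[OF order_trans[OF norm_comb_le[OF c(1) m]] R])
    show "c * m * norm ?a + c * norm ?b + (1 + c) * norm ?d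
        \<le> c * m * (L1 * norm ?u) + c * (L2 * norm ?u) + (1 + c) * (L2 * norm ?u)"
      using a b d c m by (intro add_mono mult_left_mono) auto
  qed
  also have "\<dots> = (c * m * L1 + ((1 + 2 * c) * L2 + (1 + c) * (3 / 2) * r)) * norm ?u"
    by (simp add: algebra_simps)
  also have "\<dots> \<le> lip c m * norm ?u"
  proof (rule mult_right_mono)
    have "(1 + 2 * c) * L2 \<le> (19 / 16) * (r / 2)"
      using c L2_less L2_pos by (intro mult_mono) auto
    moreover have "(1 + c) * (3 / 2) * r \<le> (35 / 32) * (3 / 2) * r"
      using c r_pos by (intro mult_right_mono) auto
    ultimately show "c * m * L1 + ((1 + 2 * c) * L2 + (1 + c) * (3 / 2) * r) \<le> lip c m"
      unfolding lip_def using r_pos by linarith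
  qed simp
  finally show ?thesis .
qed

text \<open>
  The lower bound \<open>2 / 3\<close> on \<open>L\<theta>\<close> turns the first condition into an absolute bound on the ratio \<open>c\<close> of
  the two step sizes.  The bound on \<open>lam\<close> comes from the condition on \<open>\<tau>\<^sub>4\<close>, where \<open>L1\<close> does not
  occur; the weight \<open>a1\<close> is eliminated by the first condition, so that only \<open>r\<close> and \<open>\<rho>\<close> remain.
\<close>

lemma step_size_consequences:
  assumes ss: "step_size_conditions L1 L2 \<gamma> \<mu>0 c L\<theta> \<rho> lam"
    and L\<theta>: "L\<theta>-lipschitz_on UNIV \<theta>s" and c: "0 < c" and \<rho>: "\<rho> < 1"
  shows "c \<le> 3 / 32" and "c * S\<^sup>2 \<le> \<eta>\<^sup>2 / 4" and "lam * r \<le> 49 / 192 * (1 - \<rho>)"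
proof -
  define a1 where "a1 = 1 / (2 * L\<theta>) * S"
  have g2: "1 / \<gamma>\<^sup>2 = r\<^sup>2" by (simp add: r_def power_divide)
  have L: "2 / 3 \<le> L\<theta>" by (rule lipschitz_theta_star_ge[OF L\<theta>])
  have 1: "c \<le> \<eta> / (32 * a1 * L\<theta>\<^sup>2)"
    and 2: "lam \<le> (2 * ((3 * L2\<^sup>2 * c + 4 * r\<^sup>2 * c + 12 * a1 / \<eta> * S\<^sup>2) / (c * (1 - \<rho>)))) * c * (1 - \<rho>)\<^sup>2 / (192 * a1 * S\<^sup>2)"
    using ss unfolding step_size_conditions_def Let_def g2
    by (simp_all add: a1_def \<eta>_def r_def S_def power_divide)
  have a1: "0 < a1" using L S_pos by (simp add: a1_def)
  have "32 * a1 * L\<theta>\<^sup>2 = 16 * L\<theta> * S" using L by (simp add: a1_def power2_eq_square)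
  then have "c \<le> \<eta> / (16 * L\<theta> * S)" using 1 by (simp only:)
  then have "c * (16 * L\<theta> * S) \<le> \<eta>" using L S_pos by (simp add: pos_le_divide_eq)
  then have cL: "c * L\<theta> * S \<le> \<eta> / 16" by simp
  moreover have "c * (2 / 3) * S \<le> c * L\<theta> * S" using c L S_pos by (intro mult_right_mono mult_left_mono) auto
  ultimately have cS: "c * S \<le> 3 / 32 * \<eta>" by simp
  also have "\<dots> \<le> 3 / 32 * S" using eta_bounds r_le_S by simp
  finally show "c \<le> 3 / 32" using S_pos by simp
  have S\<eta>: "S \<le> 5 / 2 * \<eta>"
  proof (rule power2_le_imp_le)
    have "(5 / 2 * \<eta>)\<^sup>2 = 25 / 4 * \<eta>\<^sup>2" by (simp add: power2_eq_square)
    then show "S\<^sup>2 \<le> (5 / 2 * \<eta>)\<^sup>2" using S_squared_le_eta zero_le_power2[of \<eta>] by linarith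
  qed (use eta_bounds in simp)
  have "c * S\<^sup>2 = (c * S) * S" by (simp add: power2_eq_square)
  also have "\<dots> \<le> (3 / 32 * \<eta>) * (5 / 2 * \<eta>)" by (rule mult_mono) (use cS S\<eta> eta_bounds S_pos in auto)
  also have "\<dots> \<le> \<eta>\<^sup>2 / 4" by (simp add: power2_eq_square)
  finally show "c * S\<^sup>2 \<le> \<eta>\<^sup>2 / 4" .
  have "lam \<le> (1 - \<rho>) / 96 * ((3 * L2\<^sup>2 + 4 * r\<^sup>2) * c / (a1 * S\<^sup>2) + 12 / \<eta>)"
  proof -
    have "(2 * ((3 * L2\<^sup>2 * c + 4 * r\<^sup>2 * c + 12 * a1 / \<eta> * S\<^sup>2) / (c * (1 - \<rho>)))) * c * (1 - \<rho>)\<^sup>2 / (192 * a1 * S\<^sup>2)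
        = (1 - \<rho>) / 96 * ((3 * L2\<^sup>2 + 4 * r\<^sup>2) * c / (a1 * S\<^sup>2) + 12 / \<eta>)"
      using c \<rho> a1 S_pos eta_bounds by (simp add: divide_simps power2_eq_square) (simp add: algebra_simps)
    then show ?thesis using 2 by (simp only:)
  qed
  also have "\<dots> \<le> (1 - \<rho>) / 96 * (1 / (2 * r) + 24 / r)"
  proof (intro mult_left_mono add_mono)
    have "c * L\<theta> * S * 8 \<le> r / 2"
      using cL eta_bounds by linarith
    then have "8 * c * L\<theta> * S * r \<le> r\<^sup>2 / 2" using r_pos mult_right_mono[of "c * L\<theta> * S * 8" "r / 2" r]
      by (simp add: power2_eq_square mult_ac)
    also have "\<dots> \<le> S\<^sup>2 / 2" using S_squared by simp
    finally have "8 * c * L\<theta> * S * r * 2 \<le> S * S" by (simp add: power2_eq_square)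
    then have "16 * c * L\<theta> * r \<le> S" using S_pos by simp
    then have "4 * (c / a1) \<le> 1 / (2 * r)"
      using L S_pos r_pos by (simp add: a1_def field_simps)
    moreover have "(3 * L2\<^sup>2 + 4 * r\<^sup>2) * c / (a1 * S\<^sup>2) \<le> 4 * (c / a1)"
    proof -
      have "(3 * L2\<^sup>2 + 4 * r\<^sup>2) * c \<le> 4 * S\<^sup>2 * c"
        using c by (intro mult_right_mono) (auto simp: S_squared)
      then show ?thesis using a1 S_pos by (simp add: divide_simps mult_ac)
    qed
    ultimately show "(3 * L2\<^sup>2 + 4 * r\<^sup>2) * c / (a1 * S\<^sup>2) \<le> 1 / (2 * r)" by linarith
    show "12 / \<eta> \<le> 24 / r" using eta_bounds r_pos by (simp add: field_simps)
  qed (use \<rho> in simp)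
  finally have "lam \<le> (1 - \<rho>) / 96 * (49 / 2 / r)" using r_pos by (simp add: field_simps)
  then have "lam * r \<le> (1 - \<rho>) / 96 * (49 / 2 / r) * r" using r_pos by (intro mult_right_mono) auto
  then show "lam * r \<le> 49 / 192 * (1 - \<rho>)" using r_pos by simp
qed

end

section \<open>Decrease of the energy along the averaged direction\<close>

text \<open>
  The scalar core of the energy decrease: \<open>A\<close>, \<open>R\<close>, \<open>Q\<close> stand for the norms of the gradient of
  the penalized objective, of the tracking part of the search direction and of the gradient of the
  proximal objective, and \<open>e\<close>, \<open>d\<close> for the norms of the two parts of the perturbation; \<open>q\<close> is the
  step size relative to \<open>\<gamma>\<close> and \<open>x\<close> the step size relative to the smoothness of \<open>F\<close>.
\<close>

lemma energy_decrease_scalar: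
  fixes A R Q e d c q x :: real
  assumes c: "0 < c" "c \<le> 3 / 32" and q: "0 \<le> q" "q \<le> 49 / 192" and x: "0 \<le> x"
    and R: "c * R\<^sup>2 \<le> Q\<^sup>2 / 4"
  shows "- (c * (A\<^sup>2 - R\<^sup>2) - A * e - R * e) - (Q\<^sup>2 - Q * d)
       + (17 / 2 * q + x / (2 * c)) * (3 * (c\<^sup>2 * A\<^sup>2 + c\<^sup>2 * R\<^sup>2 + e\<^sup>2)) + 7 / 8 * q * (5 / 4 * Q\<^sup>2 + 5 * d\<^sup>2)
     \<le> - (c / 5) * A\<^sup>2 - Q\<^sup>2 / 8 + 3 / 2 * x * (c * A\<^sup>2 + c * R\<^sup>2) + (3 / c + 8 + 3 / 2 * x / c) * (e\<^sup>2 + d\<^sup>2)"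
proof -
  have qc: "q * c \<le> 49 / 192 * (3 / 32)" using c q by (intro mult_mono) auto
  have z: "17 / 2 * q * (3 * (c\<^sup>2 * A\<^sup>2)) \<le> 4 / 5 * (4 / 5) * (c * A\<^sup>2)"
    and z': "17 / 2 * q * (3 * (c\<^sup>2 * R\<^sup>2)) \<le> 4 / 5 * (4 / 5) * (c * R\<^sup>2)"
  proof -
    have *: "17 / 2 * q * (3 * (c\<^sup>2 * t)) \<le> 4 / 5 * (4 / 5) * (c * t)" if "0 \<le> t" for t
    proof -
      have "17 / 2 * q * (3 * (c\<^sup>2 * t)) = 51 / 2 * (q * c) * (c * t)" by (simp add: power2_eq_square)
      also have "\<dots> \<le> 51 / 2 * (49 / 192 * (3 / 32)) * (c * t)"
        using qc c that by (intro mult_right_mono mult_left_mono) auto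
      also have "\<dots> \<le> 4 / 5 * (4 / 5) * (c * t)" using c that by (intro mult_right_mono) auto
      finally show ?thesis .
    qed
    show "17 / 2 * q * (3 * (c\<^sup>2 * A\<^sup>2)) \<le> 4 / 5 * (4 / 5) * (c * A\<^sup>2)"
      and "17 / 2 * q * (3 * (c\<^sup>2 * R\<^sup>2)) \<le> 4 / 5 * (4 / 5) * (c * R\<^sup>2)" by (rule *; simp)+
  qed
  have qt: "q * t\<^sup>2 \<le> 49 / 192 * t\<^sup>2" for t using q by (intro mult_right_mono) auto
  have sq: "17 / 2 * q * (3 * e\<^sup>2) = 51 / 2 * (q * e\<^sup>2)" "7 / 8 * q * (5 / 4 * Q\<^sup>2) = 35 / 32 * (q * Q\<^sup>2)"
    "7 / 8 * q * (5 * d\<^sup>2) = 35 / 8 * (q * d\<^sup>2)" by simp_all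
  have ze: "17 / 2 * q * (3 * e\<^sup>2) \<le> 7 * e\<^sup>2"
    unfolding sq using qt[of e] zero_le_power2[of e] by linarith
  have zQ: "7 / 8 * q * (5 / 4 * Q\<^sup>2) \<le> 7 / 25 * Q\<^sup>2"
    unfolding sq using qt[of Q] zero_le_power2[of Q] by linarith
  have zd: "7 / 8 * q * (5 * d\<^sup>2) \<le> 2 * d\<^sup>2"
    unfolding sq using qt[of d] zero_le_power2[of d] by linarith
  define eA where "eA = c * A\<^sup>2"
  define eR where "eR = c * R\<^sup>2"
  define ec where "ec = e\<^sup>2 / c"
  define dc where "dc = d\<^sup>2 / c"
  define xe where "xe = 3 / 2 * x / c * e\<^sup>2"
  define xd where "xd = 3 / 2 * x / c * d\<^sup>2"
  define xA where "xA = 3 / 2 * x * (eA + eR)"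
  have Ae: "A * e \<le> eA / 8 + 2 * ec"
    using two_mult_le_weighted[of "c / 4" A e] c by (simp add: eA_def ec_def)
  have Re: "R * e \<le> eR / 4 + ec"
    using two_mult_le_weighted[of "c / 2" R e] c by (simp add: eR_def ec_def)
  have Qd: "Q * d \<le> 1 / 50 * Q\<^sup>2 + 25 / 2 * d\<^sup>2"
    using two_mult_le_weighted[of "1 / 25" Q d] by simp
  have d': "27 / 2 * d\<^sup>2 \<le> dc + 6 * d\<^sup>2"
  proof -
    have "32 / 3 \<le> 1 / c" using c by (simp add: field_simps)
    then have "32 / 3 * d\<^sup>2 \<le> 1 / c * d\<^sup>2" by (rule mult_right_mono) simp
    then have "32 / 3 * d\<^sup>2 \<le> dc" by (simp add: dc_def)
    then show ?thesis using zero_le_power2[of d] by linarith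
  qed
  have pos: "0 \<le> xd" "0 \<le> dc" "0 \<le> eA" "0 \<le> ec" using x c by (simp_all add: xd_def dc_def eA_def ec_def)
  have split1: "(17 / 2 * q + x / (2 * c)) * (3 * (c\<^sup>2 * A\<^sup>2 + c\<^sup>2 * R\<^sup>2 + e\<^sup>2))
     = 17 / 2 * q * (3 * (c\<^sup>2 * A\<^sup>2)) + 17 / 2 * q * (3 * (c\<^sup>2 * R\<^sup>2)) + 17 / 2 * q * (3 * e\<^sup>2) + xA + xe"
    using c by (simp add: xA_def xe_def eA_def eR_def field_simps power2_eq_square)
  have split2: "7 / 8 * q * (5 / 4 * Q\<^sup>2 + 5 * d\<^sup>2) = 7 / 8 * q * (5 / 4 * Q\<^sup>2) + 7 / 8 * q * (5 * d\<^sup>2)"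
    by (rule distrib_left)
  have split3: "(3 / c + 8 + 3 / 2 * x / c) * (e\<^sup>2 + d\<^sup>2) = 3 * ec + 8 * e\<^sup>2 + xe + (3 * dc + 8 * d\<^sup>2 + xd)"
    by (simp add: ec_def dc_def xe_def xd_def algebra_simps add_divide_distrib)
  have split4: "c * (A\<^sup>2 - R\<^sup>2) = eA - eR" "- (c / 5) * A\<^sup>2 = - eA / 5" "3 / 2 * x * (c * A\<^sup>2 + c * R\<^sup>2) = xA"
    by (simp_all add: eA_def eR_def xA_def algebra_simps)
  show ?thesis
    unfolding split1 split2 split3 split4
    using z[folded eA_def] z'[folded eR_def] ze zQ zd Ae Re Qd d' pos R[folded eR_def]
      zero_le_power2[of Q] zero_le_power2[of d] zero_le_power2[of e]
    by linarith
qed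

context bilevel begin

text \<open>
  When \<open>x\<close> is small the curvature of \<open>F\<close> is absorbed by the decrease.  Otherwise the second-order term
  it causes is bounded by a multiple of the energy itself, because the squared gradient of a
  nonnegative smooth function is.
\<close>

lemma energy_decrease:
  assumes c: "0 < c" "c \<le> 3 / 32" "c * S\<^sup>2 \<le> \<eta>\<^sup>2 / 4" and lam: "0 \<le> lam" "lam * r \<le> 49 / 192" and m: "0 \<le> m"
    and D: "D = step_dir \<gamma> c m F G v + \<epsilon>" and x: "x = lam * c * m * L1"
  shows "energy m v - lam * inner (gradE m v) D
       + lam\<^sup>2 * ((17 / 2 * r + m * L1 / 2) * (norm (fst D))\<^sup>2 + 7 / 8 * r * (norm (snd D))\<^sup>2)
     \<le> (1 + (if x \<le> 1 / 20 then 0 else lam * (3 / 2 * x * (34 * r + 2 * m * L1)))) * energy m v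
       - lam * (c / 10 * (norm (gradPsi m (fst v)))\<^sup>2)
       + lam * ((4 / c + 8 + 3 / 2 * x / c) * (norm \<epsilon>)\<^sup>2)"
proof -
  define a where "a = gradPsi m (fst v)"
  define re where "re = gap_grad (fst v) (snd v)"
  define q where "q = gradP (fst v) (snd v)"
  have D': "D = (c *\<^sub>R (a - re) + fst \<epsilon>, q + snd \<epsilon>)"
    unfolding D step_dir_averaged by (simp add: a_def re_def q_def plus_prod_def)
  have gE: "gradE m v = (a + re, q)"
    by (simp add: gradE_def a_def re_def q_def case_prod_beta)
  have x0: "0 \<le> x" using lam c m L1_nonneg by (simp add: x)
  have "\<eta>\<^sup>2 * (c * (norm re)\<^sup>2) \<le> c * (S\<^sup>2 * (norm q)\<^sup>2)"
    using mult_left_mono[OF gap_grad_squared_le, of c "fst v" "snd v"] c by (simp add: re_def q_def mult_ac)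
  also have "\<dots> = (c * S\<^sup>2) * (norm q)\<^sup>2" by simp
  also have "\<dots> \<le> (\<eta>\<^sup>2 / 4) * (norm q)\<^sup>2" using c by (intro mult_right_mono) auto
  finally have "\<eta>\<^sup>2 * (c * (norm re)\<^sup>2) \<le> \<eta>\<^sup>2 * ((norm q)\<^sup>2 / 4)" by simp
  then have R: "c * (norm re)\<^sup>2 \<le> (norm q)\<^sup>2 / 4" using eta_bounds by simp
  have i1: "c * ((norm a)\<^sup>2 - (norm re)\<^sup>2) - norm a * norm (fst \<epsilon>) - norm re * norm (fst \<epsilon>) + ((norm q)\<^sup>2 - norm q * norm (snd \<epsilon>))
      \<le> inner (gradE m v) D"
  proof -
    have "inner (gradE m v) D = c * ((norm a)\<^sup>2 - (norm re)\<^sup>2) + inner a (fst \<epsilon>) + inner re (fst \<epsilon>) + ((norm q)\<^sup>2 + inner q (snd \<epsilon>))"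
      unfolding gE D' by (simp add: power2_norm_eq_inner inner_add_left inner_add_right inner_diff_right inner_commute algebra_simps)
    then show ?thesis
      using Cauchy_Schwarz_ineq2[of a "fst \<epsilon>"] Cauchy_Schwarz_ineq2[of re "fst \<epsilon>"] Cauchy_Schwarz_ineq2[of q "snd \<epsilon>"]
      by linarith
  qed
  have i2: "(norm (fst D))\<^sup>2 \<le> 3 * (c\<^sup>2 * (norm a)\<^sup>2 + c\<^sup>2 * (norm re)\<^sup>2 + (norm (fst \<epsilon>))\<^sup>2)"
  proof -
    have "norm (fst D) \<le> c * norm a + c * norm re + norm (fst \<epsilon>)"
    proof -
      have "norm (c *\<^sub>R (a - re)) = c * norm (a - re)" using c by simp
      also have "\<dots> \<le> c * norm a + c * norm re"
        using mult_left_mono[OF norm_triangle_ineq4[of a re], of c] c by (simp add: distrib_left)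
      finally show ?thesis
        unfolding D' fst_conv using norm_triangle_ineq[of "c *\<^sub>R (a - re)" "fst \<epsilon>"] by linarith
    qed
    then have "(norm (fst D))\<^sup>2 \<le> (c * norm a + c * norm re + norm (fst \<epsilon>))\<^sup>2" by (rule power_mono) simp
    also have "(p + s + t)\<^sup>2 \<le> 3 * (p\<^sup>2 + s\<^sup>2 + t\<^sup>2)" for p s t :: real
      using sum_squares_bound[of p s] sum_squares_bound[of p t] sum_squares_bound[of s t]
      by (simp add: power2_eq_square algebra_simps)
    finally show ?thesis by (simp add: power_mult_distrib)
  qed
  have i3: "(norm (snd D))\<^sup>2 \<le> 5 / 4 * (norm q)\<^sup>2 + 5 * (norm (snd \<epsilon>))\<^sup>2"
    unfolding D' using norm_add_squared_le_weighted[of "1 / 4" q "snd \<epsilon>"] by simp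
  define Dz where "Dz = 3 * (c\<^sup>2 * (norm a)\<^sup>2 + c\<^sup>2 * (norm re)\<^sup>2 + (norm (fst \<epsilon>))\<^sup>2)"
  define Dt where "Dt = 5 / 4 * (norm q)\<^sup>2 + 5 * (norm (snd \<epsilon>))\<^sup>2"
  define X where "X = c * (norm a)\<^sup>2 + c * (norm re)\<^sup>2"
  have eps: "(norm (fst \<epsilon>))\<^sup>2 + (norm (snd \<epsilon>))\<^sup>2 = (norm \<epsilon>)\<^sup>2"
    using norm_Pair_squared[of "fst \<epsilon>" "snd \<epsilon>"] by simp
  have "- lam * inner (gradE m v) D
       + lam\<^sup>2 * ((17 / 2 * r + m * L1 / 2) * (norm (fst D))\<^sup>2 + 7 / 8 * r * (norm (snd D))\<^sup>2)
     \<le> lam * (- (c * ((norm a)\<^sup>2 - (norm re)\<^sup>2) - norm a * norm (fst \<epsilon>) - norm re * norm (fst \<epsilon>)) - ((norm q)\<^sup>2 - norm q * norm (snd \<epsilon>)))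
       + lam\<^sup>2 * ((17 / 2 * r + m * L1 / 2) * Dz + 7 / 8 * r * Dt)"
  proof (rule add_mono)
    show "- lam * inner (gradE m v) D \<le> lam * (- (c * ((norm a)\<^sup>2 - (norm re)\<^sup>2) - norm a * norm (fst \<epsilon>) - norm re * norm (fst \<epsilon>)) - ((norm q)\<^sup>2 - norm q * norm (snd \<epsilon>)))"
      using mult_left_mono[OF i1 lam(1)] by (simp add: algebra_simps)
    show "lam\<^sup>2 * ((17 / 2 * r + m * L1 / 2) * (norm (fst D))\<^sup>2 + 7 / 8 * r * (norm (snd D))\<^sup>2)
        \<le> lam\<^sup>2 * ((17 / 2 * r + m * L1 / 2) * Dz + 7 / 8 * r * Dt)"
      unfolding Dz_def Dt_def using i2 i3 r_pos m L1_nonneg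
      by (intro mult_left_mono add_mono) auto
  qed
  also have "lam\<^sup>2 * ((17 / 2 * r + m * L1 / 2) * Dz + 7 / 8 * r * Dt)
     = lam * ((17 / 2 * (lam * r) + x / (2 * c)) * Dz + 7 / 8 * (lam * r) * Dt)"
    using c by (simp add: x power2_eq_square field_simps)
  also have "lam * (- (c * ((norm a)\<^sup>2 - (norm re)\<^sup>2) - norm a * norm (fst \<epsilon>) - norm re * norm (fst \<epsilon>)) - ((norm q)\<^sup>2 - norm q * norm (snd \<epsilon>)))
       + lam * ((17 / 2 * (lam * r) + x / (2 * c)) * Dz + 7 / 8 * (lam * r) * Dt)
     \<le> lam * (- (c / 5) * (norm a)\<^sup>2 - (norm q)\<^sup>2 / 8 + 3 / 2 * x * X + (3 / c + 8 + 3 / 2 * x / c) * (norm \<epsilon>)\<^sup>2)"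
    unfolding distrib_left[symmetric]
  proof (rule mult_left_mono[OF _ lam(1)])
    show "- (c * ((norm a)\<^sup>2 - (norm re)\<^sup>2) - norm a * norm (fst \<epsilon>) - norm re * norm (fst \<epsilon>)) - ((norm q)\<^sup>2 - norm q * norm (snd \<epsilon>))
       + ((17 / 2 * (lam * r) + x / (2 * c)) * Dz + 7 / 8 * (lam * r) * Dt)
      \<le> - (c / 5) * (norm a)\<^sup>2 - (norm q)\<^sup>2 / 8 + 3 / 2 * x * X + (3 / c + 8 + 3 / 2 * x / c) * (norm \<epsilon>)\<^sup>2"
      using energy_decrease_scalar[OF c(1,2) _ lam(2) x0 R, of "norm a" "norm (fst \<epsilon>)" "norm (snd \<epsilon>)"] lam r_pos
      unfolding Dz_def Dt_def X_def eps[symmetric] add.assoc by simp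
  qed
  finally have main: "energy m v - lam * inner (gradE m v) D
       + lam\<^sup>2 * ((17 / 2 * r + m * L1 / 2) * (norm (fst D))\<^sup>2 + 7 / 8 * r * (norm (snd D))\<^sup>2)
     \<le> energy m v + lam * (- (c / 5) * (norm a)\<^sup>2 - (norm q)\<^sup>2 / 8 + 3 / 2 * x * X + (3 / c + 8 + 3 / 2 * x / c) * (norm \<epsilon>)\<^sup>2)"
    by simp
  have E0: "0 \<le> energy m v" by (rule energy_nonneg[OF m])
  have ec: "(3 / c + 8 + 3 / 2 * x / c) * (norm \<epsilon>)\<^sup>2 \<le> (4 / c + 8 + 3 / 2 * x / c) * (norm \<epsilon>)\<^sup>2"
    using c by (intro mult_right_mono) (auto simp: divide_right_mono)
  show ?thesis
  proof (cases "x \<le> 1 / 20")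
    case True
    have "3 / 2 * x * X \<le> 3 / 2 * (1 / 20) * X"
      using True c by (intro mult_right_mono mult_left_mono) (auto simp: X_def)
    also have "\<dots> \<le> c / 10 * (norm a)\<^sup>2 + (norm q)\<^sup>2 / 8"
    proof -
      have "3 / 2 * (1 / 20) * (s + t) \<le> s / 10 + u / 8" if "0 \<le> s" "t \<le> u / 4" "0 \<le> u" for s t u :: real
        using that by simp
      from this[OF _ R, of "c * (norm a)\<^sup>2"] show ?thesis using c by (simp add: X_def)
    qed
    finally have "- (c / 5) * (norm a)\<^sup>2 - (norm q)\<^sup>2 / 8 + 3 / 2 * x * X + (3 / c + 8 + 3 / 2 * x / c) * (norm \<epsilon>)\<^sup>2
        \<le> - (c / 10 * (norm a)\<^sup>2) + (4 / c + 8 + 3 / 2 * x / c) * (norm \<epsilon>)\<^sup>2"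
      using ec by simp
    from mult_left_mono[OF this lam(1)] show ?thesis
      using main True unfolding a_def by (simp add: algebra_simps)
  next
    case False
    have "norm a \<le> norm (a + re) + norm re" using norm_triangle_ineq4[of "a + re" re] by simp
    then have "(norm a)\<^sup>2 \<le> (norm (a + re) + norm re)\<^sup>2" by (rule power_mono) simp
    also have "\<dots> \<le> 2 * (norm (a + re))\<^sup>2 + 2 * (norm re)\<^sup>2"
      using sum_squares_bound[of "norm (a + re)" "norm re"] by (simp add: power2_sum)
    finally have "c * (norm a)\<^sup>2 \<le> c * (2 * (norm (a + re))\<^sup>2 + 2 * (norm re)\<^sup>2)" using c by simp
    then have "X \<le> 2 * c * (norm (a + re))\<^sup>2 + 3 * (c * (norm re)\<^sup>2)" by (simp add: X_def algebra_simps)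
    also have "\<dots> \<le> (norm (a + re))\<^sup>2 + (norm q)\<^sup>2"
    proof -
      have "2 * c * (norm (a + re))\<^sup>2 \<le> 1 * (norm (a + re))\<^sup>2" using c by (intro mult_right_mono) auto
      then show ?thesis using R zero_le_power2[of "norm q"] by linarith
    qed
    also have "\<dots> = (norm (gradE m v))\<^sup>2" by (simp add: gE norm_Pair_squared)
    also have "\<dots> \<le> (34 * r + 2 * m * L1) * energy m v" by (rule gradE_squared_le[OF m])
    finally have "3 / 2 * x * X \<le> 3 / 2 * x * ((34 * r + 2 * m * L1) * energy m v)"
      using x0 by (intro mult_left_mono) auto
    moreover have "c / 10 * (norm a)\<^sup>2 \<le> c / 5 * (norm a)\<^sup>2" using c by (intro mult_right_mono) auto
    ultimately have "- (c / 5) * (norm a)\<^sup>2 - (norm q)\<^sup>2 / 8 + 3 / 2 * x * X + (3 / c + 8 + 3 / 2 * x / c) * (norm \<epsilon>)\<^sup>2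
        \<le> 3 / 2 * x * ((34 * r + 2 * m * L1) * energy m v) - (c / 10 * (norm a)\<^sup>2) + (4 / c + 8 + 3 / 2 * x / c) * (norm \<epsilon>)\<^sup>2"
      using ec zero_le_power2[of "norm q"] by linarith
    from mult_left_mono[OF this lam(1)] show ?thesis
      using main False unfolding a_def by (simp add: algebra_simps)
  qed
qed

end

section \<open>Summing coupled recursions\<close>

text \<open>
  With the weight \<open>\<beta> = 4 * h / \<kappa>\<close> the contraction of \<open>s\<close> pays for its contribution to \<open>e\<close>, so \<open>e + \<beta> * s\<close>
  satisfies a single recursion.  It grows by a factor only in the first \<open>k0\<close> steps.
\<close>

lemma lyapunov_sum:
  fixes e s p b :: "nat \<Rightarrow> real"
  assumes nonneg: "\<And>k. 0 \<le> e k" "\<And>k. 0 \<le> s k" "\<And>k. 0 \<le> p k"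
    and e: "\<And>k. k < K \<Longrightarrow> e (Suc k) \<le> (1 + b k) * e k - a * p k + h * s k + z1"
    and s: "\<And>k. k < K \<Longrightarrow> s (Suc k) \<le> (1 - \<kappa> / 4 + b k) * s k + z2"
    and b: "\<And>k. k < K \<Longrightarrow> 0 \<le> b k \<and> b k \<le> B" "\<And>k. k < K \<Longrightarrow> k0 \<le> k \<Longrightarrow> b k = 0"
    and h: "0 \<le> h" and \<kappa>: "0 < \<kappa>" and a: "0 \<le> a" and z: "0 \<le> z1" "0 \<le> z2" and B: "0 \<le> B"
  shows "a * (\<Sum>k<K. p k) \<le> (1 + B) ^ k0 * (e 0 + 4 * h / \<kappa> * s 0 + real K * (z1 + 4 * h / \<kappa> * z2))"
proof -
  define \<beta> where "\<beta> = 4 * h / \<kappa>"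
  have \<beta>: "0 \<le> \<beta>" "\<beta> * \<kappa> = 4 * h" using h \<kappa> by (simp_all add: \<beta>_def)
  define V where "V k = e k + \<beta> * s k" for k
  define Z where "Z = z1 + \<beta> * z2"
  have Z: "0 \<le> Z" using z \<beta> by (simp add: Z_def)
  have V: "0 \<le> V k" for k using nonneg \<beta> by (simp add: V_def)
  have step: "V (Suc k) + a * p k \<le> (1 + b k) * V k + Z" if "k < K" for k
  proof -
    have "\<beta> * s (Suc k) \<le> \<beta> * ((1 - \<kappa> / 4 + b k) * s k + z2)" using s[OF that] \<beta> by (intro mult_left_mono) auto
    also have "\<dots> = (1 + b k) * (\<beta> * s k) - (\<beta> * \<kappa>) * s k / 4 + \<beta> * z2" by (simp add: algebra_simps)
    also have "(\<beta> * \<kappa>) * s k / 4 = h * s k" unfolding \<beta> by simp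
    finally show ?thesis using e[OF that] unfolding V_def Z_def distrib_left by linarith
  qed
  have "j \<le> K \<Longrightarrow> V j + a * (\<Sum>k<j. p k) \<le> (1 + B) ^ min j k0 * (V 0 + real j * Z)" for j
  proof (induction j)
    case (Suc j)
    let ?P = "(1 + B) ^ min j k0" and ?Q = "(1 + B) ^ min (Suc j) k0"
    have j: "j < K" using Suc by simp
    have S0: "0 \<le> a * (\<Sum>k<j. p k)" using a nonneg by (intro mult_nonneg_nonneg sum_nonneg) auto
    have bb: "(1 + b j) * ?P \<le> ?Q"
    proof (cases "j < k0")
      case True
      then have "?Q = (1 + B) * ?P" by (simp add: min_def)
      moreover have "(1 + b j) * ?P \<le> (1 + B) * ?P"
        by (rule mult_right_mono) (use b(1)[OF j] B in auto)
      ultimately show ?thesis by simp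
    next
      case False
      then show ?thesis using b(2)[OF j] by (simp add: min_def)
    qed
    have Q1: "1 \<le> ?Q" using B by (intro one_le_power) auto
    have "V (Suc j) + a * (\<Sum>k<Suc j. p k) \<le> (1 + b j) * V j + Z + a * (\<Sum>k<j. p k)"
      using step[OF j] by (simp add: distrib_left)
    also have "\<dots> \<le> (1 + b j) * (V j + a * (\<Sum>k<j. p k)) + Z"
      using mult_nonneg_nonneg[OF conjunct1[OF b(1)[OF j]] S0] by (simp add: algebra_simps)
    also have "\<dots> \<le> (1 + b j) * (?P * (V 0 + real j * Z)) + ?Q * Z"
      using Suc b(1)[OF j] mult_right_mono[OF Q1 Z] by (intro add_mono mult_left_mono) auto
    also have "\<dots> \<le> ?Q * (V 0 + real j * Z) + ?Q * Z"
      using mult_right_mono[OF bb, of "V 0 + real j * Z"] V[of 0] Z by (simp add: mult.assoc)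
    finally show ?case by (simp add: algebra_simps)
  qed simp
  from this[of K] have "a * (\<Sum>k<K. p k) \<le> (1 + B) ^ min K k0 * (V 0 + real K * Z)"
    using V[of K] by simp
  also have "\<dots> \<le> (1 + B) ^ k0 * (V 0 + real K * Z)"
    using B V[of 0] Z by (intro mult_right_mono power_increasing) auto
  finally show ?thesis by (simp add: V_def Z_def \<beta>_def)
qed

lemma integral_mean:
  assumes "\<And>i. i < n \<Longrightarrow> integrable M (X i)"
  shows "integrable M (\<lambda>\<omega>. mean n (\<lambda>i. X i \<omega> :: real))"
    and "(\<integral>\<omega>. mean n (\<lambda>i. X i \<omega>) \<partial>M) = mean n (\<lambda>i. \<integral>\<omega>. X i \<omega> \<partial>M)"
  unfolding mean_def
  by (intro integrable_scaleR_right Bochner_Integration.integrable_sum; use assms in simp)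
     (subst integral_scaleR_right, subst Bochner_Integration.integral_sum; use assms in simp)

lemma inner_mean_right: "inner y (mean n u) = mean n (\<lambda>i. inner y (u i))"
  by (rule linear_mean) (rule bounded_linear.linear[OF bounded_linear_inner_right])

context bilevel begin

lemma gradE_continuous: "continuous_on UNIV (gradE m)"
proof -
  have c: "continuous_on UNIV (grad G)" using smooth_G unfolding smooth_fun_def by auto
  have "continuous_on UNIV (\<lambda>v. \<theta>s (fst v))" "continuous_on UNIV (\<lambda>v. gradPsi m (fst v))"
    by (auto intro!: continuous_on_compose2[OF theta_star_continuous] continuous_on_compose2[OF gradPsi_continuous] continuous_intros)
  then show ?thesis unfolding gradE_def gap_grad_def gradP_def case_prod_beta
    by (intro continuous_intros continuous_on_compose2[OF c]) auto
qed

lemma step_dir_continuous: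
  fixes f g :: "'x \<times> 'y \<Rightarrow> real"
  assumes "smooth_fun L1 f" "smooth_fun L2 g" "0 \<le> c" "c \<le> 3 / 32" "0 \<le> m"
  shows "continuous_on UNIV (step_dir \<gamma> c m f g)"
proof (rule lipschitz_on_continuous_on[of "lip c m"], rule lipschitz_onI)
  show "dist (step_dir \<gamma> c m f g v) (step_dir \<gamma> c m f g v') \<le> lip c m * dist v v'" for v v'
    unfolding dist_norm by (rule step_dir_lipschitz[OF assms])
qed (rule lip_nonneg[OF assms(3,5)])

lemma energy_integrable:
  assumes M: "finite_measure M" and X: "square_integrable M X" and m: "0 \<le> m"
  shows "integrable M (\<lambda>\<omega>. energy m (X \<omega>))"
proof (rule Bochner_Integration.integrable_bound)
  interpret finite_measure M by fact
  define A where "A = 17 / 2 * r + m * L1 / 2"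
  let ?g = "gradE m 0"
  show "integrable M (\<lambda>\<omega>. energy m 0 + (norm ?g)\<^sup>2 + (1 + A) * (norm (X \<omega>))\<^sup>2)"
    using square_integrable_norm[OF X] by auto
  have Xm [measurable]: "X \<in> borel_measurable M" using X by (simp add: square_integrable_def)
  show "(\<lambda>\<omega>. energy m (X \<omega>)) \<in> borel_measurable M"
    by (rule measurable_compose[OF Xm borel_measurable_continuous_onI[OF energy_continuous]])
  show "AE \<omega> in M. norm (energy m (X \<omega>)) \<le> norm (energy m 0 + (norm ?g)\<^sup>2 + (1 + A) * (norm (X \<omega>))\<^sup>2)"
  proof (rule AE_I2)
    fix \<omega>
    let ?x = "X \<omega>"
    have "energy m (0 + ?x) \<le> energy m 0 + inner ?g ?x + A * (norm (fst ?x))\<^sup>2 + 7 / 8 * r * (norm (snd ?x))\<^sup>2"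
      unfolding A_def by (rule energy_upper[OF m])
    also have "7 / 8 * r * (norm (snd ?x))\<^sup>2 \<le> A * (norm (snd ?x))\<^sup>2"
      using r_pos m L1_nonneg by (intro mult_right_mono) (auto simp: A_def)
    also have "energy m 0 + inner ?g ?x + A * (norm (fst ?x))\<^sup>2 + A * (norm (snd ?x))\<^sup>2
        = energy m 0 + inner ?g ?x + A * (norm ?x)\<^sup>2"
      by (simp add: norm_prod_squared[of ?x] algebra_simps)
    also have "inner ?g ?x \<le> (norm ?g)\<^sup>2 + (norm ?x)\<^sup>2"
      using two_mult_le_weighted[of 1 "norm ?g" "norm ?x"] norm_cauchy_schwarz[of ?g ?x]
        mult_nonneg_nonneg[OF norm_ge_zero norm_ge_zero, of ?g ?x] by linarith
    finally show "norm (energy m (X \<omega>)) \<le> norm (energy m 0 + (norm ?g)\<^sup>2 + (1 + A) * (norm (X \<omega>))\<^sup>2)"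
      using energy_nonneg[OF m, of ?x] by (simp add: algebra_simps)
  qed
qed

end

section \<open>The iterates as random variables\<close>

text \<open>
  A run of the algorithm with the three variables of an agent collected in one vector \<open>v\<close>.  The
  assumptions on \<open>c\<close> and \<open>lam\<close> are the conclusions of \<open>step_size_consequences\<close>.
\<close>

locale dsbo_run =
  bilevel F G L1 L2 \<gamma> F_low +
  sampling M "({..<K} \<times> {..<n}) <+> ({..<K} \<times> {..<n})" "case_sum (\<lambda>(k, i). Sf i) (\<lambda>(k, i). Sg i)"
    "case_sum (\<lambda>(k, i). \<xi>f k i) (\<lambda>(k, i). \<xi>g k i)"
  for F G :: "'x::euclidean_space \<times> 'y::euclidean_space \<Rightarrow> real" and L1 L2 \<gamma> F_low :: real
    and M :: "'w measure" and K n :: nat and Sf Sg :: "nat \<Rightarrow> 's measure"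
    and \<xi>f \<xi>g :: "nat \<Rightarrow> nat \<Rightarrow> 'w \<Rightarrow> 's" +
  fixes W :: "real mat" and \<rho> :: real and f g :: "nat \<Rightarrow> 'x \<times> 'y \<Rightarrow> real"
    and fs gs :: "nat \<Rightarrow> 's \<Rightarrow> 'x \<times> 'y \<Rightarrow> real"
    and \<delta>f \<delta>g \<sigma>f \<sigma>g c lam \<mu>0 :: real and \<mu> :: "nat \<Rightarrow> real"
    and v :: "nat \<Rightarrow> nat \<Rightarrow> 'w \<Rightarrow> ('x \<times> 'y) \<times> 'y" and v0 :: "nat \<Rightarrow> ('x \<times> 'y) \<times> 'y"
  assumes n: "1 \<le> n"
    and F_mean: "F = (\<lambda>z. mean n (\<lambda>i. f i z))" and G_mean: "G = (\<lambda>z. mean n (\<lambda>i. g i z))"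
    and smooth_f: "\<And>i. i < n \<Longrightarrow> smooth_fun L1 (f i)" and smooth_g: "\<And>i. i < n \<Longrightarrow> smooth_fun L2 (g i)"
    and oracle_f: "\<And>i. i < n \<Longrightarrow> stochastic_oracle (Sf i) (fs i) (f i) \<delta>f"
    and oracle_g: "\<And>i. i < n \<Longrightarrow> stochastic_oracle (Sg i) (gs i) (g i) \<delta>g"
    and topology: "network_topology n W \<rho>"
    and dissim_f: "gradient_dissimilarity n f \<sigma>f" and dissim_g: "gradient_dissimilarity n g \<sigma>g"
    and c: "0 < c" "c \<le> 3 / 32" "c * S\<^sup>2 \<le> \<eta>\<^sup>2 / 4"
    and lam: "0 < lam" "lam * r \<le> 49 / 192 * (1 - \<rho>)"
    and mu: "\<And>k. 0 \<le> \<mu> k" "\<And>k. \<mu> k \<le> \<mu>0" "\<And>k. \<mu> (Suc k) \<le> \<mu> k"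
    and init: "\<And>i \<omega>. i < n \<Longrightarrow> \<omega> \<in> space M \<Longrightarrow> v 0 i \<omega> = v0 i"
    and step: "\<And>k i \<omega>. k < K \<Longrightarrow> i < n \<Longrightarrow> \<omega> \<in> space M \<Longrightarrow>
      v (Suc k) i \<omega> = gossip n W i (\<lambda>j. v k j \<omega>
        - lam *\<^sub>R step_dir \<gamma> c (\<mu> k) (fs j (\<xi>f k j \<omega>)) (gs j (\<xi>g k j \<omega>)) (v k j \<omega>))"
begin

abbreviation "samples \<equiv> ({..<K} \<times> {..<n}) <+> ({..<K} \<times> {..<n})"

definition hist :: "nat \<Rightarrow> (nat \<times> nat + nat \<times> nat) set" where
  "hist k = ({..<k} \<times> {..<n}) <+> ({..<k} \<times> {..<n})"

definition avg :: "nat \<Rightarrow> 'w \<Rightarrow> ('x \<times> 'y) \<times> 'y" where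
  "avg k \<omega> = mean n (\<lambda>i. v k i \<omega>)"

definition cons_err :: "nat \<Rightarrow> 'w \<Rightarrow> real" where
  "cons_err k \<omega> = mean n (\<lambda>i. (norm (v k i \<omega> - avg k \<omega>))\<^sup>2)"

definition dir :: "nat \<Rightarrow> nat \<Rightarrow> ('x \<times> 'y) \<times> 'y \<Rightarrow> ('x \<times> 'y) \<times> 'y" where
  "dir k i = step_dir \<gamma> c (\<mu> k) (f i) (g i)"

definition noise :: "nat \<Rightarrow> nat \<Rightarrow> 'w \<Rightarrow> ('x \<times> 'y) \<times> 'y" where
  "noise k i \<omega> = step_dir \<gamma> c (\<mu> k) (fs i (\<xi>f k i \<omega>)) (gs i (\<xi>g k i \<omega>)) (v k i \<omega>) - dir k i (v k i \<omega>)"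

lemma rho: "0 \<le> \<rho>" "\<rho> < 1" using network_topology_n[OF topology] by auto

lemma mu0: "0 \<le> \<mu>0" using mu(1,2)[of 0] by simp

lemma hist_subset: "k \<le> K \<Longrightarrow> hist k \<subseteq> samples" by (auto simp: hist_def)

lemma hist_Suc: "hist k \<subseteq> hist (Suc k)" by (auto simp: hist_def)

lemma step_noise:
  assumes "k < K" "i < n" "\<omega> \<in> space M"
  shows "v (Suc k) i \<omega> = gossip n W i (\<lambda>j. v k j \<omega> - lam *\<^sub>R (dir k j (v k j \<omega>) + noise k j \<omega>))"
  using step[OF assms] by (simp add: noise_def)

text \<open>The two points at which agent \<open>i\<close> evaluates gradients in iteration \<open>k\<close>.\<close>

definition pt :: "nat \<Rightarrow> nat \<Rightarrow> 'w \<Rightarrow> 'x \<times> 'y" where "pt k i \<omega> = fst (v k i \<omega>)"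
definition pt' :: "nat \<Rightarrow> nat \<Rightarrow> 'w \<Rightarrow> 'x \<times> 'y" where "pt' k i \<omega> = (fst (fst (v k i \<omega>)), snd (v k i \<omega>))"

abbreviation "err_f k i \<equiv> err (Inl (k, i)) (fs i) (f i) (pt k i)"
abbreviation "err_g k i \<equiv> err (Inr (k, i)) (gs i) (g i) (pt k i)"
abbreviation "err_g' k i \<equiv> err (Inr (k, i)) (gs i) (g i) (pt' k i)"

lemma noise_eq: "noise k i \<omega> = comb c (\<mu> k) (err_f k i \<omega>) (err_g k i \<omega>) (err_g' k i \<omega>)"
  unfolding noise_def dir_def step_dir_diff_oracle err_def pt_def pt'_def by simp

lemma oracle_sample:
  assumes "i < n"
  shows "stochastic_oracle (case Inl (k, i) of Inl (k, i) \<Rightarrow> Sf i | Inr (k, i) \<Rightarrow> Sg i) (fs i) (f i) \<delta>f"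
    and "stochastic_oracle (case Inr (k, i) of Inl (k, i) \<Rightarrow> Sf i | Inr (k, i) \<Rightarrow> Sg i) (gs i) (g i) \<delta>g"
  using oracle_f[OF assms] oracle_g[OF assms] by simp_all

lemma comb_borel:
  assumes [measurable]: "a \<in> borel_measurable N" "b \<in> borel_measurable N" "d \<in> borel_measurable N"
  shows "(\<lambda>\<omega>. comb c m (a \<omega>) (b \<omega>) (d \<omega>) :: ('x \<times> 'y) \<times> 'y) \<in> borel_measurable N"
proof -
  have fst_m: "fst \<in> borel_measurable (borel :: ('x \<times> 'y) measure)" and snd_m: "snd \<in> borel_measurable (borel :: ('x \<times> 'y) measure)"
    by (auto intro!: borel_measurable_continuous_onI continuous_intros)
  note [measurable] = measurable_compose[OF assms(3) fst_m] measurable_compose[OF assms(3) snd_m]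
  show ?thesis unfolding comb_def by measurable
qed

lemma pt_measurable:
  assumes "v k i \<in> borel_measurable N"
  shows "pt k i \<in> borel_measurable N" "pt' k i \<in> borel_measurable N"
  unfolding pt_def[abs_def] pt'_def[abs_def]
  by (rule measurable_compose[OF assms], intro borel_measurable_continuous_onI continuous_intros)+

lemma fresh_not_hist: "Inl (k, i) \<notin> hist k" "Inr (k, i) \<notin> hist k"
  by (auto simp: hist_def)

lemma noise_measurable:
  assumes k: "k < K" "i < n" and J: "hist k \<subseteq> J" "J \<subseteq> samples" "Inl (k, i) \<in> J" "Inr (k, i) \<in> J"
    and v: "v k i \<in> borel_measurable (past (hist k))"
  shows "noise k i \<in> borel_measurable (past J)"
proof -
  note a = pt_measurable[OF v]
  note H = hist_subset[OF less_imp_le[OF k(1)]]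
  have j: "Inl (k, i) \<in> samples" "Inr (k, i) \<in> samples" using J by auto
  note f = oracle_error_measurable[OF H j(1) fresh_not_hist(1) oracle_sample(1) smooth_f]
    and g = oracle_error_measurable[OF H j(2) fresh_not_hist(2) oracle_sample(2) smooth_g]
  have "(\<lambda>\<omega>. comb c (\<mu> k) (err_f k i \<omega>) (err_g k i \<omega>) (err_g' k i \<omega>)) \<in> borel_measurable (past J)"
    by (intro comb_borel f[OF k(2) k(2) a(1) J(2,1,3)] g[OF k(2) k(2) _ J(2,1,4)] a)
  then show ?thesis by (simp add: noise_eq[abs_def])
qed

lemma dir_borel: "i < n \<Longrightarrow> dir k i \<in> borel_measurable borel"
  unfolding dir_def using c mu
  by (intro borel_measurable_continuous_onI step_dir_continuous smooth_f smooth_g) auto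

lemma state_measurable: "k \<le> K \<Longrightarrow> i < n \<Longrightarrow> v k i \<in> borel_measurable (past (hist k))"
proof (induction k arbitrary: i)
  case 0
  show ?case
    by (rule measurable_cong[THEN iffD2, of _ _ "\<lambda>_. v0 i"]) (use 0 init in auto)
next
  case (Suc k)
  have k: "k < K" using Suc by simp
  have vj: "v k j \<in> borel_measurable (past (hist (Suc k)))" if "j < n" for j
    using past_mono[OF hist_Suc hist_subset Suc.IH] Suc.prems that by simp
  have "(\<lambda>\<omega>. gossip n W i (\<lambda>j. v k j \<omega> - lam *\<^sub>R (dir k j (v k j \<omega>) + noise k j \<omega>))) \<in> borel_measurable (past (hist (Suc k)))"
    unfolding gossip_def
  proof (rule borel_measurable_sum)
    fix j assume "j \<in> {..<n}"
    then have j: "j < n" by simp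
    have "noise k j \<in> borel_measurable (past (hist (Suc k)))"
      using hist_subset[OF Suc.prems(1)] j Suc.IH[OF _ j] k
      by (intro noise_measurable hist_Suc) (auto simp: hist_def)
    moreover have "(\<lambda>\<omega>. dir k j (v k j \<omega>)) \<in> borel_measurable (past (hist (Suc k)))"
      by (rule measurable_compose[OF vj[OF j] dir_borel[OF j]])
    ultimately show "(\<lambda>\<omega>. W $$ (i, j) *\<^sub>R (v k j \<omega> - lam *\<^sub>R (dir k j (v k j \<omega>) + noise k j \<omega>))) \<in> borel_measurable (past (hist (Suc k)))"
      using vj[OF j] by measurable
  qed
  then show ?case
    by (rule measurable_cong[THEN iffD2, rotated]) (use step_noise[OF k Suc.prems(2)] in auto)
qed

text \<open>
  Bounds for the variance of the noise and the dissimilarity of the directions that hold in every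
  iteration.  They agree up to the names of the constants, because both quantities pass through \<open>comb\<close>.
\<close>

definition noise_bound :: real where "noise_bound = \<mu>0\<^sup>2 * \<delta>f\<^sup>2 + 4 * \<delta>g\<^sup>2"
definition dissim_bound :: real where "dissim_bound = \<mu>0\<^sup>2 * \<sigma>f\<^sup>2 + 4 * \<sigma>g\<^sup>2"

lemma noise_bound_nonneg: "0 \<le> noise_bound" "0 \<le> dissim_bound"
  by (auto simp: noise_bound_def dissim_bound_def)

lemma norm_comb_mu_squared_le:
  "(norm (comb c (\<mu> k) a b d))\<^sup>2 \<le> \<mu>0\<^sup>2 * (norm a)\<^sup>2 + 1 / 5 * (norm b)\<^sup>2 + 19 / 5 * (norm d)\<^sup>2"
proof -
  have "(norm (comb c (\<mu> k) a b d))\<^sup>2 \<le> (\<mu> k)\<^sup>2 * (norm a)\<^sup>2 + 1 / 5 * (norm b)\<^sup>2 + 19 / 5 * (norm d)\<^sup>2"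
    using c mu(1) by (intro norm_comb_squared_le) auto
  also have "(\<mu> k)\<^sup>2 * (norm a)\<^sup>2 \<le> \<mu>0\<^sup>2 * (norm a)\<^sup>2"
    by (rule mult_right_mono[OF power_mono[OF mu(2) mu(1)] zero_le_power2])
  finally show ?thesis by simp
qed

lemma noise_variance:
  assumes k: "k < K" "i < n"
  shows "square_integrable M (noise k i)" and "(\<integral>\<omega>. (norm (noise k i \<omega>))\<^sup>2 \<partial>M) \<le> noise_bound"
proof -
  have v: "v k i \<in> borel_measurable (past (hist k))" using k by (intro state_measurable) auto
  note a = pt_measurable[OF v]
  note H = hist_subset[OF less_imp_le[OF k(1)]]
  have j: "Inl (k, i) \<in> samples" "Inr (k, i) \<in> samples" using k by auto
  note f = oracle_error_variance[OF H j(1) fresh_not_hist(1) oracle_sample(1)[OF k(2)] smooth_f[OF k(2)] a(1)]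
    and g = oracle_error_variance[OF H j(2) fresh_not_hist(2) oracle_sample(2)[OF k(2)] smooth_g[OF k(2)]]
  note i = square_integrable_norm[OF f(1)] square_integrable_norm[OF g(1)[OF a(1)]] square_integrable_norm[OF g(1)[OF a(2)]]
  let ?u = "\<lambda>\<omega>. \<mu>0\<^sup>2 * (norm (err_f k i \<omega>))\<^sup>2 + 1 / 5 * (norm (err_g k i \<omega>))\<^sup>2 + 19 / 5 * (norm (err_g' k i \<omega>))\<^sup>2"
  have le: "(norm (noise k i \<omega>))\<^sup>2 \<le> ?u \<omega>" for \<omega>
    unfolding noise_eq by (rule norm_comb_mu_squared_le)
  have m: "noise k i \<in> borel_measurable M"
    by (rule past_measurable[OF order_refl noise_measurable[OF k _ _ _ _ v]]) (use k H in auto)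
  have int: "integrable M (\<lambda>\<omega>. (norm (noise k i \<omega>))\<^sup>2)"
    by (rule Bochner_Integration.integrable_bound[of M ?u])
       (use i m le in \<open>auto intro!: AE_I2 simp: abs_of_nonneg\<close>)
  show "square_integrable M (noise k i)" using m int by (simp add: square_integrable_def)
  have "(\<integral>\<omega>. (norm (noise k i \<omega>))\<^sup>2 \<partial>M) \<le> (\<integral>\<omega>. ?u \<omega> \<partial>M)"
    by (rule integral_mono[OF int _ le]) (use i in auto)
  also have "\<dots> = \<mu>0\<^sup>2 * (\<integral>\<omega>. (norm (err_f k i \<omega>))\<^sup>2 \<partial>M) + 1 / 5 * (\<integral>\<omega>. (norm (err_g k i \<omega>))\<^sup>2 \<partial>M)
      + 19 / 5 * (\<integral>\<omega>. (norm (err_g' k i \<omega>))\<^sup>2 \<partial>M)"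
    using i by simp
  also have "\<dots> \<le> \<mu>0\<^sup>2 * \<delta>f\<^sup>2 + 1 / 5 * \<delta>g\<^sup>2 + 19 / 5 * \<delta>g\<^sup>2"
    by (intro add_mono mult_left_mono f(2) g(2) a) auto
  finally show "(\<integral>\<omega>. (norm (noise k i \<omega>))\<^sup>2 \<partial>M) \<le> noise_bound" by (simp add: noise_bound_def)
qed

text \<open>
  Allowing \<open>J\<close> to contain samples of other agents from the same iteration covers the products of the
  errors of two agents.
\<close>

lemma noise_orthogonal:
  assumes k: "k < K" "i < n" and J: "hist k \<subseteq> J" "J \<subseteq> samples" "Inl (k, i) \<notin> J" "Inr (k, i) \<notin> J"
    and Y: "Y \<in> borel_measurable (past J)" "square_integrable M Y"
  shows "(\<integral>\<omega>. inner (Y \<omega>) (noise k i \<omega>) \<partial>M) = 0"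
proof -
  have v: "v k i \<in> borel_measurable (past J)"
    using k by (intro past_mono[OF J(1,2)] state_measurable) auto
  note a = pt_measurable[OF v]
  have j: "Inl (k, i) \<in> samples" "Inr (k, i) \<in> samples" using k by auto
  note f = J(2) j(1) J(3) oracle_sample(1)[OF k(2)] smooth_f[OF k(2)] a(1)
  note g = J(2) j(2) J(4) oracle_sample(2)[OF k(2)] smooth_g[OF k(2)]
  \<comment> \<open>The adjoint of \<open>comb\<close>, applied to \<open>Y\<close>, pairs with the three errors separately.\<close>
  define A where "A = (\<lambda>y :: ('x \<times> 'y) \<times> 'y. (c * \<mu> k) *\<^sub>R fst y)"
  define B where "B = (\<lambda>y :: ('x \<times> 'y) \<times> 'y. c *\<^sub>R fst y)"
  define C where "C = (\<lambda>y :: ('x \<times> 'y) \<times> 'y. (- c *\<^sub>R fst (fst y), snd y))"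
  have orth: "integrable M (\<lambda>\<omega>. inner (U (Y \<omega>)) (E \<omega>)) \<and> (\<integral>\<omega>. inner (U (Y \<omega>)) (E \<omega>) \<partial>M) = 0"
    if U: "bounded_linear U" and E: "square_integrable M E"
      and z: "\<And>Y. Y \<in> borel_measurable (past J) \<Longrightarrow> square_integrable M Y \<Longrightarrow> (\<integral>\<omega>. inner (Y \<omega>) (E \<omega>) \<partial>M) = 0"
    for U :: "('x \<times> 'y) \<times> 'y \<Rightarrow> 'x \<times> 'y" and E
  proof -
    have m: "(\<lambda>\<omega>. U (Y \<omega>)) \<in> borel_measurable (past J)"
      by (rule measurable_compose[OF Y(1)])
         (intro borel_measurable_continuous_onI linear_continuous_on U)
    obtain b where b: "\<And>y. norm (U y) \<le> b * norm y" using bounded_linear.bounded[OF U] by (metis mult.commute)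
    have "square_integrable M (\<lambda>\<omega>. U (Y \<omega>))"
      by (rule square_integrable_bound[OF Y(2) Y(2) past_measurable[OF J(2) m], of b 0]) (simp add: b)
    then show ?thesis using z[OF m] square_integrable_inner[OF _ E] by blast
  qed
  have "bounded_linear A" "bounded_linear B" "bounded_linear C"
    unfolding A_def B_def C_def
    by (intro bounded_linear_intros)+
  note o = orth[OF this(1) oracle_error_variance(1)[OF f] oracle_error_orthogonal[OF f]]
    orth[OF this(2) oracle_error_variance(1)[OF g a(1)] oracle_error_orthogonal[OF g a(1)]]
    orth[OF this(3) oracle_error_variance(1)[OF g a(2)] oracle_error_orthogonal[OF g a(2)]]
  have eq: "inner (Y \<omega>) (noise k i \<omega>)
      = inner (A (Y \<omega>)) (err_f k i \<omega>) + inner (B (Y \<omega>)) (err_g k i \<omega>) + inner (C (Y \<omega>)) (err_g' k i \<omega>)" for \<omega>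
    unfolding noise_eq comb_def A_def B_def C_def
    by (simp add: inner_prod_def inner_add_right inner_diff_right algebra_simps)
  show ?thesis unfolding eq using o by simp
qed

lemma dir_lipschitz: "i < n \<Longrightarrow> norm (dir k i u - dir k i u') \<le> lip c (\<mu> k) * norm (u - u')"
  unfolding dir_def using c mu by (intro step_dir_lipschitz smooth_f smooth_g) auto

lemma dir_square_integrable:
  assumes "i < n" "square_integrable M X"
  shows "square_integrable M (\<lambda>\<omega>. dir k i (X \<omega>))"
proof (rule square_integrable_linear_bound[OF finite_measure_axioms assms(2)])
  show "(\<lambda>\<omega>. dir k i (X \<omega>)) \<in> borel_measurable M"
    using assms measurable_compose[OF _ dir_borel] by (auto simp: square_integrable_def)
  fix \<omega>
  show "norm (dir k i (X \<omega>)) \<le> lip c (\<mu> k) * norm (X \<omega>) + norm (dir k i 0)"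
    using dir_lipschitz[OF assms(1), of k "X \<omega>" 0] norm_triangle_ineq2[of "dir k i (X \<omega>)" "dir k i 0"] by simp
qed

lemma state_square_integrable: "k \<le> K \<Longrightarrow> i < n \<Longrightarrow> square_integrable M (v k i)"
proof (induction k arbitrary: i)
  case 0
  have "square_integrable M (\<lambda>_. v0 i)" by (rule square_integrable_const[OF finite_measure_axioms])
  moreover have "square_integrable M (v 0 i) \<longleftrightarrow> square_integrable M (\<lambda>_. v0 i)"
    unfolding square_integrable_def
    by (intro conj_cong measurable_cong Bochner_Integration.integrable_cong) (use 0 init in auto)
  ultimately show ?case by simp
next
  case (Suc k)
  have k: "k < K" using Suc by simp
  have "square_integrable M (\<lambda>\<omega>. gossip n W i (\<lambda>j. v k j \<omega> - lam *\<^sub>R (dir k j (v k j \<omega>) + noise k j \<omega>)))"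
    unfolding gossip_def
    by (intro square_integrable_sum[OF finite_measure_axioms] square_integrable_scaleR square_integrable_diff
        square_integrable_add dir_square_integrable noise_variance(1)) (use Suc k in auto)
  moreover have "square_integrable M (v (Suc k) i)
      \<longleftrightarrow> square_integrable M (\<lambda>\<omega>. gossip n W i (\<lambda>j. v k j \<omega> - lam *\<^sub>R (dir k j (v k j \<omega>) + noise k j \<omega>)))"
    unfolding square_integrable_def
    by (intro conj_cong measurable_cong Bochner_Integration.integrable_cong) (use step_noise[OF k Suc.prems(2)] in auto)
  ultimately show ?case by simp
qed

lemma avg_square_integrable: "k \<le> K \<Longrightarrow> square_integrable M (avg k)"
  unfolding avg_def[abs_def] by (intro square_integrable_mean finite_measure_axioms state_square_integrable)

lemma avg_measurable: "k \<le> K \<Longrightarrow> avg k \<in> borel_measurable (past (hist k))"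
  unfolding avg_def[abs_def] mean_def
  by (intro borel_measurable_scaleR borel_measurable_sum measurable_const state_measurable) auto

abbreviation "mean_energy k \<equiv> (\<integral>\<omega>. energy (\<mu> k) (avg k \<omega>) \<partial>M)"
abbreviation "mean_cons k \<equiv> (\<integral>\<omega>. cons_err k \<omega> \<partial>M)"
abbreviation "mean_grad k \<equiv> (\<integral>\<omega>. (norm (gradPsi (\<mu> k) (fst (avg k \<omega>))))\<^sup>2 \<partial>M)"
abbreviation "mdir k \<equiv> step_dir \<gamma> c (\<mu> k) F G"

lemma cons_err_integrable: "k \<le> K \<Longrightarrow> integrable M (cons_err k)"
  unfolding cons_err_def[abs_def]
  by (intro integral_mean(1) square_integrable_norm square_integrable_diff state_square_integrable avg_square_integrable)

end

section \<open>One iteration in expectation\<close>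

context dsbo_run begin

lemma smooth_grad_mean: "grad F z = mean n (\<lambda>i. grad (f i) z)" "grad G z = mean n (\<lambda>i. grad (g i) z)"
  unfolding F_mean G_mean using smooth_fun_mean(2)[OF n] smooth_f smooth_g by metis+

lemma mean_dir: "mean n (\<lambda>i. dir k i u) = mdir k u"
proof -
  have "mean n (\<lambda>i. dir k i u) = mean n (\<lambda>i. comb c (\<mu> k) (grad (f i) (fst u)) (grad (g i) (fst u)) (grad (g i) (fst (fst u), snd u)))
      + mean n (\<lambda>i. ((0, (c / \<gamma>) *\<^sub>R (snd u - snd (fst u))), (1 / \<gamma>) *\<^sub>R (snd u - snd (fst u))))"
    unfolding dir_def step_dir_eq_comb by (rule mean_add[symmetric])
  then show ?thesis
    unfolding mean_comb mean_const[OF n] step_dir_eq_comb smooth_grad_mean .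
qed

lemma dissimilarity: "mean n (\<lambda>i. (norm (dir k i u - mdir k u))\<^sup>2) \<le> dissim_bound"
proof -
  let ?f = "\<lambda>i z. grad (f i) z - grad F z" and ?g = "\<lambda>i z. grad (g i) z - grad G z"
  let ?h = "(fst (fst u), snd u)"
  have f: "mean n (\<lambda>i. (norm (?f i z))\<^sup>2) \<le> \<sigma>f\<^sup>2" and g: "mean n (\<lambda>i. (norm (?g i z))\<^sup>2) \<le> \<sigma>g\<^sup>2" for z
    using dissim_f dissim_g unfolding gradient_dissimilarity_def F_mean G_mean by blast+
  have "(norm (dir k i u - mdir k u))\<^sup>2
      \<le> \<mu>0\<^sup>2 * (norm (?f i (fst u)))\<^sup>2 + 1 / 5 * (norm (?g i (fst u)))\<^sup>2 + 19 / 5 * (norm (?g i ?h))\<^sup>2" for i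
    unfolding dir_def step_dir_diff_oracle by (rule norm_comb_mu_squared_le)
  then have "mean n (\<lambda>i. (norm (dir k i u - mdir k u))\<^sup>2)
      \<le> mean n (\<lambda>i. \<mu>0\<^sup>2 * (norm (?f i (fst u)))\<^sup>2 + 1 / 5 * (norm (?g i (fst u)))\<^sup>2 + 19 / 5 * (norm (?g i ?h))\<^sup>2)"
    by (rule mean_mono)
  also have "\<dots> = \<mu>0\<^sup>2 * mean n (\<lambda>i. (norm (?f i (fst u)))\<^sup>2) + 1 / 5 * mean n (\<lambda>i. (norm (?g i (fst u)))\<^sup>2)
      + 19 / 5 * mean n (\<lambda>i. (norm (?g i ?h))\<^sup>2)"
    by (simp only: mean_add[symmetric] mean_cmult)
  also have "\<dots> \<le> \<mu>0\<^sup>2 * \<sigma>f\<^sup>2 + 1 / 5 * \<sigma>g\<^sup>2 + 19 / 5 * \<sigma>g\<^sup>2"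
    using f g by (intro add_mono mult_left_mono) auto
  finally show ?thesis by (simp add: dissim_bound_def)
qed

lemma expectation_norm_diff:
  assumes k: "k < K" "i < n" and p: "p \<in> borel_measurable (past (hist k))" "square_integrable M p"
  shows "integrable M (\<lambda>\<omega>. (norm (p \<omega> - lam *\<^sub>R noise k i \<omega>))\<^sup>2)"
    and "(\<integral>\<omega>. (norm (p \<omega> - lam *\<^sub>R noise k i \<omega>))\<^sup>2 \<partial>M) \<le> (\<integral>\<omega>. (norm (p \<omega>))\<^sup>2 \<partial>M) + lam\<^sup>2 * noise_bound"
proof -
  note N = noise_variance[OF k]
  have orth: "(\<integral>\<omega>. inner (p \<omega>) (noise k i \<omega>) \<partial>M) = 0"
    using k by (intro noise_orthogonal[OF k order_refl _ fresh_not_hist p] hist_subset) auto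
  have eq: "(norm (p \<omega> - lam *\<^sub>R noise k i \<omega>))\<^sup>2 = (norm (p \<omega>))\<^sup>2 - 2 * lam * inner (p \<omega>) (noise k i \<omega>) + lam\<^sup>2 * (norm (noise k i \<omega>))\<^sup>2" for \<omega>
    unfolding power2_norm_eq_inner
    by (simp add: inner_diff_left inner_diff_right inner_commute power2_eq_square algebra_simps)
  note int = square_integrable_norm[OF p(2)] square_integrable_inner[OF p(2) N(1)] square_integrable_norm[OF N(1)]
  show "integrable M (\<lambda>\<omega>. (norm (p \<omega> - lam *\<^sub>R noise k i \<omega>))\<^sup>2)"
    unfolding eq using int by auto
  have "(\<integral>\<omega>. (norm (p \<omega> - lam *\<^sub>R noise k i \<omega>))\<^sup>2 \<partial>M) = (\<integral>\<omega>. (norm (p \<omega>))\<^sup>2 \<partial>M) + lam\<^sup>2 * (\<integral>\<omega>. (norm (noise k i \<omega>))\<^sup>2 \<partial>M)"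
    unfolding eq using int orth by simp
  also have "\<dots> \<le> (\<integral>\<omega>. (norm (p \<omega>))\<^sup>2 \<partial>M) + lam\<^sup>2 * noise_bound"
    using N(2) by (intro add_mono mult_left_mono) auto
  finally show "(\<integral>\<omega>. (norm (p \<omega> - lam *\<^sub>R noise k i \<omega>))\<^sup>2 \<partial>M) \<le> (\<integral>\<omega>. (norm (p \<omega>))\<^sup>2 \<partial>M) + lam\<^sup>2 * noise_bound" .
qed

abbreviation (input) "\<kappa> \<equiv> 1 - \<rho>"

text \<open>
  The mean square deviation from the average is at most that from any other centre, here the average after a
  noiseless step with the averaged direction at \<open>avg k\<close>.  The difference of a local step to this centre
  splits into a part that is Lipschitz in the current deviation and the dissimilarity at \<open>avg k\<close>; the
  weight \<open>\<kappa> / 10\<close> in the splitting leaves enough of the contraction \<open>\<rho>\<^sup>2\<close>.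
\<close>

lemma consensus_step:
  assumes k: "k < K"
  shows "mean_cons (Suc k)
    \<le> \<rho>\<^sup>2 * ((1 + \<kappa> / 10) * (1 + lam * lip c (\<mu> k))\<^sup>2 * mean_cons k
        + (1 + 10 / \<kappa>) * lam\<^sup>2 * dissim_bound + lam\<^sup>2 * noise_bound)"
proof -
  have \<kappa>: "0 < \<kappa>" using rho by simp
  have kK: "k \<le> K" using k by simp
  define ctr where "ctr \<omega> = avg k \<omega> - lam *\<^sub>R mdir k (avg k \<omega>)" for \<omega>
  define p where "p i \<omega> = v k i \<omega> - lam *\<^sub>R dir k i (v k i \<omega>) - ctr \<omega>" for i \<omega>
  have FG_borel: "mdir k \<in> borel_measurable borel"
    using c mu by (intro borel_measurable_continuous_onI step_dir_continuous smooth_F smooth_G) auto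
  have pm: "p i \<in> borel_measurable (past (hist k))" if i: "i < n" for i
  proof -
    note [measurable] = state_measurable[OF kK i] avg_measurable[OF kK]
      measurable_compose[OF state_measurable[OF kK i] dir_borel[OF i]] measurable_compose[OF avg_measurable[OF kK] FG_borel]
    show ?thesis unfolding p_def[abs_def] ctr_def by measurable
  qed
  have sqF: "square_integrable M (\<lambda>\<omega>. mdir k (avg k \<omega>))"
    unfolding mean_dir[symmetric]
    by (intro square_integrable_mean finite_measure_axioms dir_square_integrable avg_square_integrable kK)
  have psq: "square_integrable M (p i)" if i: "i < n" for i
    unfolding p_def[abs_def] ctr_def
    by (intro square_integrable_diff square_integrable_scaleR dir_square_integrable i state_square_integrable kK avg_square_integrable sqF)
  have p_bound: "mean n (\<lambda>i. (norm (p i \<omega>))\<^sup>2) \<le> (1 + \<kappa> / 10) * (1 + lam * lip c (\<mu> k))\<^sup>2 * cons_err k \<omega> + (1 + 10 / \<kappa>) * lam\<^sup>2 * dissim_bound" for \<omega>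
  proof -
    define d where "d i = dir k i (avg k \<omega>) - mdir k (avg k \<omega>)" for i
    have "(norm (p i \<omega>))\<^sup>2 \<le> (1 + \<kappa> / 10) * ((1 + lam * lip c (\<mu> k))\<^sup>2 * (norm (v k i \<omega> - avg k \<omega>))\<^sup>2)
        + (1 + 10 / \<kappa>) * (lam\<^sup>2 * (norm (d i))\<^sup>2)" if i: "i < n" for i
    proof -
      let ?a = "(v k i \<omega> - avg k \<omega>) - lam *\<^sub>R (dir k i (v k i \<omega>) - dir k i (avg k \<omega>))" and ?b = "- lam *\<^sub>R d i"
      have "p i \<omega> = ?a + ?b" by (simp add: p_def ctr_def d_def algebra_simps)
      then have "(norm (p i \<omega>))\<^sup>2 \<le> (1 + \<kappa> / 10) * (norm ?a)\<^sup>2 + (1 + 1 / (\<kappa> / 10)) * (norm ?b)\<^sup>2"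
        using norm_add_squared_le_weighted[of "\<kappa> / 10" ?a ?b] \<kappa> by simp
      also have "(1 + \<kappa> / 10) * (norm ?a)\<^sup>2 \<le> (1 + \<kappa> / 10) * ((1 + lam * lip c (\<mu> k))\<^sup>2 * (norm (v k i \<omega> - avg k \<omega>))\<^sup>2)"
      proof (rule mult_left_mono)
        have "norm ?a \<le> norm (v k i \<omega> - avg k \<omega>) + lam * norm (dir k i (v k i \<omega>) - dir k i (avg k \<omega>))"
          using norm_triangle_ineq4[of "v k i \<omega> - avg k \<omega>" "lam *\<^sub>R (dir k i (v k i \<omega>) - dir k i (avg k \<omega>))"] lam by simp
        also have "\<dots> \<le> norm (v k i \<omega> - avg k \<omega>) + lam * (lip c (\<mu> k) * norm (v k i \<omega> - avg k \<omega>))"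
          using lam by (intro add_left_mono mult_left_mono dir_lipschitz i) auto
        finally have "norm ?a \<le> (1 + lam * lip c (\<mu> k)) * norm (v k i \<omega> - avg k \<omega>)" by (simp add: algebra_simps)
        then have "(norm ?a)\<^sup>2 \<le> ((1 + lam * lip c (\<mu> k)) * norm (v k i \<omega> - avg k \<omega>))\<^sup>2" by (rule power_mono) simp
        then show "(norm ?a)\<^sup>2 \<le> (1 + lam * lip c (\<mu> k))\<^sup>2 * (norm (v k i \<omega> - avg k \<omega>))\<^sup>2" by (simp only: power_mult_distrib)
      qed (use \<kappa> in simp)
      also have "(norm ?b)\<^sup>2 = lam\<^sup>2 * (norm (d i))\<^sup>2" by (simp add: power_mult_distrib)
      finally show ?thesis by simp
    qed
    then have "mean n (\<lambda>i. (norm (p i \<omega>))\<^sup>2) \<le> mean n (\<lambda>i. (1 + \<kappa> / 10) * ((1 + lam * lip c (\<mu> k))\<^sup>2 * (norm (v k i \<omega> - avg k \<omega>))\<^sup>2)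
        + (1 + 10 / \<kappa>) * (lam\<^sup>2 * (norm (d i))\<^sup>2))"
      by (rule mean_mono)
    also have "\<dots> = (1 + \<kappa> / 10) * ((1 + lam * lip c (\<mu> k))\<^sup>2 * cons_err k \<omega>) + (1 + 10 / \<kappa>) * (lam\<^sup>2 * mean n (\<lambda>i. (norm (d i))\<^sup>2))"
      by (simp only: mean_add[symmetric] mean_cmult cons_err_def)
    also have "\<dots> \<le> (1 + \<kappa> / 10) * ((1 + lam * lip c (\<mu> k))\<^sup>2 * cons_err k \<omega>) + (1 + 10 / \<kappa>) * (lam\<^sup>2 * dissim_bound)"
      using dissimilarity[of k "avg k \<omega>"] \<kappa> unfolding d_def by (intro add_left_mono mult_left_mono) auto
    finally show ?thesis by (simp add: mult.assoc)
  qed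
  have pointwise: "cons_err (Suc k) \<omega> \<le> \<rho>\<^sup>2 * mean n (\<lambda>i. (norm (p i \<omega> - lam *\<^sub>R noise k i \<omega>))\<^sup>2)" if \<omega>: "\<omega> \<in> space M" for \<omega>
  proof -
    define u where "u j = v k j \<omega> - lam *\<^sub>R (dir k j (v k j \<omega>) + noise k j \<omega>)" for j
    have vS: "v (Suc k) i \<omega> = gossip n W i u" if "i < n" for i
      unfolding u_def by (rule step_noise[OF k that \<omega>])
    then have "avg (Suc k) \<omega> = mean n (\<lambda>i. gossip n W i u)"
      unfolding avg_def by (rule mean_cong)
    then have aS: "avg (Suc k) \<omega> = mean n u" using mean_gossip[OF topology] by simp
    have "cons_err (Suc k) \<omega> = mean n (\<lambda>i. (norm (gossip n W i u - mean n u))\<^sup>2)"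
      unfolding cons_err_def aS by (rule mean_cong) (simp add: vS)
    also have "\<dots> \<le> \<rho>\<^sup>2 * mean n (\<lambda>i. (norm (u i - mean n u))\<^sup>2)" by (rule gossip_contraction[OF topology n])
    also have "\<dots> \<le> \<rho>\<^sup>2 * mean n (\<lambda>i. (norm (u i - ctr \<omega>))\<^sup>2)"
      using mean_deviation[OF n, of u "ctr \<omega>"] by (intro mult_left_mono) auto
    also have "mean n (\<lambda>i. (norm (u i - ctr \<omega>))\<^sup>2) = mean n (\<lambda>i. (norm (p i \<omega> - lam *\<^sub>R noise k i \<omega>))\<^sup>2)"
      by (rule mean_cong) (simp add: u_def p_def algebra_simps)
    finally show ?thesis .
  qed
  note I = expectation_norm_diff[OF k _ pm psq]
  have "mean_cons (Suc k) \<le> (\<integral>\<omega>. \<rho>\<^sup>2 * mean n (\<lambda>i. (norm (p i \<omega> - lam *\<^sub>R noise k i \<omega>))\<^sup>2) \<partial>M)"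
    using k by (intro integral_mono cons_err_integrable pointwise integrable_mult_right integral_mean(1) I(1)) auto
  also have "\<dots> = \<rho>\<^sup>2 * mean n (\<lambda>i. \<integral>\<omega>. (norm (p i \<omega> - lam *\<^sub>R noise k i \<omega>))\<^sup>2 \<partial>M)"
    using integral_mean(2)[of n M "\<lambda>i \<omega>. (norm (p i \<omega> - lam *\<^sub>R noise k i \<omega>))\<^sup>2"] I(1) by simp
  also have "\<dots> \<le> \<rho>\<^sup>2 * mean n (\<lambda>i. (\<integral>\<omega>. (norm (p i \<omega>))\<^sup>2 \<partial>M) + lam\<^sup>2 * noise_bound)"
    by (intro mult_left_mono mean_mono I(2)) auto
  also have "\<dots> = \<rho>\<^sup>2 * ((\<integral>\<omega>. mean n (\<lambda>i. (norm (p i \<omega>))\<^sup>2) \<partial>M) + lam\<^sup>2 * noise_bound)"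
    using integral_mean(2)[of n M "\<lambda>i \<omega>. (norm (p i \<omega>))\<^sup>2"] square_integrable_norm[OF psq]
    by (simp add: mean_add[symmetric] mean_const[OF n])
  also have "\<dots> \<le> \<rho>\<^sup>2 * ((\<integral>\<omega>. (1 + \<kappa> / 10) * (1 + lam * lip c (\<mu> k))\<^sup>2 * cons_err k \<omega> + (1 + 10 / \<kappa>) * lam\<^sup>2 * dissim_bound \<partial>M) + lam\<^sup>2 * noise_bound)"
    using square_integrable_norm[OF psq] cons_err_integrable[OF kK] p_bound
    by (intro mult_left_mono add_right_mono integral_mono integral_mean(1)) auto
  also have "(\<integral>\<omega>. (1 + \<kappa> / 10) * (1 + lam * lip c (\<mu> k))\<^sup>2 * cons_err k \<omega> + (1 + 10 / \<kappa>) * lam\<^sup>2 * dissim_bound \<partial>M)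
      = (1 + \<kappa> / 10) * (1 + lam * lip c (\<mu> k))\<^sup>2 * mean_cons k + (1 + 10 / \<kappa>) * lam\<^sup>2 * dissim_bound"
    using cons_err_integrable[OF kK] prob_space by simp
  finally show ?thesis .
qed

text \<open>
  Averaging gains the factor \<open>1 / n\<close>: for two agents, the noise of one is measurable with respect to
  a set of samples that does not contain the current ones of the other.
\<close>

lemma expectation_mean_noise:
  assumes k: "k < K"
  shows "square_integrable M (\<lambda>\<omega>. mean n (\<lambda>i. noise k i \<omega>))"
    and "(\<integral>\<omega>. (norm (mean n (\<lambda>i. noise k i \<omega>)))\<^sup>2 \<partial>M) \<le> noise_bound / real n"
    and "Y \<in> borel_measurable (past (hist k)) \<Longrightarrow> square_integrable M Y \<Longrightarrow>
      (\<integral>\<omega>. inner (Y \<omega>) (mean n (\<lambda>i. noise k i \<omega>)) \<partial>M) = 0"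
proof -
  note N = noise_variance[OF k]
  have H: "hist k \<subseteq> samples" using k by (intro hist_subset) auto
  show sq: "square_integrable M (\<lambda>\<omega>. mean n (\<lambda>i. noise k i \<omega>))"
    by (intro square_integrable_mean finite_measure_axioms N(1))
  have cross: "(\<integral>\<omega>. inner (noise k j \<omega>) (noise k i \<omega>) \<partial>M) = 0" if ij: "i < n" "j < n" "i \<noteq> j" for i j
  proof -
    let ?J = "hist k \<union> {Inl (k, j), Inr (k, j)}"
    have J: "hist k \<subseteq> ?J" "?J \<subseteq> samples" "Inl (k, i) \<notin> ?J" "Inr (k, i) \<notin> ?J"
      using H k ij fresh_not_hist by auto
    show ?thesis
    proof (rule noise_orthogonal[OF k ij(1) J _ N(1)[OF ij(2)]])
      show "noise k j \<in> borel_measurable (past ?J)"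
        using k ij by (intro noise_measurable[OF k ij(2) J(1,2)] state_measurable) auto
    qed
  qed
  have "(\<integral>\<omega>. (norm (mean n (\<lambda>i. noise k i \<omega>)))\<^sup>2 \<partial>M)
      = (\<integral>\<omega>. (1 / real n)\<^sup>2 * (\<Sum>i<n. \<Sum>j<n. inner (noise k j \<omega>) (noise k i \<omega>)) \<partial>M)"
  proof -
    have "(norm (mean n (\<lambda>i. noise k i \<omega>)))\<^sup>2 = (1 / real n)\<^sup>2 * inner (\<Sum>j<n. noise k j \<omega>) (\<Sum>i<n. noise k i \<omega>)" for \<omega>
      unfolding mean_def power2_norm_eq_inner by (simp add: power2_eq_square)
    then show ?thesis unfolding inner_sum_right unfolding inner_sum_left by simp
  qed
  also have "\<dots> = (1 / real n)\<^sup>2 * (\<Sum>i<n. \<Sum>j<n. \<integral>\<omega>. inner (noise k j \<omega>) (noise k i \<omega>) \<partial>M)"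
  proof -
    have si: "integrable M (\<lambda>\<omega>. inner (noise k j \<omega>) (noise k i \<omega>))" if "i < n" "j < n" for i j
      using square_integrable_inner[OF N(1) N(1)] that by blast
    have "(\<integral>\<omega>. (\<Sum>i<n. \<Sum>j<n. inner (noise k j \<omega>) (noise k i \<omega>)) \<partial>M)
        = (\<Sum>i<n. \<integral>\<omega>. (\<Sum>j<n. inner (noise k j \<omega>) (noise k i \<omega>)) \<partial>M)"
      by (rule Bochner_Integration.integral_sum) (auto intro!: Bochner_Integration.integrable_sum si)
    also have "\<dots> = (\<Sum>i<n. \<Sum>j<n. \<integral>\<omega>. inner (noise k j \<omega>) (noise k i \<omega>) \<partial>M)"
      by (intro sum.cong refl Bochner_Integration.integral_sum) (auto intro!: si)
    finally show ?thesis by simp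
  qed
  also have "(\<Sum>i<n. \<Sum>j<n. \<integral>\<omega>. inner (noise k j \<omega>) (noise k i \<omega>) \<partial>M)
      = (\<Sum>i<n. \<Sum>j<n. if j = i then (\<integral>\<omega>. (norm (noise k i \<omega>))\<^sup>2 \<partial>M) else 0)"
    by (intro sum.cong refl) (auto simp: cross power2_norm_eq_inner)
  also have "\<dots> = (\<Sum>i<n. \<integral>\<omega>. (norm (noise k i \<omega>))\<^sup>2 \<partial>M)" by simp
  also have "(1 / real n)\<^sup>2 * (\<Sum>i<n. \<integral>\<omega>. (norm (noise k i \<omega>))\<^sup>2 \<partial>M) \<le> (1 / real n)\<^sup>2 * (\<Sum>i<n. noise_bound)"
    by (intro mult_left_mono sum_mono N(2)) auto
  also have "\<dots> = noise_bound / real n" using n by (simp add: power2_eq_square)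
  finally show "(\<integral>\<omega>. (norm (mean n (\<lambda>i. noise k i \<omega>)))\<^sup>2 \<partial>M) \<le> noise_bound / real n" .
  show "(\<integral>\<omega>. inner (Y \<omega>) (mean n (\<lambda>i. noise k i \<omega>)) \<partial>M) = 0"
    if Y: "Y \<in> borel_measurable (past (hist k))" "square_integrable M Y"
  proof -
    have "(\<integral>\<omega>. inner (Y \<omega>) (mean n (\<lambda>i. noise k i \<omega>)) \<partial>M) = mean n (\<lambda>i. \<integral>\<omega>. inner (Y \<omega>) (noise k i \<omega>) \<partial>M)"
      unfolding inner_mean_right by (rule integral_mean(2)) (rule square_integrable_inner[OF Y(2) N(1)])
    also have "\<dots> = mean n (\<lambda>i. 0)"
      by (rule mean_cong) (rule noise_orthogonal[OF k _ order_refl H fresh_not_hist Y])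
    finally show ?thesis by (simp add: mean_def)
  qed
qed

lemma avg_Suc:
  assumes k: "k < K" and \<omega>: "\<omega> \<in> space M"
  shows "avg (Suc k) \<omega> = avg k \<omega> - lam *\<^sub>R (mean n (\<lambda>i. dir k i (v k i \<omega>)) + mean n (\<lambda>i. noise k i \<omega>))"
proof -
  have "avg (Suc k) \<omega> = mean n (\<lambda>i. gossip n W i (\<lambda>j. v k j \<omega> - lam *\<^sub>R (dir k j (v k j \<omega>) + noise k j \<omega>)))"
    unfolding avg_def by (rule mean_cong) (rule step_noise[OF k _ \<omega>])
  also have "\<dots> = mean n (\<lambda>j. v k j \<omega> - lam *\<^sub>R (dir k j (v k j \<omega>) + noise k j \<omega>))"
    by (rule mean_gossip[OF topology])
  finally show ?thesis by (simp add: avg_def mean_diff[symmetric] mean_add[symmetric] mean_scaleR)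
qed

definition curv :: real where "curv = 17 / 2 * r + \<mu>0 * L1 / 2"

definition rel :: "nat \<Rightarrow> real" where "rel k = lam * c * \<mu> k * L1"

lemma avg_energy_integrable: "k \<le> K \<Longrightarrow> 0 \<le> m \<Longrightarrow> integrable M (\<lambda>\<omega>. energy m (avg k \<omega>))"
  by (rule energy_integrable[OF finite_measure_axioms avg_square_integrable])

lemma gradPsi_integrable:
  assumes k: "k \<le> K" and m: "0 \<le> m"
  shows "integrable M (\<lambda>\<omega>. (norm (gradPsi m (fst (avg k \<omega>))))\<^sup>2)"
proof (rule Bochner_Integration.integrable_bound)
  show "integrable M (\<lambda>\<omega>. 12 * (34 * r + 2 * m * L1) * energy m (avg k \<omega>))"
    by (intro integrable_mult_right avg_energy_integrable k m)
  have [measurable]: "avg k \<in> borel_measurable M" using avg_square_integrable[OF k] by (simp add: square_integrable_def)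
  have "(\<lambda>p. (norm (gradPsi m (fst p)))\<^sup>2) \<in> borel_measurable (borel :: (('x \<times> 'y) \<times> 'y) measure)"
    by (intro borel_measurable_continuous_onI continuous_on_compose2[OF gradPsi_continuous] continuous_intros) auto
  then show "(\<lambda>\<omega>. (norm (gradPsi m (fst (avg k \<omega>))))\<^sup>2) \<in> borel_measurable M" by measurable
  show "AE \<omega> in M. norm ((norm (gradPsi m (fst (avg k \<omega>))))\<^sup>2) \<le> norm (12 * (34 * r + 2 * m * L1) * energy m (avg k \<omega>))"
    by (rule AE_I2) (simp only: real_norm_def abs_power2 order_trans[OF gradPsi_squared_le[OF m] abs_ge_self])
qed

text \<open>
  The energy has a quadratic upper bound around the averaged iterate, so the noise enters only
  through its second moment; its linear contribution has mean zero.
\<close>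

lemma energy_step:
  assumes k: "k < K"
  shows "mean_energy (Suc k)
    \<le> (1 + (if rel k \<le> 1 / 20 then 0 else lam * (3 / 2 * rel k * (34 * r + 2 * \<mu> k * L1)))) * mean_energy k
       - lam * (c / 10 * mean_grad k)
       + lam * ((4 / c + 8 + 3 / 2 * rel k / c) * ((lip c (\<mu> k))\<^sup>2 * mean_cons k))
       + lam\<^sup>2 * curv * noise_bound / real n"
proof -
  have kK: "k \<le> K" "Suc k \<le> K" using k by simp_all
  define m where "m = \<mu> k"
  have m: "0 \<le> m" using mu by (simp add: m_def)
  define D where "D \<omega> = mean n (\<lambda>i. dir k i (v k i \<omega>))" for \<omega>
  define N where "N \<omega> = mean n (\<lambda>i. noise k i \<omega>)" for \<omega>
  define Az where "Az = 17 / 2 * r + m * L1 / 2"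
  define At where "At = 7 / 8 * r"
  have A: "0 \<le> At" "At \<le> Az" "Az \<le> curv"
    using r_pos m L1_nonneg mu(2)[of k] by (auto simp: Az_def At_def curv_def m_def mult_right_mono)
  \<comment> \<open>The terms of the quadratic upper bound that are linear in the noise.\<close>
  define Y where "Y \<omega> = (2 * lam\<^sup>2) *\<^sub>R (Az *\<^sub>R fst (D \<omega>), At *\<^sub>R snd (D \<omega>)) - lam *\<^sub>R gradE m (avg k \<omega>)" for \<omega>
  have Dm: "D \<in> borel_measurable (past (hist k))"
    unfolding D_def[abs_def] mean_def
    by (intro borel_measurable_scaleR borel_measurable_sum measurable_const measurable_compose[OF state_measurable[OF kK(1)] dir_borel]) auto
  have Dsq: "square_integrable M D"
    unfolding D_def[abs_def] by (intro square_integrable_mean finite_measure_axioms dir_square_integrable state_square_integrable kK)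
  have gm: "(\<lambda>\<omega>. gradE m (avg k \<omega>)) \<in> borel_measurable (past (hist k))"
    by (rule measurable_compose[OF avg_measurable[OF kK(1)] borel_measurable_continuous_onI[OF gradE_continuous]])
  have gsq: "square_integrable M (\<lambda>\<omega>. gradE m (avg k \<omega>))"
    unfolding square_integrable_def
  proof
    show gM: "(\<lambda>\<omega>. gradE m (avg k \<omega>)) \<in> borel_measurable M" by (rule past_measurable[OF hist_subset[OF kK(1)] gm])
    show "integrable M (\<lambda>\<omega>. (norm (gradE m (avg k \<omega>)))\<^sup>2)"
      by (rule Bochner_Integration.integrable_bound[OF integrable_mult_right[OF avg_energy_integrable[OF kK(1) m], of "34 * r + 2 * m * L1"]])
         (use gM gradE_squared_le[OF m] energy_nonneg[OF m] r_pos m L1_nonneg in \<open>auto intro!: AE_I2 simp: abs_mult\<close>)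
  qed
  have Pm: "(\<lambda>\<omega>. (Az *\<^sub>R fst (D \<omega>), At *\<^sub>R snd (D \<omega>))) \<in> borel_measurable (past (hist k))"
    by (rule measurable_compose[OF Dm, of "\<lambda>p. (Az *\<^sub>R fst p, At *\<^sub>R snd p)"])
       (intro borel_measurable_continuous_onI continuous_intros)
  have Psq: "square_integrable M (\<lambda>\<omega>. (Az *\<^sub>R fst (D \<omega>), At *\<^sub>R snd (D \<omega>)))"
  proof (rule square_integrable_bound[OF Dsq Dsq past_measurable[OF hist_subset[OF kK(1)] Pm], of Az At])
    fix \<omega>
    have "norm (Az *\<^sub>R fst (D \<omega>), At *\<^sub>R snd (D \<omega>)) \<le> norm (Az *\<^sub>R fst (D \<omega>)) + norm (At *\<^sub>R snd (D \<omega>))" by (rule norm_Pair_le)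
    also have "\<dots> \<le> Az * norm (D \<omega>) + At * norm (D \<omega>)"
      using A by (auto intro!: add_mono mult_left_mono norm_fst_le_norm norm_snd_le_norm)
    finally show "norm (Az *\<^sub>R fst (D \<omega>), At *\<^sub>R snd (D \<omega>)) \<le> Az * norm (D \<omega>) + At * norm (D \<omega>)" .
  qed
  have Ym: "Y \<in> borel_measurable (past (hist k))" unfolding Y_def[abs_def] using Pm gm by measurable
  have Ysq: "square_integrable M Y" unfolding Y_def[abs_def] by (intro square_integrable_diff square_integrable_scaleR Psq gsq)
  note Nf = expectation_mean_noise[OF k, folded N_def]
  let ?b = "if rel k \<le> 1 / 20 then 0 else lam * (3 / 2 * rel k * (34 * r + 2 * m * L1))"
  let ?h = "(4 / c + 8 + 3 / 2 * rel k / c) * (lip c m)\<^sup>2"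
  have h0: "0 \<le> 4 / c + 8 + 3 / 2 * rel k / c" using c lam mu(1)[of k] L1_nonneg by (auto simp: rel_def)
  have point: "energy (\<mu> (Suc k)) (avg (Suc k) \<omega>) \<le> (1 + ?b) * energy m (avg k \<omega>) - lam * (c / 10 * (norm (gradPsi m (fst (avg k \<omega>))))\<^sup>2)
      + lam * (?h * cons_err k \<omega>) + inner (Y \<omega>) (N \<omega>) + lam\<^sup>2 * curv * (norm (N \<omega>))\<^sup>2" if \<omega>: "\<omega> \<in> space M" for \<omega>
  proof -
    let ?w = "- lam *\<^sub>R (D \<omega> + N \<omega>)"
    define \<epsilon> where "\<epsilon> = D \<omega> - step_dir \<gamma> c m F G (avg k \<omega>)"
    have "energy (\<mu> (Suc k)) (avg (Suc k) \<omega>) \<le> energy m (avg (Suc k) \<omega>)"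
      unfolding m_def by (rule energy_mono[OF mu(3)])
    also have "\<dots> \<le> energy m (avg k \<omega>) + inner (gradE m (avg k \<omega>)) ?w + Az * (norm (fst ?w))\<^sup>2 + At * (norm (snd ?w))\<^sup>2"
    proof -
      have "avg (Suc k) \<omega> = avg k \<omega> + ?w" using avg_Suc[OF k \<omega>] by (simp add: D_def N_def)
      then show ?thesis unfolding Az_def At_def by (simp only: energy_upper[OF m])
    qed
    also have "\<dots> = (energy m (avg k \<omega>) - lam * inner (gradE m (avg k \<omega>)) (D \<omega>) + lam\<^sup>2 * (Az * (norm (fst (D \<omega>)))\<^sup>2 + At * (norm (snd (D \<omega>)))\<^sup>2))
        + inner (Y \<omega>) (N \<omega>) + lam\<^sup>2 * (Az * (norm (fst (N \<omega>)))\<^sup>2 + At * (norm (snd (N \<omega>)))\<^sup>2)"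
    proof -
      have sq: "(norm (- lam *\<^sub>R (a + b)))\<^sup>2 = lam\<^sup>2 * ((norm a)\<^sup>2 + 2 * inner a b + (norm b)\<^sup>2)" for a b :: "'b::real_inner"
        unfolding power2_norm_eq_inner
        by (simp add: inner_add_left inner_add_right inner_commute power2_eq_square algebra_simps)
      have "(norm (fst ?w))\<^sup>2 = lam\<^sup>2 * ((norm (fst (D \<omega>)))\<^sup>2 + 2 * inner (fst (D \<omega>)) (fst (N \<omega>)) + (norm (fst (N \<omega>)))\<^sup>2)"
        "(norm (snd ?w))\<^sup>2 = lam\<^sup>2 * ((norm (snd (D \<omega>)))\<^sup>2 + 2 * inner (snd (D \<omega>)) (snd (N \<omega>)) + (norm (snd (N \<omega>)))\<^sup>2)"
        unfolding fst_scaleR snd_scaleR fst_add snd_add by (rule sq)+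
      moreover have "inner (Y \<omega>) (N \<omega>) = 2 * lam\<^sup>2 * (Az * inner (fst (D \<omega>)) (fst (N \<omega>)) + At * inner (snd (D \<omega>)) (snd (N \<omega>)))
          - lam * inner (gradE m (avg k \<omega>)) (N \<omega>)"
        unfolding Y_def by (simp add: inner_prod_def inner_diff_left inner_add_left algebra_simps)
      moreover have "inner (gradE m (avg k \<omega>)) ?w = - lam * inner (gradE m (avg k \<omega>)) (D \<omega>) - lam * inner (gradE m (avg k \<omega>)) (N \<omega>)"
        by (simp add: inner_add_right algebra_simps)
      ultimately show ?thesis by (simp add: algebra_simps)
    qed
    also have "energy m (avg k \<omega>) - lam * inner (gradE m (avg k \<omega>)) (D \<omega>) + lam\<^sup>2 * (Az * (norm (fst (D \<omega>)))\<^sup>2 + At * (norm (snd (D \<omega>)))\<^sup>2)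
        \<le> (1 + ?b) * energy m (avg k \<omega>) - lam * (c / 10 * (norm (gradPsi m (fst (avg k \<omega>))))\<^sup>2) + lam * ((4 / c + 8 + 3 / 2 * rel k / c) * (norm \<epsilon>)\<^sup>2)"
    proof -
      have "lam * r \<le> 49 / 192" using lam rho by simp
      then show ?thesis
        unfolding Az_def At_def using lam
        by (intro energy_decrease[OF c _ _ m]) (auto simp: \<epsilon>_def rel_def m_def)
    qed
    also have "lam * ((4 / c + 8 + 3 / 2 * rel k / c) * (norm \<epsilon>)\<^sup>2) \<le> lam * (?h * cons_err k \<omega>)"
    proof -
      have "(norm \<epsilon>)\<^sup>2 \<le> (lip c m)\<^sup>2 * cons_err k \<omega>"
      proof -
        have "\<epsilon> = mean n (\<lambda>i. dir k i (v k i \<omega>) - dir k i (avg k \<omega>))"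
          unfolding \<epsilon>_def D_def m_def mean_dir[symmetric] mean_diff ..
        then have "(norm \<epsilon>)\<^sup>2 \<le> mean n (\<lambda>i. (norm (dir k i (v k i \<omega>) - dir k i (avg k \<omega>)))\<^sup>2)"
          by (simp only: norm_mean_squared_le)
        also have "\<dots> \<le> mean n (\<lambda>i. (lip c m)\<^sup>2 * (norm (v k i \<omega> - avg k \<omega>))\<^sup>2)"
        proof (rule mean_mono)
          fix i assume "i < n"
          then show "(norm (dir k i (v k i \<omega>) - dir k i (avg k \<omega>)))\<^sup>2 \<le> (lip c m)\<^sup>2 * (norm (v k i \<omega> - avg k \<omega>))\<^sup>2"
            unfolding power_mult_distrib[symmetric] m_def by (intro power_mono dir_lipschitz) auto
        qed
        finally show ?thesis by (simp only: mean_cmult cons_err_def)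
      qed
      from mult_left_mono[OF this h0] show ?thesis using lam by (simp add: mult.assoc)
    qed
    also have "lam\<^sup>2 * (Az * (norm (fst (N \<omega>)))\<^sup>2 + At * (norm (snd (N \<omega>)))\<^sup>2) \<le> lam\<^sup>2 * curv * (norm (N \<omega>))\<^sup>2"
    proof -
      have "Az * (norm (fst (N \<omega>)))\<^sup>2 + At * (norm (snd (N \<omega>)))\<^sup>2 \<le> curv * (norm (fst (N \<omega>)))\<^sup>2 + curv * (norm (snd (N \<omega>)))\<^sup>2"
        using A by (intro add_mono mult_right_mono) auto
      also have "\<dots> = curv * (norm (N \<omega>))\<^sup>2" by (simp add: norm_prod_squared[of "N \<omega>"] distrib_left)
      finally have "lam\<^sup>2 * (Az * (norm (fst (N \<omega>)))\<^sup>2 + At * (norm (snd (N \<omega>)))\<^sup>2) \<le> lam\<^sup>2 * (curv * (norm (N \<omega>))\<^sup>2)"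
        by (rule mult_left_mono) simp
      then show ?thesis by (simp only: mult.assoc)
    qed
    finally show ?thesis by simp
  qed
  note ints = avg_energy_integrable[OF kK(1) m] gradPsi_integrable[OF kK(1) m] cons_err_integrable[OF kK(1)]
    square_integrable_inner[OF Ysq Nf(1)] square_integrable_norm[OF Nf(1)]
  have "mean_energy (Suc k) \<le> (\<integral>\<omega>. (1 + ?b) * energy m (avg k \<omega>) - lam * (c / 10 * (norm (gradPsi m (fst (avg k \<omega>))))\<^sup>2)
      + lam * (?h * cons_err k \<omega>) + inner (Y \<omega>) (N \<omega>) + lam\<^sup>2 * curv * (norm (N \<omega>))\<^sup>2 \<partial>M)"
    by (intro integral_mono point avg_energy_integrable kK(2) mu(1) Bochner_Integration.integrable_add Bochner_Integration.integrable_diff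
        integrable_mult_right ints)
  also have "\<dots> = (1 + ?b) * (\<integral>\<omega>. energy m (avg k \<omega>) \<partial>M) - lam * (c / 10 * (\<integral>\<omega>. (norm (gradPsi m (fst (avg k \<omega>))))\<^sup>2 \<partial>M))
      + lam * (?h * mean_cons k) + lam\<^sup>2 * curv * (\<integral>\<omega>. (norm (N \<omega>))\<^sup>2 \<partial>M)"
    using ints Nf(3)[OF Ym Ysq] by (simp del: times_divide_eq_left times_divide_eq_right)
  also have "lam\<^sup>2 * curv * (\<integral>\<omega>. (norm (N \<omega>))\<^sup>2 \<partial>M) \<le> lam\<^sup>2 * curv * (noise_bound / real n)"
    using Nf(2) A by (intro mult_left_mono) auto
  finally show ?thesis unfolding m_def by (simp add: mult.assoc split del: if_split)
qed

end

section \<open>The bound on the average squared gradient\<close>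

lemma fst_mean: "fst (mean n u) = mean n (\<lambda>i. fst (u i))" and snd_mean: "snd (mean n u) = mean n (\<lambda>i. snd (u i))"
  by (simp_all add: mean_def fst_sum snd_sum)

context dsbo_run begin

text \<open>
  The strength with which the disagreement enters the energy recursion, uniformly in \<open>k\<close>.
\<close>

definition coup :: real where "coup = (4 / c + 8 + 3 / 2 * \<mu>0 * L1 / r) * (lip c \<mu>0)\<^sup>2"

definition growth :: real where
  "growth = 1 / r * (3 / 2 * (c * \<mu>0 * L1 / r) * (34 * r + 2 * \<mu>0 * L1)) + 11 / 10 * (1 + lip c \<mu>0 / r)\<^sup>2"

text \<open>
  The recursions may grow only while the curvature of \<open>\<mu> k * F\<close> is not dominated by that of the
  proximal term.
\<close>

definition early :: "nat \<Rightarrow> real" where "early k = (if \<mu> k * L1 \<le> r then 0 else growth)"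

lemma kappa: "0 < \<kappa>" "\<kappa> \<le> 1" using rho by simp_all

lemma lam_le: "lam \<le> \<kappa> / r" "lam \<le> 1 / r"
proof -
  have "49 / 192 * \<kappa> \<le> 1 * \<kappa>" using kappa by (intro mult_right_mono) auto
  then have "lam * r \<le> \<kappa>" using lam(2) by simp
  then show 1: "lam \<le> \<kappa> / r" using r_pos by (simp add: pos_le_divide_eq)
  show "lam \<le> 1 / r" by (rule order_trans[OF 1]) (use kappa r_pos in \<open>simp add: divide_right_mono\<close>)
qed

lemma lam_r: "3 / 32 * (lam * r) \<le> 1 / 20" "3 / 32 * (lam * r) + 9 / 4 * (lam * r) \<le> 3 / 5 * \<kappa>"
proof -
  define q where "q = lam * r"
  have "q \<le> 49 / 192 * \<kappa>" using lam(2) by (simp add: q_def)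
  then show "3 / 32 * (lam * r) \<le> 1 / 20" and "3 / 32 * (lam * r) + 9 / 4 * (lam * r) \<le> 3 / 5 * \<kappa>"
    using kappa unfolding q_def[symmetric] by (simp_all add: field_simps)
qed

lemma lip_le: "lip c (\<mu> k) \<le> lip c \<mu>0"
  using mu(2)[of k] c L1_nonneg by (simp add: lip_def mult_right_mono)

lemma rel_bounds: "0 \<le> rel k" "rel k \<le> c * \<mu>0 * L1 / r"
proof -
  show "0 \<le> rel k" using lam c mu(1)[of k] L1_nonneg by (simp add: rel_def)
  have "lam * (c * \<mu> k * L1) \<le> 1 / r * (c * \<mu>0 * L1)"
    using lam_le(2) lam c mu(1,2)[of k] L1_nonneg r_pos
    by (intro mult_mono mult_right_mono mult_left_mono) auto
  then show "rel k \<le> c * \<mu>0 * L1 / r" by (simp add: rel_def mult_ac)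
qed

lemma lip_pos: "0 < lip c \<mu>0"
  using c mu0 L1_nonneg r_pos by (auto simp: lip_def intro!: add_nonneg_pos)

lemma coup_pos: "0 < coup"
proof -
  have "0 < 4 / c + 8 + 3 / 2 * \<mu>0 * L1 / r"
    using c mu0 L1_nonneg r_pos by (intro add_pos_nonneg) auto
  then show ?thesis using lip_pos by (simp add: coup_def)
qed

lemma growth_parts:
  "0 \<le> 1 / r * (3 / 2 * (c * \<mu>0 * L1 / r) * (34 * r + 2 * \<mu>0 * L1))" "0 \<le> 11 / 10 * (1 + lip c \<mu>0 / r)\<^sup>2"
  using c mu0 L1_nonneg r_pos by simp_all

lemma growth_nonneg: "0 \<le> growth" unfolding growth_def using growth_parts by (rule add_nonneg_nonneg)

lemma energy_recursion:
  assumes k: "k < K"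
  shows "mean_energy (Suc k)
    \<le> (1 + early k) * mean_energy k
       - lam * c / 10 * mean_grad k
       + lam * coup * mean_cons k + lam\<^sup>2 * curv * noise_bound / real n"
proof -
  have E0: "0 \<le> mean_energy k" by (intro Bochner_Integration.integral_nonneg energy_nonneg mu)
  have s0: "0 \<le> mean_cons k" by (intro Bochner_Integration.integral_nonneg) (simp add: cons_err_def mean_nonneg)
  have b: "(if rel k \<le> 1 / 20 then 0 else lam * (3 / 2 * rel k * (34 * r + 2 * \<mu> k * L1))) \<le> early k"
  proof (cases "\<mu> k * L1 \<le> r")
    case True
    have "rel k = c * (lam * (\<mu> k * L1))" by (simp add: rel_def)
    also have "\<dots> \<le> 3 / 32 * (lam * r)" using True c lam mu(1)[of k] L1_nonneg by (intro mult_mono mult_left_mono) auto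
    also have "\<dots> \<le> 1 / 20" by (rule lam_r)
    finally show ?thesis by (simp add: early_def True)
  next
    case False
    have "lam * (3 / 2 * rel k * (34 * r + 2 * \<mu> k * L1)) \<le> 1 / r * (3 / 2 * (c * \<mu>0 * L1 / r) * (34 * r + 2 * \<mu>0 * L1))"
      using rel_bounds[of k] lam lam_le(2) mu(1,2)[of k] L1_nonneg r_pos
      by (intro mult_mono add_mono order_refl mult_nonneg_nonneg add_nonneg_nonneg) auto
    also have "\<dots> \<le> growth" unfolding growth_def using growth_parts(2) by simp
    finally show ?thesis using False growth_nonneg by (simp add: early_def)
  qed
  have h: "(4 / c + 8 + 3 / 2 * rel k / c) * ((lip c (\<mu> k))\<^sup>2 * mean_cons k) \<le> coup * mean_cons k"
  proof -
    have "rel k / c \<le> \<mu>0 * L1 / r" using rel_bounds(2)[of k] c by (simp add: field_simps)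
    from mult_left_mono[OF this, of "3 / 2"]
    have 1: "4 / c + 8 + 3 / 2 * rel k / c \<le> 4 / c + 8 + 3 / 2 * \<mu>0 * L1 / r" by simp
    have 2: "(lip c (\<mu> k))\<^sup>2 \<le> (lip c \<mu>0)\<^sup>2" using lip_le lip_nonneg[of c "\<mu> k"] c mu by (intro power_mono) auto
    have "(4 / c + 8 + 3 / 2 * rel k / c) * (lip c (\<mu> k))\<^sup>2 \<le> coup"
      unfolding coup_def using c rel_bounds[of k] mu0 L1_nonneg r_pos by (intro mult_mono 1 2) auto
    from mult_right_mono[OF this s0] show ?thesis by (simp add: mult.assoc)
  qed
  note energy_step[OF k]
  also have "(1 + (if rel k \<le> 1 / 20 then 0 else lam * (3 / 2 * rel k * (34 * r + 2 * \<mu> k * L1)))) * mean_energy k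
      \<le> (1 + early k) * mean_energy k"
    using b E0 by (intro mult_right_mono) auto
  also have "lam * ((4 / c + 8 + 3 / 2 * rel k / c) * ((lip c (\<mu> k))\<^sup>2 * mean_cons k))
      \<le> lam * (coup * mean_cons k)"
    using h lam by (intro mult_left_mono) auto
  finally show ?thesis by (simp add: mult.assoc)
qed

lemma consensus_recursion:
  assumes k: "k < K"
  shows "mean_cons (Suc k)
    \<le> (1 - \<kappa> / 4 + early k) * mean_cons k + 11 / \<kappa> * lam\<^sup>2 * (dissim_bound + noise_bound)"
proof -
  let ?l = "lip c (\<mu> k)"
  have s0: "0 \<le> mean_cons k" by (intro Bochner_Integration.integral_nonneg) (simp add: cons_err_def mean_nonneg)
  have l0: "0 \<le> lam * ?l" using lam lip_nonneg[of c "\<mu> k"] c mu by simp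
  have coef: "\<rho>\<^sup>2 * ((1 + \<kappa> / 10) * (1 + lam * ?l)\<^sup>2) \<le> 1 - \<kappa> / 4 + early k"
  proof (cases "\<mu> k * L1 \<le> r")
    case True
    have "lam * ?l = c * (lam * (\<mu> k * L1)) + 9 / 4 * (lam * r)" by (simp add: lip_def algebra_simps)
    also have "c * (lam * (\<mu> k * L1)) \<le> 3 / 32 * (lam * r)"
      using True c lam mu(1)[of k] L1_nonneg by (intro mult_mono mult_left_mono) auto
    also note lam_r(2)
    finally have l: "lam * ?l \<le> 3 / 5 * \<kappa>" by simp
    define t where "t = \<rho> * (1 + lam * ?l)"
    have t0: "0 \<le> t" using rho l0 by (simp add: t_def)
    have "t \<le> (1 - \<kappa>) * (1 + 3 / 5 * \<kappa>)" unfolding t_def using rho l l0 by (intro mult_mono) auto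
    also have "\<dots> = 1 - 2 / 5 * \<kappa> - 3 / 5 * \<kappa>\<^sup>2"
      by (simp add: algebra_simps power2_eq_square add_divide_distrib diff_divide_distrib)
    also have "\<dots> \<le> 1 - 2 / 5 * \<kappa>" by simp
    finally have t1: "t \<le> 1 - 2 / 5 * \<kappa>" .
    have "t \<le> 1" using t1 kappa by (simp add: field_simps)
    then have "t\<^sup>2 \<le> t" using t0 by (simp add: power2_eq_square mult_left_le)
    then have "(1 + \<kappa> / 10) * t\<^sup>2 \<le> (1 + \<kappa> / 10) * (1 - 2 / 5 * \<kappa>)" using t1 kappa by (intro mult_left_mono) auto
    also have "\<dots> = 1 - 3 / 10 * \<kappa> - 1 / 25 * \<kappa>\<^sup>2"
      by (simp add: algebra_simps power2_eq_square add_divide_distrib diff_divide_distrib)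
    also have "\<dots> \<le> 1 - \<kappa> / 4"
    proof -
      have "1 - 3 / 10 * a - 1 / 25 * b \<le> 1 - a / 4" if "0 < a" "0 \<le> b" for a b :: real
        using that by simp
      from this[OF kappa(1) zero_le_power2] show ?thesis .
    qed
    finally have "(1 + \<kappa> / 10) * t\<^sup>2 \<le> 1 - \<kappa> / 4" .
    moreover have "\<rho>\<^sup>2 * ((1 + \<kappa> / 10) * (1 + lam * ?l)\<^sup>2) = (1 + \<kappa> / 10) * t\<^sup>2"
      by (simp only: t_def power_mult_distrib mult_ac)
    ultimately show ?thesis using True by (simp only: early_def if_True)
  next
    case False
    have "lam * ?l \<le> 1 / r * lip c \<mu>0"
      using lam_le(2) lip_le lip_nonneg[of c "\<mu> k"] c mu r_pos by (intro mult_mono) auto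
    then have "(1 + lam * ?l)\<^sup>2 \<le> (1 + lip c \<mu>0 / r)\<^sup>2" using l0 by (intro power_mono) auto
    then have "(1 + \<kappa> / 10) * (1 + lam * ?l)\<^sup>2 \<le> 11 / 10 * (1 + lip c \<mu>0 / r)\<^sup>2"
      using kappa by (intro mult_mono) auto
    also have "\<dots> \<le> growth" unfolding growth_def using growth_parts(1) by linarith
    finally have g: "(1 + \<kappa> / 10) * (1 + lam * ?l)\<^sup>2 \<le> growth" .
    have "\<rho>\<^sup>2 * ((1 + \<kappa> / 10) * (1 + lam * ?l)\<^sup>2) \<le> 1 * ((1 + \<kappa> / 10) * (1 + lam * ?l)\<^sup>2)"
      using rho kappa by (intro mult_right_mono) (auto simp: power_le_one)
    also have "\<dots> \<le> growth" using g by (simp only: mult_1)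
    also have "\<dots> \<le> 1 - \<kappa> / 4 + growth"
    proof -
      have "0 \<le> 1 - \<kappa> / 4" using kappa by (simp add: field_simps)
      then show ?thesis by (simp only: le_add_same_cancel2)
    qed
    finally show ?thesis using False by (simp only: early_def if_False)
  qed
  have z: "\<rho>\<^sup>2 * ((1 + 10 / \<kappa>) * lam\<^sup>2 * dissim_bound + lam\<^sup>2 * noise_bound) \<le> 11 / \<kappa> * lam\<^sup>2 * (dissim_bound + noise_bound)"
  proof -
    have k1: "1 \<le> 1 / \<kappa>" using kappa by simp
    have "(1 + 10 / \<kappa>) * (lam\<^sup>2 * dissim_bound) + 1 * (lam\<^sup>2 * noise_bound) \<le> 11 / \<kappa> * (lam\<^sup>2 * dissim_bound) + 11 / \<kappa> * (lam\<^sup>2 * noise_bound)"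
    proof (intro add_mono mult_right_mono)
      show "1 + 10 / \<kappa> \<le> 11 / \<kappa>" "1 \<le> 11 / \<kappa>" using k1 by simp_all
    qed (use noise_bound_nonneg in auto)
    moreover have "\<rho>\<^sup>2 * ((1 + 10 / \<kappa>) * lam\<^sup>2 * dissim_bound + lam\<^sup>2 * noise_bound) \<le> 1 * ((1 + 10 / \<kappa>) * lam\<^sup>2 * dissim_bound + lam\<^sup>2 * noise_bound)"
      using rho kappa noise_bound_nonneg by (intro mult_right_mono) (auto simp: power_le_one)
    ultimately show ?thesis by (simp add: algebra_simps add_divide_distrib)
  qed
  have "mean_cons (Suc k)
      \<le> \<rho>\<^sup>2 * ((1 + \<kappa> / 10) * (1 + lam * ?l)\<^sup>2) * mean_cons k
        + \<rho>\<^sup>2 * ((1 + 10 / \<kappa>) * lam\<^sup>2 * dissim_bound + lam\<^sup>2 * noise_bound)"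
    using consensus_step[OF k] by (simp only: distrib_left mult.assoc add.assoc)
  also have "\<dots> \<le> (1 - \<kappa> / 4 + early k) * mean_cons k + 11 / \<kappa> * lam\<^sup>2 * (dissim_bound + noise_bound)"
    by (intro add_mono mult_right_mono coef z s0)
  finally show ?thesis .
qed

text \<open>
  In the Lyapunov function the disagreement has the weight \<open>4 * lam * coup / \<kappa>\<close>.  It is at most
  \<open>4 * coup / r\<close>, so the initial disagreement does not bring in a factor \<open>1 / (1 - \<rho>)\<close>.
\<close>

lemma average_gradient_bound:
  assumes K: "1 \<le> K" and k0: "\<And>k. k0 \<le> k \<Longrightarrow> \<mu> k * L1 \<le> r"
  shows "1 / real K * (\<Sum>k<K. mean_grad k)
    \<le> 10 / c * (1 + growth) ^ k0 *
       ((energy (\<mu> 0) (mean n v0) + 4 * coup / r * mean n (\<lambda>i. (norm (v0 i - mean n v0))\<^sup>2)) / (lam * real K)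
        + lam * curv * noise_bound / real n + 44 * coup * lam\<^sup>2 / \<kappa>\<^sup>2 * (dissim_bound + noise_bound))"
proof -
  define e where "e k = mean_energy k" for k
  define s where "s k = mean_cons k" for k
  define p where "p k = mean_grad k" for k
  have avg0: "avg 0 \<omega> = mean n v0" if "\<omega> \<in> space M" for \<omega>
    unfolding avg_def by (rule mean_cong) (simp add: init that)
  have e0: "e 0 = energy (\<mu> 0) (mean n v0)"
  proof -
    have "e 0 = (\<integral>\<omega>. energy (\<mu> 0) (mean n v0) \<partial>M)"
      unfolding e_def by (rule Bochner_Integration.integral_cong) (auto simp: avg0)
    then show ?thesis by (simp add: prob_space)
  qed
  have s0: "s 0 = mean n (\<lambda>i. (norm (v0 i - mean n v0))\<^sup>2)"
  proof -
    have "s 0 = (\<integral>\<omega>. mean n (\<lambda>i. (norm (v0 i - mean n v0))\<^sup>2) \<partial>M)"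
      unfolding s_def cons_err_def
      by (rule Bochner_Integration.integral_cong) (auto simp: avg0 init intro!: mean_cong)
    then show ?thesis by (simp add: prob_space)
  qed
  have s00: "0 \<le> s 0" unfolding s0 by (rule mean_nonneg) simp
  define Z where "Z = lam\<^sup>2 * curv * noise_bound / real n
    + 4 * (lam * coup) / \<kappa> * (11 / \<kappa> * lam\<^sup>2 * (dissim_bound + noise_bound))"
  have sum: "lam * c / 10 * (\<Sum>k<K. p k) \<le> (1 + growth) ^ k0 * (e 0 + 4 * (lam * coup) / \<kappa> * s 0 + real K * Z)"
    unfolding Z_def
  proof (rule lyapunov_sum[where b=early])
    show "0 \<le> e k" for k unfolding e_def by (intro Bochner_Integration.integral_nonneg energy_nonneg mu)
    show "0 \<le> s k" for k unfolding s_def by (intro Bochner_Integration.integral_nonneg) (simp add: cons_err_def mean_nonneg)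
    show "0 \<le> p k" for k unfolding p_def by (intro Bochner_Integration.integral_nonneg) simp
    show "e (Suc k) \<le> (1 + early k) * e k - lam * c / 10 * p k + lam * coup * s k + lam\<^sup>2 * curv * noise_bound / real n" if "k < K" for k
      unfolding e_def s_def p_def by (rule energy_recursion[OF that])
    show "s (Suc k) \<le> (1 - \<kappa> / 4 + early k) * s k + 11 / \<kappa> * lam\<^sup>2 * (dissim_bound + noise_bound)" if "k < K" for k
      unfolding s_def by (rule consensus_recursion[OF that])
    show "0 \<le> early k \<and> early k \<le> growth" for k using growth_nonneg by (simp add: early_def)
    show "early k = 0" if "k0 \<le> k" for k using k0[OF that] by (simp add: early_def)
    show "0 \<le> lam * coup" "0 < \<kappa>" "0 \<le> lam * c / 10" "0 \<le> growth" using lam coup_pos kappa c growth_nonneg by auto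
    show "0 \<le> lam\<^sup>2 * curv * noise_bound / real n" "0 \<le> 11 / \<kappa> * lam\<^sup>2 * (dissim_bound + noise_bound)"
      using noise_bound_nonneg kappa r_pos mu0 L1_nonneg by (auto simp: curv_def)
  qed
  have "4 * (lam * coup) / \<kappa> \<le> 4 * coup / r"
  proof -
    have "lam / \<kappa> \<le> 1 / r" using lam_le(1) kappa r_pos by (simp add: field_simps)
    from mult_left_mono[OF this, of "4 * coup"] show ?thesis using coup_pos by (simp add: mult_ac)
  qed
  then have "4 * (lam * coup) / \<kappa> * s 0 \<le> 4 * coup / r * s 0" using s00 by (rule mult_right_mono)
  then have "(1 + growth) ^ k0 * (e 0 + 4 * (lam * coup) / \<kappa> * s 0 + real K * Z)
      \<le> (1 + growth) ^ k0 * (e 0 + 4 * coup / r * s 0 + real K * Z)"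
    using growth_nonneg by (intro mult_left_mono) auto
  with sum have "lam * c / 10 * (\<Sum>k<K. p k) \<le> (1 + growth) ^ k0 * (e 0 + 4 * coup / r * s 0 + real K * Z)" by linarith
  from mult_left_mono[OF this, of "10 / (c * lam * real K)"]
  have "1 / real K * (\<Sum>k<K. p k) \<le> 10 / (c * lam * real K) * ((1 + growth) ^ k0 * (e 0 + 4 * coup / r * s 0 + real K * Z))"
    using c lam by simp
  also have "\<dots> = 10 / c * (1 + growth) ^ k0 * ((e 0 + 4 * coup / r * s 0) / (lam * real K)
        + lam * curv * noise_bound / real n + 44 * coup * lam\<^sup>2 / \<kappa>\<^sup>2 * (dissim_bound + noise_bound))"
  proof -
    define G0 where "G0 = (1 + growth) ^ k0"
    define z1 where "z1 = curv * noise_bound / real n"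
    define z2 where "z2 = coup * (dissim_bound + noise_bound)"
    define y where "y = e 0 + 4 * coup / r * s 0"
    have a: "lam\<^sup>2 * curv * noise_bound / real n = lam * (lam * z1)" "lam * curv * noise_bound / real n = lam * z1"
      by (simp_all add: z1_def power2_eq_square)
    have b: "4 * (lam * coup) / \<kappa> * (11 / \<kappa> * lam\<^sup>2 * (dissim_bound + noise_bound)) = lam * (44 * lam\<^sup>2 / \<kappa>\<^sup>2 * z2)"
      "44 * coup * lam\<^sup>2 / \<kappa>\<^sup>2 * (dissim_bound + noise_bound) = 44 * lam\<^sup>2 / \<kappa>\<^sup>2 * z2"
      by (simp_all add: z2_def power2_eq_square)
    show ?thesis
      unfolding Z_def a b G0_def[symmetric] y_def[symmetric] using c lam K by (simp add: field_simps)
  qed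
  finally show ?thesis unfolding p_def e0 s0 .
qed

end

text \<open>
  The constants are fixed from \<open>L1\<close>, \<open>\<gamma>\<close>, \<open>\<mu>0\<close>, \<open>p\<close> and the step-size factors alone; it remains to
  insert \<open>lam = c_theta * sqrt (n / K)\<close> into the bound for a single run.
\<close>

theorem theorem3p5:
  fixes L1 L2 \<gamma> \<mu>0 p c_theta c_lam :: real
  assumes "0 < \<mu>0" and "0 < p" and "p < 1 / 4"
    and "0 < \<gamma>" and "\<gamma> < 1 / (2 * L2)"
    and "0 < c_theta" and "0 < c_lam"
  shows "\<exists>A1 A2 A3 :: real. \<exists>C1 :: real \<Rightarrow> real \<Rightarrow> real \<Rightarrow> real \<Rightarrow> real \<Rightarrow> real.
    0 < A1 \<and> 0 < A2 \<and> 0 < A3 \<and> (\<forall>\<Delta> df dg sf sg. 0 < C1 \<Delta> df dg sf sg) \<and>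
    (\<forall>(n :: nat) (K :: nat) (W :: real mat) (\<rho> :: real)
      (f :: nat \<Rightarrow> 'x::euclidean_space \<times> 'y::euclidean_space \<Rightarrow> real)
      (g :: nat \<Rightarrow> 'x \<times> 'y \<Rightarrow> real) (F :: 'x \<times> 'y \<Rightarrow> real) (G :: 'x \<times> 'y \<Rightarrow> real) (F_low :: real)
      (Sf :: nat \<Rightarrow> 's measure) (Sg :: nat \<Rightarrow> 's measure)
      (fs :: nat \<Rightarrow> 's \<Rightarrow> 'x \<times> 'y \<Rightarrow> real) (gs :: nat \<Rightarrow> 's \<Rightarrow> 'x \<times> 'y \<Rightarrow> real)
      (\<delta>f :: real) (\<delta>g :: real) (\<sigma>f :: real) (\<sigma>g :: real) (L\<theta> :: real)
      (\<mu> :: nat \<Rightarrow> real) (lam_theta :: nat \<Rightarrow> real) (lam_x :: nat \<Rightarrow> real) (lam_y :: nat \<Rightarrow> real)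
      (M :: 'w measure) (\<xi>f :: nat \<Rightarrow> nat \<Rightarrow> 'w \<Rightarrow> 's) (\<xi>g :: nat \<Rightarrow> nat \<Rightarrow> 'w \<Rightarrow> 's)
      (\<theta>0 :: nat \<Rightarrow> 'y) (x0 :: nat \<Rightarrow> 'x) (y0 :: nat \<Rightarrow> 'y)
      (\<theta> :: nat \<Rightarrow> nat \<Rightarrow> 'w \<Rightarrow> 'y) (x :: nat \<Rightarrow> nat \<Rightarrow> 'w \<Rightarrow> 'x) (y :: nat \<Rightarrow> nat \<Rightarrow> 'w \<Rightarrow> 'y).
      1 \<le> n \<longrightarrow> 1 \<le> K \<longrightarrow>
      F = (\<lambda>z. mean n (\<lambda>i. f i z)) \<longrightarrow> G = (\<lambda>z. mean n (\<lambda>i. g i z)) \<longrightarrow>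
      (\<forall>z. F_low \<le> F z) \<longrightarrow>
      (\<forall>i<n. smooth_fun L1 (f i) \<and> smooth_fun L2 (g i)) \<longrightarrow>
      (\<forall>i<n. stochastic_oracle (Sf i) (fs i) (f i) \<delta>f \<and> stochastic_oracle (Sg i) (gs i) (g i) \<delta>g) \<longrightarrow>
      network_topology n W \<rho> \<longrightarrow>
      gradient_dissimilarity n f \<sigma>f \<longrightarrow> gradient_dissimilarity n g \<sigma>g \<longrightarrow>
      0 < L\<theta> \<longrightarrow> L\<theta>-lipschitz_on UNIV (theta_star \<gamma> G) \<longrightarrow>
      (\<forall>k<K. \<mu> k = \<mu>0 * real (k + 1) powr (- p)) \<longrightarrow>
      (\<forall>k<K. lam_theta k = c_theta * real n powr (1 / 2) * real K powr (- (1 / 2)) \<and>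
             lam_x k = c_lam * lam_theta k \<and> lam_y k = c_lam * lam_theta k) \<longrightarrow>
      (\<forall>k<K. step_size_conditions L1 L2 \<gamma> \<mu>0 c_lam L\<theta> \<rho> (lam_theta k)) \<longrightarrow>
      fresh_samples M n K Sf Sg \<xi>f \<xi>g \<longrightarrow>
      (\<forall>\<omega>\<in>space M.
        sun_dsbo_se n K W \<gamma> \<mu> lam_theta lam_x lam_y fs gs
          (\<lambda>k i. \<xi>f k i \<omega>) (\<lambda>k i. \<xi>g k i \<omega>) \<theta>0 x0 y0
          (\<lambda>k i. \<theta> k i \<omega>) (\<lambda>k i. x k i \<omega>) (\<lambda>k i. y k i \<omega>)) \<longrightarrow>
      (\<forall>k<K. integrable M (\<lambda>\<omega>.
        (norm (grad (Psi \<gamma> F G (\<mu> k)) (mean n (\<lambda>i. x k i \<omega>), mean n (\<lambda>i. y k i \<omega>))))\<^sup>2)) \<and>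
      1 / real K * (\<Sum>k<K. \<integral>\<omega>.
        (norm (grad (Psi \<gamma> F G (\<mu> k)) (mean n (\<lambda>i. x k i \<omega>), mean n (\<lambda>i. y k i \<omega>))))\<^sup>2 \<partial>M)
      \<le> A1 * (C1 (initial_gap n \<gamma> F G F_low \<theta>0 x0 y0) (\<delta>f\<^sup>2) (\<delta>g\<^sup>2) (\<sigma>f\<^sup>2) (\<sigma>g\<^sup>2)
               / (real n powr (1 / 2) * real K powr (1 / 2)))
        + A2 * (real n * (\<delta>f\<^sup>2 + \<delta>g\<^sup>2) / ((1 - \<rho>)\<^sup>2 * real K))
        + A3 * (real n * (\<sigma>f\<^sup>2 + \<sigma>g\<^sup>2) / ((1 - \<rho>)\<^sup>2 * real K)))"
proof -
  \<comment> \<open>The constants must be positive for every \<open>L1\<close>, although runs exist only for nonnegative \<open>L1\<close>.\<close>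
  define L where "L = \<bar>L1\<bar>"
  have L1: "0 \<le> L" by (simp add: L_def)
  define r where "r = 1 / \<gamma>"
  have r: "0 < r" using assms by (simp add: r_def)
  define lipm where "lipm = c_lam * \<mu>0 * L + 9 / 4 * r"
  define coup where "coup = (4 / c_lam + 8 + 3 / 2 * \<mu>0 * L / r) * lipm\<^sup>2"
  define growth where "growth = 1 / r * (3 / 2 * (c_lam * \<mu>0 * L / r) * (34 * r + 2 * \<mu>0 * L)) + 11 / 10 * (1 + lipm / r)\<^sup>2"
  define curv where "curv = 17 / 2 * r + \<mu>0 * L / 2"
  have "(\<lambda>k. \<mu>0 * real (k + 1) powr (- p) * L) \<longlonglongrightarrow> \<mu>0 * 0 * L"
  proof (intro tendsto_intros tendsto_neg_powr)
    show "filterlim (\<lambda>k. real (k + 1)) at_top sequentially"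
      using filterlim_compose[OF filterlim_real_sequentially filterlim_add_const_nat_at_top] .
  qed (use assms in simp)
  then have "\<forall>\<^sub>F k in sequentially. \<mu>0 * real (k + 1) powr (- p) * L < r"
    using r by (intro order_tendstoD(2)) auto
  then obtain k0 where k0: "\<And>k. k0 \<le> k \<Longrightarrow> \<mu>0 * real (k + 1) powr (- p) * L \<le> r"
    unfolding eventually_sequentially by (meson less_imp_le)
  define T where "T = 10 / c_lam * (1 + growth) ^ k0"
  define nu where "nu = \<mu>0\<^sup>2 + 4"
  define E0 where "E0 = \<mu>0 + 1 + r + 4 * coup / r"
  define A1 where "A1 = T * (E0 / c_theta + c_theta * curv * nu)"
  define A2 where "A2 = T * (44 * coup * c_theta\<^sup>2 * nu)"
  define C1 where "C1 = (\<lambda>(\<Delta>::real) (df::real) (dg::real) (sf::real) (sg::real). 1 + \<bar>\<Delta>\<bar> + \<bar>df\<bar> + \<bar>dg\<bar>)"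
  have lipm: "0 < lipm" using assms L1 r by (auto simp: lipm_def intro!: add_nonneg_pos)
  have "0 < 4 / c_lam + 8 + 3 / 2 * \<mu>0 * L / r" using assms L1 r by (intro add_pos_nonneg) auto
  then have coup: "0 < coup" using lipm by (simp add: coup_def)
  have growth: "0 \<le> growth" using assms L1 r by (auto simp: growth_def intro!: add_nonneg_nonneg)
  have curv: "0 < curv" using assms L1 r by (auto simp: curv_def intro!: add_pos_nonneg)
  have T: "0 < T" using assms growth by (auto simp: T_def intro!: divide_pos_pos mult_pos_pos zero_less_power add_pos_nonneg)
  have nu: "0 < nu" by (auto simp: nu_def intro!: add_nonneg_pos)
  have E0: "0 < E0" using assms r coup by (auto simp: E0_def intro!: add_pos_pos)
  have A: "0 < A1" "0 < A2" using T E0 curv nu coup assms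
    by (auto simp: A1_def A2_def intro!: mult_pos_pos add_pos_pos)
  show ?thesis
  proof (rule exI[of _ A1], rule exI[of _ A2], rule exI[of _ A2], rule exI[of _ C1], intro conjI allI impI)
    show "0 < A1" "0 < A2" "0 < A2" by (fact A)+
    show "0 < C1 \<Delta> df dg sf sg" for \<Delta> df dg sf sg by (simp add: C1_def add_pos_nonneg)
  next
    fix n K :: nat and W :: "real mat" and \<rho> :: real and f g :: "nat \<Rightarrow> 'x \<times> 'y \<Rightarrow> real"
      and F G :: "'x \<times> 'y \<Rightarrow> real" and F_low :: real and Sf Sg :: "nat \<Rightarrow> 's measure"
      and fs gs :: "nat \<Rightarrow> 's \<Rightarrow> 'x \<times> 'y \<Rightarrow> real" and \<delta>f \<delta>g \<sigma>f \<sigma>g L\<theta> :: real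
      and \<mu> lam_theta lam_x lam_y :: "nat \<Rightarrow> real" and M :: "'w measure" and \<xi>f \<xi>g :: "nat \<Rightarrow> nat \<Rightarrow> 'w \<Rightarrow> 's"
      and \<theta>0 :: "nat \<Rightarrow> 'y" and x0 :: "nat \<Rightarrow> 'x" and y0 :: "nat \<Rightarrow> 'y"
      and \<theta> :: "nat \<Rightarrow> nat \<Rightarrow> 'w \<Rightarrow> 'y" and x :: "nat \<Rightarrow> nat \<Rightarrow> 'w \<Rightarrow> 'x" and y :: "nat \<Rightarrow> nat \<Rightarrow> 'w \<Rightarrow> 'y"
    assume n: "1 \<le> n" and K: "1 \<le> K"
      and F: "F = (\<lambda>z. mean n (\<lambda>i. f i z))" and G: "G = (\<lambda>z. mean n (\<lambda>i. g i z))"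
      and low: "\<forall>z. F_low \<le> F z"
      and smooth: "\<forall>i<n. smooth_fun L1 (f i) \<and> smooth_fun L2 (g i)"
      and orc: "\<forall>i<n. stochastic_oracle (Sf i) (fs i) (f i) \<delta>f \<and> stochastic_oracle (Sg i) (gs i) (g i) \<delta>g"
      and net: "network_topology n W \<rho>"
      and dis: "gradient_dissimilarity n f \<sigma>f" "gradient_dissimilarity n g \<sigma>g"
      and L\<theta>: "0 < L\<theta>" "L\<theta>-lipschitz_on UNIV (theta_star \<gamma> G)"
      and \<mu>: "\<forall>k<K. \<mu> k = \<mu>0 * real (k + 1) powr (- p)"
      and lams: "\<forall>k<K. lam_theta k = c_theta * real n powr (1 / 2) * real K powr (- (1 / 2)) \<and>
             lam_x k = c_lam * lam_theta k \<and> lam_y k = c_lam * lam_theta k"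
      and ss: "\<forall>k<K. step_size_conditions L1 L2 \<gamma> \<mu>0 c_lam L\<theta> \<rho> (lam_theta k)"
      and fresh: "fresh_samples M n K Sf Sg \<xi>f \<xi>g"
      and run: "\<forall>\<omega>\<in>space M.
        sun_dsbo_se n K W \<gamma> \<mu> lam_theta lam_x lam_y fs gs
          (\<lambda>k i. \<xi>f k i \<omega>) (\<lambda>k i. \<xi>g k i \<omega>) \<theta>0 x0 y0
          (\<lambda>k i. \<theta> k i \<omega>) (\<lambda>k i. x k i \<omega>) (\<lambda>k i. y k i \<omega>)"
    have LL: "L = L1"
      using smooth_fun_nonneg[of L1 "f 0"] smooth n by (simp add: L_def)
    define sn where "sn = real n powr (1 / 2)"
    define sK where "sK = real K powr (1 / 2)"
    define lam where "lam = c_theta * sn / sK"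
    have sn: "0 < sn" "sn\<^sup>2 = real n" and sK: "0 < sK" "sK\<^sup>2 = real K"
      using n K by (simp_all add: sn_def sK_def power2_eq_square powr_add[symmetric])
    have lam_theta: "lam_theta k = lam" if "k < K" for k
    proof -
      have "lam_theta k = c_theta * real n powr (1 / 2) * real K powr (- (1 / 2))" using lams that by blast
      then show ?thesis unfolding lam_def sn_def sK_def powr_minus by (simp only: divide_inverse)
    qed
    have lam0: "0 < lam" using assms sn sK by (simp add: lam_def)
    have rho: "0 \<le> \<rho>" "\<rho> < 1" using network_topology_n[OF net] by auto
    define \<mu>' where "\<mu>' k = \<mu>0 * real (k + 1) powr (- p)" for k :: nat
    define v where "v k i \<omega> = ((x k i \<omega>, y k i \<omega>), \<theta> k i \<omega>)" for k i \<omega>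
    define v0 where "v0 i = ((x0 i, y0 i), \<theta>0 i)" for i
    interpret B: bilevel F G L1 L2 \<gamma> F_low
    proof
      show "smooth_fun L1 F" "smooth_fun L2 G" unfolding F G using smooth n by (auto intro: smooth_fun_mean(1))
    qed (use low assms in auto)
    note sc = B.step_size_consequences[OF _ L\<theta>(2) \<open>0 < c_lam\<close> rho(2), of \<mu>0 lam]
    have ss': "step_size_conditions L1 L2 \<gamma> \<mu>0 c_lam L\<theta> \<rho> lam" using ss lam_theta[of 0] K by auto
    interpret R: dsbo_run F G L1 L2 \<gamma> F_low M K n Sf Sg \<xi>f \<xi>g W \<rho> f g fs gs \<delta>f \<delta>g \<sigma>f \<sigma>g c_lam lam \<mu>0 \<mu>' v v0
    proof (intro dsbo_run.intro dsbo_run_axioms.intro sampling.intro sampling_axioms.intro)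
      show "bilevel F G L1 L2 \<gamma> F_low" by (rule B.bilevel_axioms)
      show "prob_space M" using fresh by (simp add: fresh_samples_def)
      show "prob_space.indep_vars M (case_sum (\<lambda>(k, i). Sf i) (\<lambda>(k, i). Sg i))
          (case_sum (\<lambda>(k, i). \<xi>f k i) (\<lambda>(k, i). \<xi>g k i)) (({..<K} \<times> {..<n}) <+> ({..<K} \<times> {..<n}))"
        using fresh by (simp add: fresh_samples_def)
      show "distr M (case_sum (\<lambda>(k, i). Sf i) (\<lambda>(k, i). Sg i) j) (case_sum (\<lambda>(k, i). \<xi>f k i) (\<lambda>(k, i). \<xi>g k i) j)
          = case_sum (\<lambda>(k, i). Sf i) (\<lambda>(k, i). Sg i) j"
        if "j \<in> ({..<K} \<times> {..<n}) <+> ({..<K} \<times> {..<n})" for j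
        using fresh that by (auto simp: fresh_samples_def)
      show "0 \<le> \<mu>' k" "\<mu>' k \<le> \<mu>0" "\<mu>' (Suc k) \<le> \<mu>' k" for k
      proof -
        show "0 \<le> \<mu>' k" using assms by (simp add: \<mu>'_def)
        have "real (k + 1) powr (- p) \<le> 1 powr (- p)" using assms by (intro powr_mono2') auto
        then show "\<mu>' k \<le> \<mu>0" using assms by (simp add: \<mu>'_def mult_left_le)
        have "real (Suc k + 1) powr (- p) \<le> real (k + 1) powr (- p)" using assms by (intro powr_mono2') auto
        then show "\<mu>' (Suc k) \<le> \<mu>' k" unfolding \<mu>'_def using assms by (intro mult_left_mono) auto
      qed
      show "v 0 i \<omega> = v0 i" if "i < n" "\<omega> \<in> space M" for i \<omega>
        using run that by (auto simp: sun_dsbo_se_def v_def v0_def)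
      show "v (Suc k) i \<omega> = gossip n W i (\<lambda>j. v k j \<omega>
          - lam *\<^sub>R step_dir \<gamma> c_lam (\<mu>' k) (fs j (\<xi>f k j \<omega>)) (gs j (\<xi>g k j \<omega>)) (v k j \<omega>))"
        if kio: "k < K" "i < n" "\<omega> \<in> space M" for k i \<omega>
      proof -
        have m: "\<mu> k = \<mu>' k" using \<mu> kio by (simp add: \<mu>'_def)
        have l: "lam_theta k = lam" "lam_x k = lam * c_lam" "lam_y k = lam * c_lam"
          using lams lam_theta[OF kio(1)] kio by (simp_all add: mult.commute)
        have eq: "v k j \<omega> - lam *\<^sub>R step_dir \<gamma> c_lam (\<mu>' k) (fs j (\<xi>f k j \<omega>)) (gs j (\<xi>g k j \<omega>)) (v k j \<omega>)
          = ((x k j \<omega> - lam_x k *\<^sub>R dir_x (\<mu> k) (fs j (\<xi>f k j \<omega>)) (gs j (\<xi>g k j \<omega>)) (x k j \<omega>) (y k j \<omega>) (\<theta> k j \<omega>),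
              y k j \<omega> - lam_y k *\<^sub>R dir_y \<gamma> (\<mu> k) (fs j (\<xi>f k j \<omega>)) (gs j (\<xi>g k j \<omega>)) (x k j \<omega>) (y k j \<omega>) (\<theta> k j \<omega>)),
             \<theta> k j \<omega> - lam_theta k *\<^sub>R dir_theta \<gamma> (gs j (\<xi>g k j \<omega>)) (x k j \<omega>) (y k j \<omega>) (\<theta> k j \<omega>))" for j
          by (simp add: v_def step_dir_def m l)
        have "sun_dsbo_se n K W \<gamma> \<mu> lam_theta lam_x lam_y fs gs (\<lambda>k i. \<xi>f k i \<omega>) (\<lambda>k i. \<xi>g k i \<omega>) \<theta>0 x0 y0
          (\<lambda>k i. \<theta> k i \<omega>) (\<lambda>k i. x k i \<omega>) (\<lambda>k i. y k i \<omega>)" using run kio by blast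
        then show ?thesis
          unfolding eq gossip_Pair sun_dsbo_se_def v_def[of "Suc k"] using kio by simp
      qed
    qed (use n F G smooth orc net dis sc[OF ss'] lam0 assms in auto)
    have avg: "fst (R.avg k \<omega>) = (mean n (\<lambda>i. x k i \<omega>), mean n (\<lambda>i. y k i \<omega>))" for k \<omega>
      by (simp add: R.avg_def v_def prod_eq_iff fst_mean snd_mean)
    have gr: "grad (Psi \<gamma> F G (\<mu> k)) (mean n (\<lambda>i. x k i \<omega>), mean n (\<lambda>i. y k i \<omega>)) = B.gradPsi (\<mu>' k) (fst (R.avg k \<omega>))"
      if "k < K" for k \<omega> using \<mu> that unfolding avg B.grad_Psi by (simp add: \<mu>'_def)
    show "integrable M (\<lambda>\<omega>. (norm (grad (Psi \<gamma> F G (\<mu> k)) (mean n (\<lambda>i. x k i \<omega>), mean n (\<lambda>i. y k i \<omega>))))\<^sup>2)"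
      if "k < K" for k
      unfolding gr[OF that] using that by (intro R.gradPsi_integrable R.mu) simp
    have rr: "B.r = r" by (simp add: B.r_def r_def)
    have ll: "B.lip c_lam \<mu>0 = lipm" by (simp add: B.lip_def lipm_def rr LL)
    have cs: "R.coup = coup" "R.growth = growth" "R.curv = curv"
      by (simp_all add: R.coup_def coup_def R.growth_def growth_def R.curv_def curv_def ll rr LL)
    define \<Delta> where "\<Delta> = initial_gap n \<gamma> F G F_low \<theta>0 x0 y0"
    define s0 where "s0 = mean n (\<lambda>i. (norm (v0 i - mean n v0))\<^sup>2)"
    let ?z = "(mean n x0, mean n y0)"
    have mv0: "mean n v0 = (?z, mean n \<theta>0)" by (simp add: v0_def prod_eq_iff fst_mean snd_mean)
    have s0: "s0 = mean n (\<lambda>i. (norm (\<theta>0 i - mean n \<theta>0))\<^sup>2 + (norm (x0 i - mean n x0))\<^sup>2 + (norm (y0 i - mean n y0))\<^sup>2)"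
      unfolding s0_def mv0 by (rule mean_cong) (simp add: v0_def norm_Pair_squared)
    have parts: "0 \<le> F ?z - F_low" "0 \<le> G ?z - V_env \<gamma> G ?z" "0 \<le> (norm (mean n \<theta>0 - theta_star \<gamma> G ?z))\<^sup>2" "0 \<le> s0"
      using low B.V_env_le[of ?z "mean n y0"] by (auto simp: B.prox_obj_r s0_def intro!: mean_nonneg)
    have \<Delta>: "\<Delta> = (F ?z - F_low) + (G ?z - V_env \<gamma> G ?z) + (norm (mean n \<theta>0 - theta_star \<gamma> G ?z))\<^sup>2 + s0"
      unfolding \<Delta>_def initial_gap_def Let_def s0 ..
    have init: "B.energy (\<mu>' 0) (mean n v0) + 4 * coup / r * s0 \<le> E0 * \<Delta>"
    proof -
      have "B.energy (\<mu>' 0) (mean n v0) \<le> \<mu>0 * (F ?z - F_low) + (G ?z - V_env \<gamma> G ?z) + r * (norm (mean n \<theta>0 - theta_star \<gamma> G ?z))\<^sup>2"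
        unfolding mv0 using B.energy_le[of \<mu>0 ?z "mean n \<theta>0"] assms by (simp add: \<mu>'_def rr)
      then have "B.energy (\<mu>' 0) (mean n v0) + 4 * coup / r * s0
          \<le> \<mu>0 * (F ?z - F_low) + 1 * (G ?z - V_env \<gamma> G ?z) + r * (norm (mean n \<theta>0 - theta_star \<gamma> G ?z))\<^sup>2 + 4 * coup / r * s0"
        by simp
      also have "\<dots> \<le> E0 * (F ?z - F_low) + E0 * (G ?z - V_env \<gamma> G ?z) + E0 * (norm (mean n \<theta>0 - theta_star \<gamma> G ?z))\<^sup>2 + E0 * s0"
        using parts assms r coup by (intro add_mono mult_right_mono) (auto simp: E0_def)
      finally show ?thesis unfolding \<Delta> distrib_left .
    qed
    have nb: "R.noise_bound \<le> nu * (\<delta>f\<^sup>2 + \<delta>g\<^sup>2)" "R.dissim_bound \<le> nu * (\<sigma>f\<^sup>2 + \<sigma>g\<^sup>2)"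
      by (simp_all add: R.noise_bound_def R.dissim_bound_def nu_def algebra_simps)
    define D where "D = \<delta>f\<^sup>2 + \<delta>g\<^sup>2"
    define Sg2 where "Sg2 = \<sigma>f\<^sup>2 + \<sigma>g\<^sup>2"
    have D0: "0 \<le> D" by (simp add: D_def)
    have \<Delta>0: "0 \<le> \<Delta>" unfolding \<Delta> using parts by linarith
    have "1 / real K * (\<Sum>k<K. \<integral>\<omega>. (norm (grad (Psi \<gamma> F G (\<mu> k)) (mean n (\<lambda>i. x k i \<omega>), mean n (\<lambda>i. y k i \<omega>))))\<^sup>2 \<partial>M)
        = 1 / real K * (\<Sum>k<K. \<integral>\<omega>. (norm (B.gradPsi (\<mu>' k) (fst (R.avg k \<omega>))))\<^sup>2 \<partial>M)"
      by (simp add: gr)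
    also have "\<dots> \<le> T * ((B.energy (\<mu>' 0) (mean n v0) + 4 * coup / r * s0) / (lam * real K)
        + lam * curv * R.noise_bound / real n + 44 * coup * lam\<^sup>2 / (1 - \<rho>)\<^sup>2 * (R.dissim_bound + R.noise_bound))"
      using R.average_gradient_bound[OF K, of k0] k0 unfolding cs rr T_def s0_def by (simp add: \<mu>'_def LL)
    also have "\<dots> \<le> T * (E0 * \<Delta> / (lam * real K) + lam * curv * (nu * D) / real n + 44 * coup * lam\<^sup>2 / (1 - \<rho>)\<^sup>2 * (nu * Sg2 + nu * D))"
      using T lam0 K n curv coup nb init unfolding D_def Sg2_def
      by (intro mult_left_mono add_mono divide_right_mono) auto
    also have "\<dots> = T * (E0 / c_theta * \<Delta> / (sn * sK) + c_theta * curv * nu * D / (sn * sK)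
        + 44 * coup * c_theta\<^sup>2 * nu * (real n * (Sg2 + D) / ((1 - \<rho>)\<^sup>2 * real K)))"
    proof -
      have 1: "E0 * \<Delta> / (lam * real K) = E0 / c_theta * \<Delta> / (sn * sK)"
        unfolding lam_def sK(2)[symmetric] using sn(1) sK(1) assms by (simp add: power2_eq_square)
      have 2: "lam * curv * (nu * D) / real n = c_theta * curv * nu * D / (sn * sK)"
        unfolding lam_def sn(2)[symmetric] using sn(1) sK(1) by (simp add: power2_eq_square mult_ac)
      have 3: "44 * coup * lam\<^sup>2 / (1 - \<rho>)\<^sup>2 * (nu * Sg2 + nu * D) = 44 * coup * c_theta\<^sup>2 * nu * (real n * (Sg2 + D) / ((1 - \<rho>)\<^sup>2 * real K))"
        unfolding lam_def sn(2)[symmetric] sK(2)[symmetric] distrib_left[symmetric] by (simp add: power_mult_distrib power_divide mult_ac)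
      show ?thesis unfolding 1 2 3 ..
    qed
    also have "\<dots> \<le> T * ((E0 / c_theta + c_theta * curv * nu) * (C1 \<Delta> (\<delta>f\<^sup>2) (\<delta>g\<^sup>2) (\<sigma>f\<^sup>2) (\<sigma>g\<^sup>2) / (sn * sK))
        + 44 * coup * c_theta\<^sup>2 * nu * (real n * (Sg2 + D) / ((1 - \<rho>)\<^sup>2 * real K)))"
    proof -
      have c1: "\<Delta> \<le> C1 \<Delta> (\<delta>f\<^sup>2) (\<delta>g\<^sup>2) (\<sigma>f\<^sup>2) (\<sigma>g\<^sup>2)" "D \<le> C1 \<Delta> (\<delta>f\<^sup>2) (\<delta>g\<^sup>2) (\<sigma>f\<^sup>2) (\<sigma>g\<^sup>2)"
        using \<Delta>0 D0 by (simp_all add: C1_def D_def)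
      have "E0 / c_theta * \<Delta> / (sn * sK) + c_theta * curv * nu * D / (sn * sK)
         \<le> E0 / c_theta * C1 \<Delta> (\<delta>f\<^sup>2) (\<delta>g\<^sup>2) (\<sigma>f\<^sup>2) (\<sigma>g\<^sup>2) / (sn * sK) + c_theta * curv * nu * C1 \<Delta> (\<delta>f\<^sup>2) (\<delta>g\<^sup>2) (\<sigma>f\<^sup>2) (\<sigma>g\<^sup>2) / (sn * sK)"
        using sn sK E0 curv nu assms by (intro add_mono divide_right_mono mult_left_mono c1) auto
      also have "\<dots> = (E0 / c_theta + c_theta * curv * nu) * (C1 \<Delta> (\<delta>f\<^sup>2) (\<delta>g\<^sup>2) (\<sigma>f\<^sup>2) (\<sigma>g\<^sup>2) / (sn * sK))"
        by (simp only: distrib_right times_divide_eq_right add_divide_distrib)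
      finally show ?thesis using T by (intro mult_left_mono add_right_mono) auto
    qed
    also have "\<dots> = A1 * (C1 \<Delta> (\<delta>f\<^sup>2) (\<delta>g\<^sup>2) (\<sigma>f\<^sup>2) (\<sigma>g\<^sup>2) / (sn * sK))
        + A2 * (real n * D / ((1 - \<rho>)\<^sup>2 * real K)) + A2 * (real n * Sg2 / ((1 - \<rho>)\<^sup>2 * real K))"
      by (simp add: A1_def A2_def algebra_simps add_divide_distrib)
    finally show "1 / real K * (\<Sum>k<K. \<integral>\<omega>. (norm (grad (Psi \<gamma> F G (\<mu> k)) (mean n (\<lambda>i. x k i \<omega>), mean n (\<lambda>i. y k i \<omega>))))\<^sup>2 \<partial>M)
      \<le> A1 * (C1 (initial_gap n \<gamma> F G F_low \<theta>0 x0 y0) (\<delta>f\<^sup>2) (\<delta>g\<^sup>2) (\<sigma>f\<^sup>2) (\<sigma>g\<^sup>2)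
               / (real n powr (1 / 2) * real K powr (1 / 2)))
        + A2 * (real n * (\<delta>f\<^sup>2 + \<delta>g\<^sup>2) / ((1 - \<rho>)\<^sup>2 * real K))
        + A2 * (real n * (\<sigma>f\<^sup>2 + \<sigma>g\<^sup>2) / ((1 - \<rho>)\<^sup>2 * real K))"
      unfolding \<Delta>_def D_def Sg2_def sn_def sK_def .
  qed
qed

end
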